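(* Let $(E,h)$ be a Hermitian holomorphic vector bundle of rank $r$ over a complex manifold $X$ of dimension $n$, let $\rho=(\rho_0,\dots,\rho_m)$ be a dimension sequence ($0=\rho_0<\rho_1<\dots<\rho_m=r$) and $\pi_\rho\colon\mathbb{F}_\rho(E)\to X$ the associated flag bundle. Choose a point $(x_0,\mathbf{f}_0)\in\mathbb{F}_\rho(E)$ and let $(e_1,\dots,e_r)$ be a local normal coordinate frame of $(E,h)$ at $x_0$ (with respect to local holomorphic coordinates $z=(z_1,\dots,z_n)$ of $X$ centered at $x_0$) which identifies the flag $\mathbf{f}_0$, i.e. the $\rho_l$-dimensional subspace of $\mathbf{f}_0$ is $\operatorname{Span}\{e_{r-\rho_l+1}(x_0),\dots,e_r(x_0)\}$ for each $l$. Let $(z,\zeta)$ be the induced local holomorphic coordinates on $\mathbb{F}_\rho(E)$ centered at $(x_0,\mathbf{f}_0)$. Then for any $0\le\ell<l\le m$ the Chern curvature $\Theta(U_{\rho,l}/U_{\rho,\ell},h_{\rho,(l,\ell)})$ at $(x_0,\mathbf{f}_0)$ equals $$\sum_{r-\rho_l<\alpha,\beta\le r-\rho_\ell}\Bigl(\Theta_{\beta\alpha}-\sum_{1\le\lambda\le r-\rho_l}d\zeta_{\lambda\alpha}\wedge d\bar\zeta_{\lambda\beta}+\sum_{r-\rho_\ell<\mu\le r}d\zeta_{\beta\mu}\wedge d\bar\zeta_{\alpha\mu}\Bigr)\otimes e_\alpha^\vee\otimes e_\beta .$$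
   Context: Flag bundle: the fiber of $\pi_\rho$ over $x$ is the manifold of flags $\{0\}=V_{x,\rho_0}\subset V_{x,\rho_1}\subset\dots\subset V_{x,\rho_m}=E_x$ with $\dim_{\mathbb C}V_{x,\rho_l}=\rho_l$. The tautological filtration is $(0)=U_{\rho,0}\subset U_{\rho,1}\subset\dots\subset U_{\rho,m}=\pi_\rho^*E$, with fiber of $U_{\rho,l}$ at a flag equal to $V_{x,\rho_l}$. $U_{\rho,l}$ carries the restriction metric $h_{\rho,l}=\pi_\rho^*h|_{U_{\rho,l}}$ and $U_{\rho,l}/U_{\rho,\ell}$ carries the quotient metric $h_{\rho,(l,\ell)}$ of $h_{\rho,l}$ (for $\ell=0$ this is just $(U_{\rho,l},h_{\rho,l})$). Normal coordinate frame at $x_0$: a local holomorphic frame $(e_1,\dots,e_r)$ of $E$ with $\langle e_\alpha(z),e_\beta(z)\rangle_h=\delta_{\alpha\beta}-\sum_{j,k}c_{jk\alpha\beta}z_j\bar z_k+O(|z|^3)$, where the $c_{jk\alpha\beta}$ are the coefficients of the Chern curvature $\Theta(E,h)_{x_0}=\sum_{\alpha,\beta}\sum_{j,k}c_{jk\alpha\beta}\,dz_j\wedge d\bar z_k\otimes e_\alpha^\vee\otimes e_\beta$. Set $\Theta_{\beta\alpha}:=\sum_{1\le j,k\le n}c_{jk\alpha\beta}\,dz_j\wedge d\bar z_k$, identified with its pull-back by $\pi_\rho$. Coordinates $(z,\zeta)$: $\zeta=(\zeta_{\lambda\mu})$ is indexed by the pairs $(\lambda,\mu)$ for which there is $q\in\{1,\dots,m-1\}$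 with $1\le\lambda\le r-\rho_{m-q}<\mu\le r$. The point $(z,\zeta)$ is the flag in $E_z$ with $V_{z,\rho_l}=\operatorname{Span}\{\epsilon_{r-\rho_l+1}(z,\zeta),\dots,\epsilon_r(z,\zeta)\}$, where $\epsilon_\alpha(z,\zeta)=e_\alpha(z)+\sum_\lambda\zeta_{\lambda\alpha}e_\lambda(z)$, the sum being over all $\lambda<\alpha$ such that $(\lambda,\alpha)$ is an admissible pair. At $(x_0,\mathbf{f}_0)$ the fiber of $U_{\rho,l}/U_{\rho,\ell}$ has as basis the classes of $e_\alpha(x_0)$, $r-\rho_l<\alpha\le r-\rho_\ell$; these classes are denoted $e_\alpha$ and their dual basis $e_\alpha^\vee$ in the formula. Empty sums are zero. *)

theory Defs
  imports "HOL-Analysis.Analysis" "HOL-Algebra.Module" "HOL-Algebra.AbelCoset"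
begin

section \<open>Calculus on open subsets of \<open>\<complex>\<^sup>I\<close>\<close>

text \<open>
  For a finite index set \<open>I\<close>, the space \<open>\<complex>\<^sup>I\<close> consists of the functions \<open>'i \<Rightarrow> complex\<close> that are
  \<open>undefined\<close> outside \<open>I\<close>. Tangent vectors are functions \<open>'i \<Rightarrow> complex\<close> of which only the
  components in \<open>I\<close> matter; the real tangent space is identified with \<open>\<complex>\<^sup>I\<close> in the usual way.
\<close>

abbreviation cspace :: "'i set \<Rightarrow> ('i \<Rightarrow> complex) topology" where
  "cspace I \<equiv> product_topology (\<lambda>_. euclidean) I"

definition origin :: "'i set \<Rightarrow> 'i \<Rightarrow> complex" where
  "origin I = (\<lambda>i\<in>I. 0)"

text \<open>
  Real partial derivative in the direction \<open>c\<close> of the \<open>i\<close>-th coordinate: \<open>c = 1\<close> gives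
  \<open>\<partial>/\<partial>x\<^sub>i\<close> and \<open>c = \<i>\<close> gives \<open>\<partial>/\<partial>y\<^sub>i\<close>, where \<open>z\<^sub>i = x\<^sub>i + \<i> y\<^sub>i\<close>.
\<close>

definition coord_line :: "'i \<Rightarrow> complex \<Rightarrow> (('i \<Rightarrow> complex) \<Rightarrow> complex) \<Rightarrow> ('i \<Rightarrow> complex) \<Rightarrow> real \<Rightarrow> complex"
  where "coord_line i c f p = (\<lambda>t. f (p(i := p i + of_real t * c)))"

definition rpartial :: "'i \<Rightarrow> complex \<Rightarrow> (('i \<Rightarrow> complex) \<Rightarrow> complex) \<Rightarrow> ('i \<Rightarrow> complex) \<Rightarrow> complex"
  where "rpartial i c f p = vector_derivative (coord_line i c f p) (at 0)"

primrec Ck :: "nat \<Rightarrow> 'i set \<Rightarrow> ('i \<Rightarrow> complex) set \<Rightarrow> (('i \<Rightarrow> complex) \<Rightarrow> complex) \<Rightarrow> bool" where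
  "Ck 0 I \<Omega> f \<longleftrightarrow> continuous_map (subtopology (cspace I) \<Omega>) euclidean f"
| "Ck (Suc k) I \<Omega> f \<longleftrightarrow> continuous_map (subtopology (cspace I) \<Omega>) euclidean f \<and>
     (\<forall>i\<in>I. \<forall>c\<in>{1, \<i>}. (\<forall>p\<in>\<Omega>. coord_line i c f p differentiable (at 0)) \<and> Ck k I \<Omega> (rpartial i c f))"

definition smooth :: "'i set \<Rightarrow> ('i \<Rightarrow> complex) set \<Rightarrow> (('i \<Rightarrow> complex) \<Rightarrow> complex) \<Rightarrow> bool" where
  "smooth I \<Omega> f \<longleftrightarrow> (\<forall>k. Ck k I \<Omega> f)"

definition holo :: "'i set \<Rightarrow> ('i \<Rightarrow> complex) set \<Rightarrow> (('i \<Rightarrow> complex) \<Rightarrow> complex) \<Rightarrow> bool" where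
  "holo I \<Omega> f \<longleftrightarrow> smooth I \<Omega> f \<and>
     (\<forall>p\<in>\<Omega>. \<forall>i\<in>I. (\<lambda>w. f (p(i := w))) field_differentiable (at (p i)))"

text \<open>Complex-valued one-forms and two-forms at a point, as functions of real tangent vectors.\<close>

type_synonym 'i form1 = "('i \<Rightarrow> complex) \<Rightarrow> complex"
type_synonym 'i form2 = "('i \<Rightarrow> complex) \<Rightarrow> ('i \<Rightarrow> complex) \<Rightarrow> complex"

definition d_coord :: "'i \<Rightarrow> 'i form1" where
  "d_coord i v = v i"

definition d_coord_bar :: "'i \<Rightarrow> 'i form1" where
  "d_coord_bar i v = cnj (v i)"

definition wedge :: "'i form1 \<Rightarrow> 'i form1 \<Rightarrow> 'i form2" where
  "wedge a b u v = a u * b v - a v * b u"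

definition d_fun :: "'i set \<Rightarrow> (('i \<Rightarrow> complex) \<Rightarrow> complex) \<Rightarrow> ('i \<Rightarrow> complex) \<Rightarrow> 'i form1" where
  "d_fun I f p v =
     (\<Sum>i\<in>I. rpartial i 1 f p * of_real (Re (v i)) + rpartial i \<i> f p * of_real (Im (v i)))"


section \<open>Complex vector spaces, bases, quotients, Hermitian forms\<close>

definition complex_ring :: "complex ring" where
  "complex_ring = \<lparr>carrier = UNIV, mult = (*), one = 1, zero = 0, add = (+)\<rparr>"

definition lincomb :: "(complex, 'v) module \<Rightarrow> nat set \<Rightarrow> (nat \<Rightarrow> complex) \<Rightarrow> (nat \<Rightarrow> 'v) \<Rightarrow> 'v" where
  "lincomb V J c b = (\<Oplus>\<^bsub>V\<^esub>\<alpha>\<in>J. c \<alpha> \<odot>\<^bsub>V\<^esub> b \<alpha>)"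

definition lspan :: "(complex, 'v) module \<Rightarrow> nat set \<Rightarrow> (nat \<Rightarrow> 'v) \<Rightarrow> 'v set" where
  "lspan V J b = range (\<lambda>c. lincomb V J c b)"

definition is_basis :: "(complex, 'v) module \<Rightarrow> nat set \<Rightarrow> (nat \<Rightarrow> 'v) \<Rightarrow> bool" where
  "is_basis V J b \<longleftrightarrow> finite J \<and> b \<in> J \<rightarrow> carrier V \<and>
     (\<forall>v\<in>carrier V. \<exists>!c. c \<in> J \<rightarrow>\<^sub>E UNIV \<and> v = lincomb V J c b)"

definition has_dim :: "(complex, 'v) module \<Rightarrow> nat \<Rightarrow> bool" where
  "has_dim V k \<longleftrightarrow> (\<exists>b. is_basis V {1..k} b)"

definition dual_basis :: "(complex, 'v) module \<Rightarrow> nat set \<Rightarrow> (nat \<Rightarrow> 'v) \<Rightarrow> nat \<Rightarrow> 'v \<Rightarrow> complex" where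
  "dual_basis V J b \<alpha> v = (THE c. c \<in> J \<rightarrow>\<^sub>E UNIV \<and> v = lincomb V J c b) \<alpha>"

definition hermitian_inner :: "(complex, 'v) module \<Rightarrow> ('v \<Rightarrow> 'v \<Rightarrow> complex) \<Rightarrow> bool" where
  "hermitian_inner V h \<longleftrightarrow>
     (\<forall>u\<in>carrier V. \<forall>v\<in>carrier V. \<forall>w\<in>carrier V. h (u \<oplus>\<^bsub>V\<^esub> v) w = h u w + h v w) \<and>
     (\<forall>c. \<forall>u\<in>carrier V. \<forall>v\<in>carrier V. h (c \<odot>\<^bsub>V\<^esub> u) v = c * h u v) \<and>
     (\<forall>u\<in>carrier V. \<forall>v\<in>carrier V. h v u = cnj (h u v)) \<and>
     (\<forall>u\<in>carrier V. u \<noteq> \<zero>\<^bsub>V\<^esub> \<longrightarrow> Re (h u u) > 0)"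

text \<open>The fields \<open>mult\<close> and \<open>one\<close> play no role in the module axioms.\<close>

definition quot_module :: "(complex, 'v) module \<Rightarrow> 'v set \<Rightarrow> (complex, 'v set) module" where
  "quot_module V W =
     \<lparr>carrier = a_rcosets\<^bsub>V\<^esub> W, mult = undefined, one = undefined, zero = W, add = set_add V,
      smult = (\<lambda>c S. \<Union>u\<in>S. W +>\<^bsub>V\<^esub> (c \<odot>\<^bsub>V\<^esub> u))\<rparr>"

text \<open>Quotient metric: each class is represented by its element orthogonal to \<open>W\<close>.\<close>

definition orth_rep :: "('v \<Rightarrow> 'v \<Rightarrow> complex) \<Rightarrow> 'v set \<Rightarrow> 'v set \<Rightarrow> 'v" where
  "orth_rep h W S = (THE u. u \<in> S \<and> (\<forall>w\<in>W. h u w = 0))"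

definition quot_herm :: "('v \<Rightarrow> 'v \<Rightarrow> complex) \<Rightarrow> 'v set \<Rightarrow> 'v set \<Rightarrow> 'v set \<Rightarrow> complex" where
  "quot_herm h W S T = h (orth_rep h W S) (orth_rep h W T)"

text \<open>
  \<open>end_form V J b \<omega>\<close> is the two-form \<open>\<Sum>\<^sub>\<alpha>\<^sub>,\<^sub>\<beta> \<omega> \<beta> \<alpha> \<otimes> b\<^sub>\<alpha>\<^sup>\<or> \<otimes> b\<^sub>\<beta>\<close> with values in the
  endomorphisms of \<open>V\<close>.
\<close>

definition end_form :: "(complex, 'v) module \<Rightarrow> nat set \<Rightarrow> (nat \<Rightarrow> 'v) \<Rightarrow> (nat \<Rightarrow> nat \<Rightarrow> 'i form2)
    \<Rightarrow> ('i \<Rightarrow> complex) \<Rightarrow> ('i \<Rightarrow> complex) \<Rightarrow> 'v \<Rightarrow> 'v" where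
  "end_form V J b \<omega> u v =
     (\<lambda>y\<in>carrier V. lincomb V J (\<lambda>\<beta>. \<Sum>\<alpha>\<in>J. \<omega> \<beta> \<alpha> u v * dual_basis V J b \<alpha> y) b)"


section \<open>Complex manifolds\<close>

type_synonym ('x, 'i) chart = "'x set \<times> ('x \<Rightarrow> 'i \<Rightarrow> complex)"

definition is_chart :: "'i set \<Rightarrow> 'x set \<Rightarrow> ('x, 'i) chart \<Rightarrow> bool" where
  "is_chart I X \<kappa> \<longleftrightarrow> fst \<kappa> \<subseteq> X \<and> inj_on (snd \<kappa>) (fst \<kappa>) \<and> openin (cspace I) (snd \<kappa> ` fst \<kappa>)"

definition holo_transition :: "'i set \<Rightarrow> ('x, 'i) chart \<Rightarrow> ('x, 'i) chart \<Rightarrow> bool" where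
  "holo_transition I \<kappa> \<kappa>' \<longleftrightarrow>
     openin (cspace I) (snd \<kappa> ` (fst \<kappa> \<inter> fst \<kappa>')) \<and>
     (\<forall>i\<in>I. holo I (snd \<kappa> ` (fst \<kappa> \<inter> fst \<kappa>')) (\<lambda>w. snd \<kappa>' (inv_into (fst \<kappa>) (snd \<kappa>) w) i))"

definition atlas_open :: "'i set \<Rightarrow> ('x, 'i) chart set \<Rightarrow> 'x set \<Rightarrow> bool" where
  "atlas_open I A W \<longleftrightarrow>
     W \<subseteq> \<Union> (fst ` A) \<and> (\<forall>\<kappa>\<in>A. openin (cspace I) (snd \<kappa> ` (fst \<kappa> \<inter> W)))"

text \<open>A complex manifold of dimension \<open>card I\<close>, given by its maximal holomorphic atlas \<open>A\<close>.\<close>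

definition complex_manifold :: "'i set \<Rightarrow> 'x set \<Rightarrow> ('x, 'i) chart set \<Rightarrow> bool" where
  "complex_manifold I X A \<longleftrightarrow> finite I \<and>
     (\<forall>\<kappa>\<in>A. is_chart I X \<kappa>) \<and> \<Union> (fst ` A) = X \<and>
     (\<forall>\<kappa>\<in>A. \<forall>\<kappa>'\<in>A. holo_transition I \<kappa> \<kappa>') \<and>
     (\<forall>\<kappa>. is_chart I X \<kappa> \<and> (\<forall>\<kappa>'\<in>A. holo_transition I \<kappa> \<kappa>' \<and> holo_transition I \<kappa>' \<kappa>) \<longrightarrow> \<kappa> \<in> A) \<and>
     Hausdorff_space (topology (atlas_open I A)) \<and> second_countable (topology (atlas_open I A))"

definition smooth_fun :: "'i set \<Rightarrow> ('x, 'i) chart set \<Rightarrow> 'x set \<Rightarrow> ('x \<Rightarrow> complex) \<Rightarrow> bool" where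
  "smooth_fun I A W f \<longleftrightarrow>
     (\<forall>\<kappa>\<in>A. smooth I (snd \<kappa> ` (fst \<kappa> \<inter> W)) (\<lambda>w. f (inv_into (fst \<kappa>) (snd \<kappa>) w)))"

definition holo_fun :: "'i set \<Rightarrow> ('x, 'i) chart set \<Rightarrow> 'x set \<Rightarrow> ('x \<Rightarrow> complex) \<Rightarrow> bool" where
  "holo_fun I A W f \<longleftrightarrow>
     (\<forall>\<kappa>\<in>A. holo I (snd \<kappa> ` (fst \<kappa> \<inter> W)) (\<lambda>w. f (inv_into (fst \<kappa>) (snd \<kappa>) w)))"


section \<open>Hermitian holomorphic vector bundles and their Chern curvature\<close>

text \<open>
  The holomorphic structure of a vector bundle is recorded by its local holomorphic frames
  \<open>(U, s)\<close>, equivalently its local holomorphic trivialisations; \<open>s \<alpha> x\<close> is the value at \<open>x\<close> of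
  the section with index \<open>\<alpha>\<close> in the finite set \<open>idx\<close>, whose cardinality is the rank. The metric
  \<open>herm\<close> is linear in its first argument.
\<close>

record ('x, 'v) hbundle =
  fib :: "'x \<Rightarrow> (complex, 'v) module"
  idx :: "nat set"
  frames :: "('x set \<times> (nat \<Rightarrow> 'x \<Rightarrow> 'v)) set"
  herm :: "'x \<Rightarrow> 'v \<Rightarrow> 'v \<Rightarrow> complex"

definition is_frame :: "'i set \<Rightarrow> ('x, 'i) chart set \<Rightarrow> ('x, 'v) hbundle \<Rightarrow> 'x set \<times> (nat \<Rightarrow> 'x \<Rightarrow> 'v) \<Rightarrow> bool"
  where "is_frame I A E \<sigma> \<longleftrightarrow>
     atlas_open I A (fst \<sigma>) \<and> (\<forall>x\<in>fst \<sigma>. is_basis (fib E x) (idx E) (\<lambda>\<alpha>. snd \<sigma> \<alpha> x))"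

definition holo_change :: "'i set \<Rightarrow> ('x, 'i) chart set \<Rightarrow> ('x, 'v) hbundle \<Rightarrow>
    'x set \<times> (nat \<Rightarrow> 'x \<Rightarrow> 'v) \<Rightarrow> 'x set \<times> (nat \<Rightarrow> 'x \<Rightarrow> 'v) \<Rightarrow> bool"
  where "holo_change I A E \<sigma> \<tau> \<longleftrightarrow>
     (\<exists>g. (\<forall>\<alpha>\<in>idx E. \<forall>\<beta>\<in>idx E. holo_fun I A (fst \<sigma> \<inter> fst \<tau>) (g \<alpha> \<beta>)) \<and>
          (\<forall>x\<in>fst \<sigma> \<inter> fst \<tau>. \<forall>\<beta>\<in>idx E.
             snd \<tau> \<beta> x = lincomb (fib E x) (idx E) (\<lambda>\<alpha>. g \<alpha> \<beta> x) (\<lambda>\<alpha>. snd \<sigma> \<alpha> x)))"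

definition hermitian_holomorphic_bundle ::
  "'i set \<Rightarrow> 'x set \<Rightarrow> ('x, 'i) chart set \<Rightarrow> ('x, 'v) hbundle \<Rightarrow> bool" where
  "hermitian_holomorphic_bundle I X A E \<longleftrightarrow> finite (idx E) \<and>
     (\<forall>x\<in>X. module complex_ring (fib E x) \<and> hermitian_inner (fib E x) (herm E x)) \<and>
     (\<forall>\<sigma>\<in>frames E. is_frame I A E \<sigma>) \<and> \<Union> (fst ` frames E) = X \<and>
     (\<forall>\<sigma>\<in>frames E. \<forall>\<tau>\<in>frames E. holo_change I A E \<sigma> \<tau>) \<and>
     (\<forall>\<sigma>. is_frame I A E \<sigma> \<and> (\<forall>\<tau>\<in>frames E. holo_change I A E \<sigma> \<tau> \<and> holo_change I A E \<tau> \<sigma>)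
        \<longrightarrow> \<sigma> \<in> frames E) \<and>
     (\<forall>(U, s)\<in>frames E. \<forall>\<alpha>\<in>idx E. \<forall>\<beta>\<in>idx E.
        smooth_fun I A U (\<lambda>x. herm E x (s \<alpha> x) (s \<beta> x)))"

text \<open>
  The Chern connection in a holomorphic frame with Gram matrix \<open>H\<close> on \<open>\<Omega> \<subseteq> \<complex>\<^sup>I\<close>. The connection
  matrix \<open>D s\<^sub>\<alpha> = \<Sum>\<^sub>\<beta> A \<beta> \<alpha> \<otimes> s\<^sub>\<beta>\<close> is of type (1,0), \<open>A \<beta> \<alpha> = \<Sum>\<^sub>i a \<beta> \<alpha> i dz\<^sub>i\<close>, since the
  (0,1)-part of \<open>D\<close> is the Cauchy-Riemann operator and the frame is holomorphic; the second
  condition is compatibility with the metric.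
\<close>

definition conn_form :: "'i set \<Rightarrow> ('i \<Rightarrow> ('i \<Rightarrow> complex) \<Rightarrow> complex) \<Rightarrow> ('i \<Rightarrow> complex) \<Rightarrow> 'i form1" where
  "conn_form I a p v = (\<Sum>i\<in>I. a i p * d_coord i v)"

definition chern_connection :: "'i set \<Rightarrow> ('i \<Rightarrow> complex) set \<Rightarrow> nat set \<Rightarrow>
    (nat \<Rightarrow> nat \<Rightarrow> ('i \<Rightarrow> complex) \<Rightarrow> complex) \<Rightarrow>
    (nat \<Rightarrow> nat \<Rightarrow> 'i \<Rightarrow> ('i \<Rightarrow> complex) \<Rightarrow> complex) \<Rightarrow> bool" where
  "chern_connection I \<Omega> J H a \<longleftrightarrow>
     (\<forall>\<alpha>\<in>J. \<forall>\<beta>\<in>J. \<forall>i\<in>I. smooth I \<Omega> (a \<beta> \<alpha> i)) \<and>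
     (\<forall>p\<in>\<Omega>. \<forall>\<alpha>\<in>J. \<forall>\<beta>\<in>J. \<forall>v. d_fun I (H \<alpha> \<beta>) p v =
        (\<Sum>\<gamma>\<in>J. conn_form I (a \<gamma> \<alpha>) p v * H \<gamma> \<beta> p) +
        (\<Sum>\<gamma>\<in>J. cnj (conn_form I (a \<gamma> \<beta>) p v) * H \<alpha> \<gamma> p))"

text \<open>The curvature matrix \<open>dA + A \<and> A\<close>.\<close>

definition curvature_matrix :: "'i set \<Rightarrow> nat set \<Rightarrow>
    (nat \<Rightarrow> nat \<Rightarrow> 'i \<Rightarrow> ('i \<Rightarrow> complex) \<Rightarrow> complex) \<Rightarrow> ('i \<Rightarrow> complex) \<Rightarrow> nat \<Rightarrow> nat \<Rightarrow> 'i form2" where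
  "curvature_matrix I J a p \<beta> \<alpha> u v =
     (\<Sum>i\<in>I. wedge (d_fun I (a \<beta> \<alpha> i) p) (d_coord i) u v) +
     (\<Sum>\<gamma>\<in>J. wedge (conn_form I (a \<beta> \<gamma>) p) (conn_form I (a \<gamma> \<alpha>) p) u v)"

text \<open>
  \<open>\<Theta>\<close> is the Chern curvature of \<open>B\<close> at \<open>p\<close>, its form part being expressed in the coordinates \<open>\<kappa>\<close>.
  The curvature does not depend on the holomorphic frame used to compute it.
\<close>

definition has_chern_curvature :: "'i set \<Rightarrow> ('x, 'i) chart \<Rightarrow> ('x, 'v) hbundle \<Rightarrow> 'x \<Rightarrow>
    (('i \<Rightarrow> complex) \<Rightarrow> ('i \<Rightarrow> complex) \<Rightarrow> 'v \<Rightarrow> 'v) \<Rightarrow> bool" where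
  "has_chern_curvature I \<kappa> B p \<Theta> \<longleftrightarrow>
     (\<exists>W s a. \<exists>H :: nat \<Rightarrow> nat \<Rightarrow> ('i \<Rightarrow> complex) \<Rightarrow> complex.
        (W, s) \<in> frames B \<and> p \<in> W \<and> W \<subseteq> fst \<kappa> \<and> openin (cspace I) (snd \<kappa> ` W) \<and>
        H = (\<lambda>\<alpha> \<beta> w. let y = inv_into (fst \<kappa>) (snd \<kappa>) w in herm B y (s \<alpha> y) (s \<beta> y)) \<and>
        (\<forall>\<alpha>\<in>idx B. \<forall>\<beta>\<in>idx B. smooth I (snd \<kappa> ` W) (H \<alpha> \<beta>)) \<and>
        chern_connection I (snd \<kappa> ` W) (idx B) H a \<and>
        \<Theta> = end_form (fib B p) (idx B) (\<lambda>\<alpha>. s \<alpha> p) (curvature_matrix I (idx B) a (snd \<kappa> p)))"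

text \<open>
  \<open>normal_frame n (U, z) E e x\<^sub>0 c\<close>: on the coordinate neighbourhood \<open>U\<close>, with coordinates \<open>z\<close>
  centred at \<open>x\<^sub>0\<close>, \<open>e\<close> is a normal coordinate frame, and \<open>c j k \<alpha> \<beta>\<close> are the curvature coefficients.
\<close>

definition base_curv :: "nat \<Rightarrow> (nat \<Rightarrow> 'i) \<Rightarrow> (nat \<Rightarrow> nat \<Rightarrow> nat \<Rightarrow> nat \<Rightarrow> complex) \<Rightarrow> nat \<Rightarrow> nat \<Rightarrow> 'i form2" where
  "base_curv n \<iota> c \<beta> \<alpha> u v =
     (\<Sum>j\<in>{1..n}. \<Sum>k\<in>{1..n}. c j k \<alpha> \<beta> * wedge (d_coord (\<iota> j)) (d_coord_bar (\<iota> k)) u v)"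

definition normal_frame :: "nat \<Rightarrow> ('x, nat) chart \<Rightarrow> ('x, 'v) hbundle \<Rightarrow> (nat \<Rightarrow> 'x \<Rightarrow> 'v) \<Rightarrow> 'x \<Rightarrow>
    (nat \<Rightarrow> nat \<Rightarrow> nat \<Rightarrow> nat \<Rightarrow> complex) \<Rightarrow> bool" where
  "normal_frame n \<kappa> E e x\<^sub>0 c \<longleftrightarrow>
     (fst \<kappa>, e) \<in> frames E \<and> x\<^sub>0 \<in> fst \<kappa> \<and> snd \<kappa> x\<^sub>0 = origin {1..n} \<and>
     has_chern_curvature {1..n} \<kappa> E x\<^sub>0
       (end_form (fib E x\<^sub>0) (idx E) (\<lambda>\<alpha>. e \<alpha> x\<^sub>0) (base_curv n id c)) \<and>
     (\<forall>\<alpha>\<in>idx E. \<forall>\<beta>\<in>idx E. \<exists>C. \<exists>\<epsilon>>0. \<forall>x\<in>fst \<kappa>. L2_set (\<lambda>j. norm (snd \<kappa> x j)) {1..n} < \<epsilon> \<longrightarrow>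
        norm (herm E x (e \<alpha> x) (e \<beta> x) -
              ((if \<alpha> = \<beta> then 1 else 0) -
               (\<Sum>j\<in>{1..n}. \<Sum>k\<in>{1..n}. c j k \<alpha> \<beta> * snd \<kappa> x j * cnj (snd \<kappa> x k))))
          \<le> C * L2_set (\<lambda>j. norm (snd \<kappa> x j)) {1..n} ^ 3)"


section \<open>Flag bundles\<close>

definition dimension_sequence :: "nat \<Rightarrow> nat \<Rightarrow> (nat \<Rightarrow> nat) \<Rightarrow> bool" where
  "dimension_sequence r m \<rho> \<longleftrightarrow> \<rho> 0 = 0 \<and> strict_mono_on {..m} \<rho> \<and> \<rho> m = r"

type_synonym ('x, 'v) flag = "'x \<times> (nat \<Rightarrow> 'v set)"

definition flag_bundle :: "'x set \<Rightarrow> ('x, 'v) hbundle \<Rightarrow> nat \<Rightarrow> (nat \<Rightarrow> nat) \<Rightarrow> ('x, 'v) flag set" where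
  "flag_bundle X E m \<rho> = {(x, V). x \<in> X \<and> V \<in> extensional {..m} \<and>
     V 0 = {\<zero>\<^bsub>fib E x\<^esub>} \<and> V m = carrier (fib E x) \<and> (\<forall>l<m. V l \<subseteq> V (Suc l)) \<and>
     (\<forall>l\<le>m. submodule (V l) complex_ring (fib E x) \<and> has_dim ((fib E x)\<lparr>carrier := V l\<rparr>) (\<rho> l))}"

definition admissible :: "nat \<Rightarrow> nat \<Rightarrow> (nat \<Rightarrow> nat) \<Rightarrow> (nat \<times> nat) set" where
  "admissible r m \<rho> = {(\<nu>, \<mu>). \<exists>q\<in>{1..m - 1}. 1 \<le> \<nu> \<and> \<nu> \<le> r - \<rho> (m - q) \<and> r - \<rho> (m - q) < \<mu> \<and> \<mu> \<le> r}"

text \<open>Coordinate \<open>Inl j\<close> is \<open>z\<^sub>j\<close>, and coordinate \<open>Inr (\<lambda>, \<mu>)\<close> is \<open>\<zeta>\<^sub>\<lambda>\<^sub>\<mu>\<close>.\<close>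

definition flag_index :: "nat \<Rightarrow> nat \<Rightarrow> nat \<Rightarrow> (nat \<Rightarrow> nat) \<Rightarrow> (nat + nat \<times> nat) set" where
  "flag_index n r m \<rho> = Inl ` {1..n} \<union> Inr ` admissible r m \<rho>"

definition eps :: "(complex, 'v) module \<Rightarrow> nat \<Rightarrow> nat \<Rightarrow> (nat \<Rightarrow> nat) \<Rightarrow> (nat \<Rightarrow> 'v) \<Rightarrow> (nat \<times> nat \<Rightarrow> complex) \<Rightarrow>
    nat \<Rightarrow> 'v" where
  "eps V r m \<rho> b \<zeta> \<alpha> =
     b \<alpha> \<oplus>\<^bsub>V\<^esub> lincomb V {\<nu>. \<nu> < \<alpha> \<and> (\<nu>, \<alpha>) \<in> admissible r m \<rho>} (\<lambda>\<nu>. \<zeta> (\<nu>, \<alpha>)) b"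

definition flag_dom :: "nat \<Rightarrow> nat \<Rightarrow> nat \<Rightarrow> (nat \<Rightarrow> nat) \<Rightarrow> ('x, nat) chart \<Rightarrow> (nat + nat \<times> nat \<Rightarrow> complex) set" where
  "flag_dom n r m \<rho> \<kappa> = {w \<in> topspace (cspace (flag_index n r m \<rho>)). (\<lambda>j\<in>{1..n}. w (Inl j)) \<in> snd \<kappa> ` fst \<kappa>}"

definition flag_param :: "nat \<Rightarrow> nat \<Rightarrow> nat \<Rightarrow> (nat \<Rightarrow> nat) \<Rightarrow> ('x, 'v) hbundle \<Rightarrow> ('x, nat) chart \<Rightarrow>
    (nat \<Rightarrow> 'x \<Rightarrow> 'v) \<Rightarrow> (nat + nat \<times> nat \<Rightarrow> complex) \<Rightarrow> ('x, 'v) flag" where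
  "flag_param n r m \<rho> E \<kappa> e w =
     (let x = inv_into (fst \<kappa>) (snd \<kappa>) (\<lambda>j\<in>{1..n}. w (Inl j)) in
      (x, \<lambda>l\<in>{..m}. lspan (fib E x) {r - \<rho> l<..r}
                      (eps (fib E x) r m \<rho> (\<lambda>\<alpha>. e \<alpha> x) (\<lambda>p. w (Inr p)))))"

definition flag_chart :: "nat \<Rightarrow> nat \<Rightarrow> nat \<Rightarrow> (nat \<Rightarrow> nat) \<Rightarrow> ('x, 'v) hbundle \<Rightarrow> ('x, nat) chart \<Rightarrow>
    (nat \<Rightarrow> 'x \<Rightarrow> 'v) \<Rightarrow> (('x, 'v) flag, nat + nat \<times> nat) chart" where
  "flag_chart n r m \<rho> E \<kappa> e =
     (flag_param n r m \<rho> E \<kappa> e ` flag_dom n r m \<rho> \<kappa>,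
      inv_into (flag_dom n r m \<rho> \<kappa>) (flag_param n r m \<rho> E \<kappa> e))"

text \<open>
  The complex structure of the flag bundle is the one for which all the \<open>flag_chart\<close>s (over charts
  \<open>\<kappa>\<close> of \<open>X\<close> and holomorphic frames \<open>e\<close> of \<open>E\<close>) are holomorphic charts. These are mutually
  compatible, so holomorphy near a point may be tested in any one of them.

  \<open>holo_pullback_section\<close>: \<open>N\<close> is open in the flag bundle and \<open>t\<close> is a holomorphic section over \<open>N\<close>
  of the pull-back of \<open>E\<close>.
\<close>

definition holo_pullback_section :: "nat \<Rightarrow> nat \<Rightarrow> nat \<Rightarrow> (nat \<Rightarrow> nat) \<Rightarrow> ('x, nat) chart set \<Rightarrow>
    ('x, 'v) hbundle \<Rightarrow> ('x, 'v) flag set \<Rightarrow> (('x, 'v) flag \<Rightarrow> 'v) \<Rightarrow> bool" where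
  "holo_pullback_section n r m \<rho> A E N t \<longleftrightarrow>
     (\<forall>y\<in>N. \<exists>\<kappa>\<in>A. \<exists>e \<phi> G g. (fst \<kappa>, e) \<in> frames E \<and> \<phi> = flag_chart n r m \<rho> E \<kappa> e \<and>
        y \<in> G \<and> G \<subseteq> fst \<phi> \<inter> N \<and> openin (cspace (flag_index n r m \<rho>)) (snd \<phi> ` G) \<and>
        (\<forall>\<gamma>\<in>idx E. holo (flag_index n r m \<rho>) (snd \<phi> ` G) (g \<gamma>)) \<and>
        (\<forall>y'\<in>G. t y' = lincomb (fib E (fst y')) (idx E) (\<lambda>\<gamma>. g \<gamma> (snd \<phi> y')) (\<lambda>\<gamma>. e \<gamma> (fst y'))))"

definition taut_fib :: "('x, 'v) hbundle \<Rightarrow> nat \<Rightarrow> ('x, 'v) flag \<Rightarrow> (complex, 'v) module" where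
  "taut_fib E l y = (fib E (fst y))\<lparr>carrier := snd y l\<rparr>"

text \<open>
  The bundle \<open>U\<^sub>\<rho>\<^sub>,\<^sub>l / U\<^sub>\<rho>\<^sub>,\<^sub>k\<close> with \<open>k < l\<close>. A frame is holomorphic if it lifts locally to
  holomorphic sections of \<open>U\<^sub>\<rho>\<^sub>,\<^sub>l\<close>, i.e. to holomorphic sections of the pull-back of \<open>E\<close> with values
  in \<open>U\<^sub>\<rho>\<^sub>,\<^sub>l\<close>. The metric is the quotient of the restriction of the pull-back metric.
\<close>

definition taut_quotient :: "nat \<Rightarrow> nat \<Rightarrow> nat \<Rightarrow> (nat \<Rightarrow> nat) \<Rightarrow> 'x set \<Rightarrow> ('x, nat) chart set \<Rightarrow>
    ('x, 'v) hbundle \<Rightarrow> nat \<Rightarrow> nat \<Rightarrow> (('x, 'v) flag, 'v set) hbundle" where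
  "taut_quotient n r m \<rho> X A E l k =
     \<lparr>fib = (\<lambda>y. quot_module (taut_fib E l y) (snd y k)),
      idx = {r - \<rho> l<..r - \<rho> k},
      frames = {(W, s). W \<subseteq> flag_bundle X E m \<rho> \<and>
        (\<forall>y\<in>W. is_basis (quot_module (taut_fib E l y) (snd y k)) {r - \<rho> l<..r - \<rho> k} (\<lambda>\<alpha>. s \<alpha> y)) \<and>
        (\<forall>y\<in>W. \<exists>N t. y \<in> N \<and> N \<subseteq> W \<and> (\<forall>\<alpha>\<in>{r - \<rho> l<..r - \<rho> k}.
           holo_pullback_section n r m \<rho> A E N (t \<alpha>) \<and>
           (\<forall>y'\<in>N. t \<alpha> y' \<in> snd y' l \<and> s \<alpha> y' = snd y' k +>\<^bsub>fib E (fst y')\<^esub> t \<alpha> y')))},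
      herm = (\<lambda>y. quot_herm (herm E (fst y)) (snd y k))\<rparr>"

end

theory Submission
  imports Defs "HOL-Library.Landau_Symbols"
begin

text \<open>
  Over a whole flag chart, the classes of \<open>\<epsilon>\<^sub>\<alpha>\<close>, \<open>r - \<rho>\<^sub>l < \<alpha> \<le> r - \<rho>\<^sub>k\<close>, form a holomorphic frame of
  \<open>U\<^sub>l / U\<^sub>k\<close>. If \<open>G\<close> is the Gram matrix of the \<open>\<epsilon>\<^sub>\<alpha>\<close>, the Gram matrix of these classes is
  \<open>H\<^sub>\<alpha>\<^sub>\<beta> = G\<^sub>\<alpha>\<^sub>\<beta> - \<Sum>\<^sub>\<mu> q\<^sub>\<alpha>\<^sub>\<mu> G\<^sub>\<mu>\<^sub>\<beta>\<close>, where \<open>q\<close> solves \<open>\<Sum>\<^sub>\<mu> q\<^sub>\<alpha>\<^sub>\<mu> G\<^sub>\<mu>\<^sub>\<nu> = G\<^sub>\<alpha>\<^sub>\<nu>\<close> for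
  \<open>r - \<rho>\<^sub>k < \<mu>, \<nu> \<le> r\<close>. The normal frame gives, modulo third order terms,
  \<open>G\<^sub>\<alpha>\<^sub>\<beta> = \<delta>\<^sub>\<alpha>\<^sub>\<beta> + \<zeta>\<^sub>\<beta>\<^sub>\<alpha> + cnj \<zeta>\<^sub>\<alpha>\<^sub>\<beta> + \<Sum>\<^sub>\<gamma> \<zeta>\<^sub>\<gamma>\<^sub>\<alpha> cnj \<zeta>\<^sub>\<gamma>\<^sub>\<beta> - \<Sum>\<^sub>j\<^sub>k c\<^sub>j\<^sub>k\<^sub>\<alpha>\<^sub>\<beta> z\<^sub>j cnj z\<^sub>k\<close>,
  and hence \<open>H\<^sub>\<alpha>\<^sub>\<beta> = G\<^sub>\<alpha>\<^sub>\<beta> - \<Sum>\<^sub>\<mu> \<zeta>\<^sub>\<beta>\<^sub>\<mu> cnj \<zeta>\<^sub>\<alpha>\<^sub>\<mu>\<close>. The curvature at the origin only depends on this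
  2-jet of \<open>H\<close>: differentiating \<open>\<Sum>\<^sub>\<gamma> A\<^sub>\<gamma>\<^sub>\<alpha> H\<^sub>\<gamma>\<^sub>\<beta> = \<partial>H\<^sub>\<alpha>\<^sub>\<beta>\<close> expresses \<open>dA\<close> by derivatives of \<open>H\<close>.
\<close>


section \<open>Calculus of \<open>C\<^sup>k\<close> functions\<close>

text \<open>The remainder after the 2-jet is only known to be smooth and \<open>O(|w|^3)\<close>,
  and a bound of this kind cannot simply be differentiated. Its first and second partial derivatives
  at the origin are shown to vanish by difference quotients along real lines; this is what allows
  the estimate in the definition of a normal frame to determine a curvature. The definition of the
  curvature asks for a frame, a smooth Gram matrix and a smooth connection on a whole open set
  around the point. Hence both linear systems, the one for \<open>q\<close> and the one for the
  connection matrix \<open>A\<close>, are solved with smooth solutions on the entire chart, and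
  nondegeneracy of the Gram matrices is established at each of its points. Finally, the coordinates
  of \<open>flag_chart\<close> are given by \<open>inv_into\<close>, so nothing can be computed in
  them before the flag parametrisation is known to be injective.\<close>

definition shift :: "'i \<Rightarrow> complex \<Rightarrow> ('i \<Rightarrow> complex) \<Rightarrow> 'i \<Rightarrow> complex" where
  "shift i x p = p(i := p i + x)"

lemma shift_commute: "shift i x (shift j y p) = shift j y (shift i x p)"
  by (auto simp: shift_def fun_eq_iff)

lemma shift_add: "shift i x (shift i y p) = shift i (x + y) p"
  by (auto simp: shift_def fun_eq_iff)

lemma shift_zero [simp]: "shift i 0 p = p"
  by (simp add: shift_def)

lemma coord_line_shift: "coord_line i c f p t = f (shift i (of_real t * c) p)"
  by (simp add: coord_line_def shift_def)

text \<open>The case \<open>i = j\<close> is included: the two moves then add up in one coordinate,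
  and pure second derivatives are treated like mixed ones.\<close>

lemma continuous_map_shift2:
  assumes "p \<in> topspace (cspace I)" "i \<in> I" "j \<in> I"
  shows "continuous_map euclidean (cspace I) (\<lambda>(x, y). shift i x (shift j y p))"
proof -
  have "continuous_map euclidean euclidean (\<lambda>xy. (case xy of (x, y) \<Rightarrow> shift i x (shift j y p)) k)" for k
    by (cases "k = i"; cases "k = j") (auto simp: shift_def case_prod_beta intro!: continuous_intros)
  then show ?thesis
    using assms by (auto simp: continuous_map_componentwise shift_def extensional_def image_subset_iff PiE_def)
qed

lemma continuous_map_shift:
  assumes "p \<in> topspace (cspace I)" "i \<in> I"
  shows "continuous_map euclidean (cspace I) (\<lambda>x. shift i x p)"
proof -
  have "continuous_map euclidean euclidean (\<lambda>x. shift i x p k)" for k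
    by (auto simp: shift_def intro!: continuous_intros)
  then show ?thesis
    using assms by (auto simp: continuous_map_componentwise shift_def extensional_def image_subset_iff PiE_def)
qed

text \<open>Existence and value in one relation, since \<open>rpartial\<close> alone returns an
  arbitrary value where the derivative does not exist.\<close>

definition pderiv_at :: "'i \<Rightarrow> complex \<Rightarrow> (('i \<Rightarrow> complex) \<Rightarrow> complex) \<Rightarrow> ('i \<Rightarrow> complex) \<Rightarrow> complex \<Rightarrow> bool" where
  "pderiv_at i c f p D \<longleftrightarrow> (coord_line i c f p has_vector_derivative D) (at 0)"

lemma pderiv_at_rpartial: "pderiv_at i c f p D \<Longrightarrow> rpartial i c f p = D"
  by (auto simp: pderiv_at_def rpartial_def intro: vector_derivative_at)

lemma differentiable_pderiv_at: "coord_line i c f p differentiable (at 0) \<longleftrightarrow> pderiv_at i c f p (rpartial i c f p)"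
  by (auto simp: pderiv_at_def rpartial_def vector_derivative_works)

lemma pderiv_at_const: "pderiv_at i c (\<lambda>_. a) p 0"
  by (simp add: pderiv_at_def coord_line_def)

lemma pderiv_at_add: "pderiv_at i c f p D \<Longrightarrow> pderiv_at i c g p E \<Longrightarrow> pderiv_at i c (\<lambda>p. f p + g p) p (D + E)"
  unfolding pderiv_at_def coord_line_def by (rule has_vector_derivative_add)

lemma pderiv_at_mult:
  "pderiv_at i c f p D \<Longrightarrow> pderiv_at i c g p E \<Longrightarrow> pderiv_at i c (\<lambda>p. f p * g p) p (f p * E + D * g p)"
  unfolding pderiv_at_def coord_line_def by (drule (1) has_vector_derivative_mult) simp

lemma pderiv_at_cnj: "pderiv_at i c f p D \<Longrightarrow> pderiv_at i c (\<lambda>p. cnj (f p)) p (cnj D)"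
  unfolding pderiv_at_def coord_line_def by (rule has_vector_derivative_cnj)

lemma pderiv_at_inverse:
  assumes "pderiv_at i c f p D" "f p \<noteq> 0"
  shows "pderiv_at i c (\<lambda>p. inverse (f p)) p (- (inverse (f p) * D * inverse (f p)))"
proof -
  have "((\<lambda>t. inverse (coord_line i c f p t)) has_derivative
      (\<lambda>h. - (inverse (coord_line i c f p 0) * (h *\<^sub>R D) * inverse (coord_line i c f p 0)))) (at 0)"
    by (rule Deriv.has_derivative_inverse) (use assms in \<open>auto simp: pderiv_at_def has_vector_derivative_def coord_line_def\<close>)
  then show ?thesis
    by (simp add: pderiv_at_def has_vector_derivative_def coord_line_def)
qed

lemma pderiv_at_coord: "pderiv_at i c (\<lambda>p. p j) p (if i = j then c else 0)"
proof (cases "i = j")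
  case True
  have "((\<lambda>t. p i + complex_of_real t * c) has_vector_derivative (0 + (1 * c))) (at 0)"
    by (intro has_vector_derivative_add has_vector_derivative_mult_left has_vector_derivative_const)
      (auto intro!: derivative_eq_intros simp: has_vector_derivative_def scaleR_conv_of_real)
  then show ?thesis using True by (simp add: pderiv_at_def coord_line_def)
next
  case False
  then show ?thesis by (simp add: pderiv_at_def coord_line_def)
qed

section \<open>Closure properties of \<open>C^k\<close> functions on an open set\<close>

locale open_domain =
  fixes I :: "'i set" and \<Omega> :: "('i \<Rightarrow> complex) set"
  assumes openin_domain: "openin (cspace I) \<Omega>"
begin

lemma domain_subset: "\<Omega> \<subseteq> topspace (cspace I)"
  using openin_domain openin_subset by blast

lemma eventually_shift_mem:
  assumes "p \<in> \<Omega>" "i \<in> I"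
  shows "eventually (\<lambda>x. shift i x p \<in> \<Omega>) (nhds 0)"
proof -
  have c: "continuous_map euclidean (cspace I) (\<lambda>x. shift i x p)"
    using assms domain_subset by (intro continuous_map_shift) auto
  have "openin euclidean {x \<in> topspace euclidean. shift i x p \<in> \<Omega>}"
    by (rule openin_continuous_map_preimage[OF c openin_domain])
  then have "open {x. shift i x p \<in> \<Omega>}" by simp
  then show ?thesis
    using assms by (auto simp: eventually_nhds intro!: exI[of _ "{x. shift i x p \<in> \<Omega>}"])
qed

text \<open>The derivative sees only a short segment through \<open>p\<close>, and openness keeps
  that segment inside \<open>\<Omega>\<close>. Later identities between functions hold on
  \<open>\<Omega>\<close> only; this localisation is what allows them to be differentiated.\<close>

lemma pderiv_at_cong:
  assumes "p \<in> \<Omega>" "i \<in> I" "\<And>q. q \<in> \<Omega> \<Longrightarrow> f q = g q" "pderiv_at i c f p D"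
  shows "pderiv_at i c g p D"
proof -
  have "((\<lambda>t::real. of_real t * c) \<longlongrightarrow> of_real 0 * c) (nhds 0)"
    by (intro tendsto_intros) (simp add: filterlim_ident)
  then have lim: "filterlim (\<lambda>t::real. of_real t * c) (nhds 0) (nhds 0)" by simp
  have "eventually (\<lambda>t::real. shift i (of_real t * c) p \<in> \<Omega>) (nhds 0)"
    using filterlim_iff[THEN iffD1, OF lim, rule_format, OF eventually_shift_mem[OF assms(1,2)]] .
  then have "eventually (\<lambda>t. coord_line i c f p t = coord_line i c g p t) (nhds 0)"
    by eventually_elim (simp add: coord_line_shift assms(3))
  then obtain S where S: "open S" "0 \<in> S" "\<And>t. t \<in> S \<Longrightarrow> coord_line i c f p t = coord_line i c g p t"
    unfolding eventually_nhds by blast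
  show ?thesis
    unfolding pderiv_at_def
    by (rule has_vector_derivative_transform_within_open[OF assms(4)[unfolded pderiv_at_def] S])
qed

lemma rpartial_cong:
  assumes "p \<in> \<Omega>" "i \<in> I" "\<And>q. q \<in> \<Omega> \<Longrightarrow> f q = g q" "pderiv_at i c f p (rpartial i c f p)"
  shows "rpartial i c g p = rpartial i c f p"
  using pderiv_at_cong[OF assms] by (rule pderiv_at_rpartial)

lemma Ck_continuous: "Ck k I \<Omega> f \<Longrightarrow> continuous_map (subtopology (cspace I) \<Omega>) euclidean f"
  by (cases k) auto

lemma Ck_pderiv_at:
  "Ck (Suc k) I \<Omega> f \<Longrightarrow> i \<in> I \<Longrightarrow> c \<in> {1, \<i>} \<Longrightarrow> p \<in> \<Omega> \<Longrightarrow> pderiv_at i c f p (rpartial i c f p)"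
  by (auto simp: differentiable_pderiv_at)

lemma Ck_rpartial:
  "Ck (Suc k) I \<Omega> f \<Longrightarrow> i \<in> I \<Longrightarrow> c \<in> {1, \<i>} \<Longrightarrow> Ck k I \<Omega> (rpartial i c f)"
  by auto

lemma Ck_cong:
  assumes "\<And>q. q \<in> \<Omega> \<Longrightarrow> f q = g q" "Ck k I \<Omega> f"
  shows "Ck k I \<Omega> g"
  using assms
proof (induction k arbitrary: f g)
  case 0
  then show ?case
    by (auto elim!: continuous_map_eq)
next
  case (Suc k)
  have cont: "continuous_map (subtopology (cspace I) \<Omega>) euclidean g"
    using Ck_continuous[OF Suc.prems(2)] by (rule continuous_map_eq) (use Suc.prems in auto)
  have pd: "pderiv_at i c g p (rpartial i c f p)" if "i \<in> I" "c \<in> {1, \<i>}" "p \<in> \<Omega>" for i c p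
    using pderiv_at_cong[OF that(3,1) Suc.prems(1) Ck_pderiv_at[OF Suc.prems(2) that]] .
  have "Ck k I \<Omega> (rpartial i c g)" if "i \<in> I" "c \<in> {1, \<i>}" for i c
    by (rule Suc.IH[OF _ Ck_rpartial[OF Suc.prems(2) that]])
      (use pderiv_at_rpartial[OF pd[OF that]] in simp)
  moreover have "pderiv_at i c g p (rpartial i c g p)" if "i \<in> I" "c \<in> {1, \<i>}" "p \<in> \<Omega>" for i c p
    using pd[OF that] pderiv_at_rpartial by metis
  ultimately show ?case
    using cont unfolding Ck.simps differentiable_pderiv_at by blast
qed

text \<open>\<open>D\<close> has to agree with the partial derivatives on \<open>\<Omega>\<close>
  only, so formulas with divisions that are meaningful just there can be used.\<close>

lemma Ck_SucI:
  assumes "continuous_map (subtopology (cspace I) \<Omega>) euclidean f"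
    and "\<And>i c p. i \<in> I \<Longrightarrow> c \<in> {1, \<i>} \<Longrightarrow> p \<in> \<Omega> \<Longrightarrow> pderiv_at i c f p (D i c p)"
    and "\<And>i c. i \<in> I \<Longrightarrow> c \<in> {1, \<i>} \<Longrightarrow> Ck k I \<Omega> (D i c)"
  shows "Ck (Suc k) I \<Omega> f"
proof -
  have *: "rpartial i c f p = D i c p" if "i \<in> I" "c \<in> {1, \<i>}" "p \<in> \<Omega>" for i c p
    using assms(2)[OF that] by (rule pderiv_at_rpartial)
  have "Ck k I \<Omega> (rpartial i c f)" if "i \<in> I" "c \<in> {1, \<i>}" for i c
    by (rule Ck_cong[OF _ assms(3)[OF that]]) (use * that in auto)
  moreover have "pderiv_at i c f p (rpartial i c f p)" if "i \<in> I" "c \<in> {1, \<i>}" "p \<in> \<Omega>" for i c p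
    using assms(2)[OF that] * that by simp
  ultimately show ?thesis
    using assms(1) unfolding Ck.simps differentiable_pderiv_at by blast
qed

text \<open>Each level of \<open>Ck\<close> asks for continuity and the next derivatives, so
  monotonicity in \<open>k\<close> has to be proved. The product and inverse rules rely on it,
  because the undifferentiated function occurs in their derivative.\<close>

lemma Ck_Suc_imp: "Ck (Suc k) I \<Omega> f \<Longrightarrow> Ck k I \<Omega> f"
proof (induction k arbitrary: f)
  case 0
  show ?case using Ck_continuous[OF 0] by (simp only: Ck.simps)
next
  case (Suc k)
  show ?case
    by (rule Ck_SucI[where D = "\<lambda>i c. rpartial i c f", OF Ck_continuous[OF Suc.prems]
        Ck_pderiv_at[OF Suc.prems] Suc.IH[OF Ck_rpartial[OF Suc.prems]]])
qed

lemma Ck_const [intro!]: "Ck k I \<Omega> (\<lambda>_. a)"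
proof (induction k arbitrary: a)
  case (Suc k)
  show ?case by (rule Ck_SucI[where D = "\<lambda>_ _ _. 0"]) (use Suc in \<open>auto intro: pderiv_at_const\<close>)
qed auto

lemma Ck_coord: "i \<in> I \<Longrightarrow> Ck k I \<Omega> (\<lambda>p. p i)"
proof (cases k)
  case 0
  assume i: "i \<in> I"
  have "continuous_map (cspace I) euclidean (\<lambda>p. p i)"
    by (rule continuous_map_product_projection[OF i])
  then show ?thesis using 0 by (auto intro: continuous_map_from_subtopology)
next
  case (Suc k')
  assume i: "i \<in> I"
  have "continuous_map (cspace I) euclidean (\<lambda>p. p i)"
    by (rule continuous_map_product_projection[OF i])
  then show ?thesis unfolding Suc
    by (intro Ck_SucI[where D = "\<lambda>j c _. if j = i then c else 0"] pderiv_at_coord Ck_const)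
     (auto intro: continuous_map_from_subtopology)
qed

lemma Ck_add: "Ck k I \<Omega> f \<Longrightarrow> Ck k I \<Omega> g \<Longrightarrow> Ck k I \<Omega> (\<lambda>p. f p + g p)"
proof (induction k arbitrary: f g)
  case 0
  then show ?case by (auto intro!: continuous_map_add)
next
  case (Suc k)
  show ?case
    by (intro Ck_SucI[where D = "\<lambda>i c p. rpartial i c f p + rpartial i c g p"]
        continuous_map_add Ck_continuous[OF Suc.prems(1)] Ck_continuous[OF Suc.prems(2)] pderiv_at_add
        Ck_pderiv_at[OF Suc.prems(1)] Ck_pderiv_at[OF Suc.prems(2)] Suc.IH
        Ck_rpartial[OF Suc.prems(1)] Ck_rpartial[OF Suc.prems(2)])
qed

lemma Ck_mult: "Ck k I \<Omega> f \<Longrightarrow> Ck k I \<Omega> g \<Longrightarrow> Ck k I \<Omega> (\<lambda>p. f p * g p)"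
proof (induction k arbitrary: f g)
  case 0
  then show ?case by (auto simp: continuous_map_atin intro!: continuous_map_real_mult tendsto_mult)
next
  case (Suc k)
  have "continuous_map (subtopology (cspace I) \<Omega>) euclidean (\<lambda>p. f p * g p)"
    using Ck_continuous[OF Suc.prems(1)] Ck_continuous[OF Suc.prems(2)]
    by (auto simp: continuous_map_atin intro!: tendsto_mult)
  then show ?case
    by (intro Ck_SucI[where D = "\<lambda>i c p. f p * rpartial i c g p + rpartial i c f p * g p"]
        pderiv_at_mult Ck_pderiv_at[OF Suc.prems(1)] Ck_pderiv_at[OF Suc.prems(2)] Ck_add Suc.IH
        Ck_rpartial[OF Suc.prems(1)] Ck_rpartial[OF Suc.prems(2)]
        Ck_Suc_imp[OF Suc.prems(1)] Ck_Suc_imp[OF Suc.prems(2)])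
qed

lemma Ck_cnj: "Ck k I \<Omega> f \<Longrightarrow> Ck k I \<Omega> (\<lambda>p. cnj (f p))"
proof (induction k arbitrary: f)
  case 0
  then show ?case by (auto simp: continuous_map_atin intro!: tendsto_cnj)
next
  case (Suc k)
  have "continuous_map (subtopology (cspace I) \<Omega>) euclidean (\<lambda>p. cnj (f p))"
    using Ck_continuous[OF Suc.prems(1)] by (auto simp: continuous_map_atin intro!: tendsto_cnj)
  then show ?case
    by (intro Ck_SucI[where D = "\<lambda>i c p. cnj (rpartial i c f p)"]
        pderiv_at_cnj Ck_pderiv_at[OF Suc.prems] Suc.IH Ck_rpartial[OF Suc.prems])
qed

text \<open>The induction keeps \<open>f\<close> fixed: the derivative is a product of the
  derivative of \<open>f\<close> with two copies of \<open>inverse (f p)\<close>, and these copies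
  are of class \<open>C^k\<close> by the induction hypothesis.\<close>

lemma Ck_inverse:
  assumes "Ck k I \<Omega> f" and nz: "\<And>p. p \<in> \<Omega> \<Longrightarrow> f p \<noteq> 0"
  shows "Ck k I \<Omega> (\<lambda>p. inverse (f p))"
  using assms(1)
proof (induction k)
  case 0
  then show ?case using nz by (auto simp: continuous_map_atin intro!: tendsto_inverse)
next
  case (Suc k)
  have "continuous_map (subtopology (cspace I) \<Omega>) euclidean (\<lambda>p. inverse (f p))"
    using Ck_continuous[OF Suc.prems(1)] nz by (auto simp: continuous_map_atin intro!: tendsto_inverse)
  moreover have "Ck k I \<Omega> (\<lambda>p. inverse (f p))" using Suc Ck_Suc_imp by blast
  \<comment> \<open>The minus sign is written as a factor \<open>- 1\<close>, so that the rules for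
    constants and products cover it.\<close>
  moreover have "pderiv_at i c (\<lambda>p. inverse (f p)) p (- 1 * (inverse (f p) * rpartial i c f p * inverse (f p)))"
    if "i \<in> I" "c \<in> {1, \<i>}" "p \<in> \<Omega>" for i c p
    using pderiv_at_inverse[OF Ck_pderiv_at[OF Suc.prems(1) that] nz[OF that(3)]] by simp
  ultimately show ?case
    using Ck_rpartial[OF Suc.prems(1)]
    by (intro Ck_SucI[where D = "\<lambda>i c p. - 1 * (inverse (f p) * rpartial i c f p * inverse (f p))"]
        Ck_const Ck_mult)
qed

lemma smooth_cong: "(\<And>q. q \<in> \<Omega> \<Longrightarrow> f q = g q) \<Longrightarrow> smooth I \<Omega> f \<Longrightarrow> smooth I \<Omega> g"
  unfolding smooth_def using Ck_cong by blast

lemma smooth_const [intro!]: "smooth I \<Omega> (\<lambda>_. a)"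
  by (auto simp: smooth_def)

lemma smooth_coord: "i \<in> I \<Longrightarrow> smooth I \<Omega> (\<lambda>p. p i)"
  by (auto simp: smooth_def intro: Ck_coord)

lemma smooth_add: "smooth I \<Omega> f \<Longrightarrow> smooth I \<Omega> g \<Longrightarrow> smooth I \<Omega> (\<lambda>p. f p + g p)"
  by (auto simp: smooth_def intro: Ck_add)

lemma smooth_mult: "smooth I \<Omega> f \<Longrightarrow> smooth I \<Omega> g \<Longrightarrow> smooth I \<Omega> (\<lambda>p. f p * g p)"
  by (auto simp: smooth_def intro: Ck_mult)

lemma smooth_cnj: "smooth I \<Omega> f \<Longrightarrow> smooth I \<Omega> (\<lambda>p. cnj (f p))"
  by (auto simp: smooth_def intro: Ck_cnj)

lemma smooth_inverse: "smooth I \<Omega> f \<Longrightarrow> (\<And>p. p \<in> \<Omega> \<Longrightarrow> f p \<noteq> 0) \<Longrightarrow> smooth I \<Omega> (\<lambda>p. inverse (f p))"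
  by (auto simp: smooth_def intro: Ck_inverse)

lemma smooth_diff: "smooth I \<Omega> f \<Longrightarrow> smooth I \<Omega> g \<Longrightarrow> smooth I \<Omega> (\<lambda>p. f p - g p)"
  using smooth_add[of f "\<lambda>p. (- 1) * g p"] smooth_mult[OF smooth_const, of g "- 1"] by simp

lemma smooth_divide:
  "smooth I \<Omega> f \<Longrightarrow> smooth I \<Omega> g \<Longrightarrow> (\<And>p. p \<in> \<Omega> \<Longrightarrow> g p \<noteq> 0) \<Longrightarrow> smooth I \<Omega> (\<lambda>p. f p / g p)"
  unfolding divide_inverse by (intro smooth_mult smooth_inverse)

lemma smooth_sum: "(\<And>x. x \<in> S \<Longrightarrow> smooth I \<Omega> (f x)) \<Longrightarrow> smooth I \<Omega> (\<lambda>p. \<Sum>x\<in>S. f x p)"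
  by (induction S rule: infinite_finite_induct) (auto intro: smooth_add)

lemma smooth_rpartial: "smooth I \<Omega> f \<Longrightarrow> i \<in> I \<Longrightarrow> c \<in> {1, \<i>} \<Longrightarrow> smooth I \<Omega> (rpartial i c f)"
  unfolding smooth_def using Ck_rpartial by blast

lemma smooth_pderiv_at:
  "smooth I \<Omega> f \<Longrightarrow> i \<in> I \<Longrightarrow> c \<in> {1, \<i>} \<Longrightarrow> p \<in> \<Omega> \<Longrightarrow> pderiv_at i c f p (rpartial i c f p)"
  unfolding smooth_def using Ck_pderiv_at by blast

end


section \<open>Chern connections in a frame\<close>

text \<open>
  This weakening of positive definiteness passes to Schur complements without any use of Hermitian
  symmetry.
\<close>

definition anisotropic :: "nat set \<Rightarrow> (nat \<Rightarrow> nat \<Rightarrow> complex) \<Rightarrow> bool" where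
  "anisotropic J H \<longleftrightarrow>
     (\<forall>x. (\<exists>\<alpha>\<in>J. x \<alpha> \<noteq> 0) \<longrightarrow> (\<Sum>\<alpha>\<in>J. \<Sum>\<beta>\<in>J. x \<alpha> * cnj (x \<beta>) * H \<alpha> \<beta>) \<noteq> 0)"

lemma anisotropic_diagonal:
  assumes "anisotropic J H" "a \<in> J" "finite J"
  shows "H a a \<noteq> 0"
proof -
  define x :: "nat \<Rightarrow> complex" where "x = (\<lambda>\<alpha>. if \<alpha> = a then 1 else 0)"
  have "(\<Sum>\<alpha>\<in>J. \<Sum>\<beta>\<in>J. x \<alpha> * cnj (x \<beta>) * H \<alpha> \<beta>) \<noteq> 0"
    using assms(1)[unfolded anisotropic_def, rule_format, of x] assms(2) by (auto simp: x_def)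
  moreover have "(\<Sum>\<alpha>\<in>J. \<Sum>\<beta>\<in>J. x \<alpha> * cnj (x \<beta>) * H \<alpha> \<beta>) = H a a"
  proof -
    have "(\<Sum>\<alpha>\<in>J. \<Sum>\<beta>\<in>J. x \<alpha> * cnj (x \<beta>) * H \<alpha> \<beta>)
        = (\<Sum>\<alpha>\<in>J. \<Sum>\<beta>\<in>J. if \<beta> = a then (if \<alpha> = a then H \<alpha> a else 0) else 0)"
      by (intro sum.cong) (auto simp: x_def)
    then show ?thesis using assms by simp
  qed
  ultimately show ?thesis by simp
qed

text \<open>A vector \<open>x\<close> on \<open>J\<close> extends to \<open>insert a J\<close> so
  that the column \<open>a\<close> drops out of the form. What remains is the Schur complement
  evaluated at \<open>x\<close>, which is nonzero because the extended vector is nonzero.\<close>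

lemma anisotropic_schur:
  assumes "anisotropic (insert a J) H" "a \<notin> J" "finite J"
  shows "anisotropic J (\<lambda>\<alpha> \<beta>. H \<alpha> \<beta> - H \<alpha> a * H a \<beta> / H a a)"
  unfolding anisotropic_def
proof (intro allI impI)
  fix x :: "nat \<Rightarrow> complex"
  assume nz: "\<exists>\<alpha>\<in>J. x \<alpha> \<noteq> 0"
  have haa: "H a a \<noteq> 0" using anisotropic_diagonal[OF assms(1)] assms(3) by simp
  \<comment> \<open>The value that makes
    \<open>\<Sum>\<alpha>\<in>insert a J. y \<alpha> * H \<alpha> a\<close> vanish, as
    \<open>cola\<close> records.\<close>
  define s where "s = - (\<Sum>\<alpha>\<in>J. x \<alpha> * H \<alpha> a) / H a a"
  define y where "y = x(a := s)"
  have yJ: "y \<alpha> = x \<alpha>" if "\<alpha> \<in> J" for \<alpha> using that assms(2) by (auto simp: y_def)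
  have ya: "y a = s" by (simp add: y_def)
  have col: "(\<Sum>\<alpha>\<in>insert a J. y \<alpha> * H \<alpha> \<beta>) = (\<Sum>\<alpha>\<in>J. x \<alpha> * (H \<alpha> \<beta> - H \<alpha> a * H a \<beta> / H a a))" for \<beta>
    using assms(2,3) yJ
    by (simp add: ya s_def right_diff_distrib sum_subtractf sum_distrib_right sum_distrib_left
        sum_divide_distrib mult.assoc algebra_simps)
  have cola: "(\<Sum>\<alpha>\<in>insert a J. y \<alpha> * H \<alpha> a) = 0"
    unfolding col using haa by simp
  have "(\<Sum>\<alpha>\<in>insert a J. \<Sum>\<beta>\<in>insert a J. y \<alpha> * cnj (y \<beta>) * H \<alpha> \<beta>)
      = (\<Sum>\<beta>\<in>insert a J. cnj (y \<beta>) * (\<Sum>\<alpha>\<in>insert a J. y \<alpha> * H \<alpha> \<beta>))"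
    by (subst sum.swap) (simp add: sum_distrib_left ac_simps)
  also have "\<dots> = (\<Sum>\<beta>\<in>J. cnj (y \<beta>) * (\<Sum>\<alpha>\<in>insert a J. y \<alpha> * H \<alpha> \<beta>))"
    using assms(2,3) cola by (subst sum.insert) simp_all
  also have "\<dots> = (\<Sum>\<beta>\<in>J. cnj (x \<beta>) * (\<Sum>\<alpha>\<in>J. x \<alpha> * (H \<alpha> \<beta> - H \<alpha> a * H a \<beta> / H a a)))"
    using yJ by (intro sum.cong refl) (simp only: col)
  also have "\<dots> = (\<Sum>\<alpha>\<in>J. \<Sum>\<beta>\<in>J. x \<alpha> * cnj (x \<beta>) * (H \<alpha> \<beta> - H \<alpha> a * H a \<beta> / H a a))"
    by (subst sum.swap) (simp add: sum_distrib_left ac_simps)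
  finally have eq: "(\<Sum>\<alpha>\<in>insert a J. \<Sum>\<beta>\<in>insert a J. y \<alpha> * cnj (y \<beta>) * H \<alpha> \<beta>) = \<dots>" .
  have "\<exists>\<alpha>\<in>insert a J. y \<alpha> \<noteq> 0" using nz yJ by auto
  then have "(\<Sum>\<alpha>\<in>insert a J. \<Sum>\<beta>\<in>insert a J. y \<alpha> * cnj (y \<beta>) * H \<alpha> \<beta>) \<noteq> 0"
    using assms(1) unfolding anisotropic_def by blast
  then show "(\<Sum>\<alpha>\<in>J. \<Sum>\<beta>\<in>J. x \<alpha> * cnj (x \<beta>) * (H \<alpha> \<beta> - H \<alpha> a * H a \<beta> / H a a)) \<noteq> 0"
    using eq by simp
qed

text \<open>Gaussian elimination, one Schur complement at a time, keeps the solution smooth.\<close>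

lemma (in open_domain) smooth_solve:
  assumes "finite J"
    and "\<And>\<alpha> \<beta>. \<alpha> \<in> J \<Longrightarrow> \<beta> \<in> J \<Longrightarrow> smooth I \<Omega> (H \<alpha> \<beta>)"
    and "\<And>p. p \<in> \<Omega> \<Longrightarrow> anisotropic J (\<lambda>\<alpha> \<beta>. H \<alpha> \<beta> p)"
    and "\<And>\<beta>. \<beta> \<in> J \<Longrightarrow> smooth I \<Omega> (b \<beta>)"
  shows "\<exists>x. (\<forall>\<alpha>\<in>J. smooth I \<Omega> (x \<alpha>)) \<and> (\<forall>p\<in>\<Omega>. \<forall>\<beta>\<in>J. (\<Sum>\<alpha>\<in>J. x \<alpha> p * H \<alpha> \<beta> p) = b \<beta> p)"
  using assms
proof (induction J arbitrary: H b rule: finite_induct)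
  case empty
  then show ?case by simp
next
  case (insert a J)
  note sm = insert.prems(1) and an = insert.prems(2) and smb = insert.prems(3)
  have nz: "H a a p \<noteq> 0" if "p \<in> \<Omega>" for p
    using anisotropic_diagonal[OF an[OF that]] insert.hyps by simp
  \<comment> \<open>Elimination of the unknown with index \<open>a\<close>: the Schur complement of
    the matrix and the matching right-hand side.\<close>
  define H' where "H' = (\<lambda>\<alpha> \<beta> p. H \<alpha> \<beta> p - H \<alpha> a p * H a \<beta> p / H a a p)"
  define b' where "b' = (\<lambda>\<beta> p. b \<beta> p - b a p * H a \<beta> p / H a a p)"
  have "\<exists>x. (\<forall>\<alpha>\<in>J. smooth I \<Omega> (x \<alpha>)) \<and> (\<forall>p\<in>\<Omega>. \<forall>\<beta>\<in>J. (\<Sum>\<alpha>\<in>J. x \<alpha> p * H' \<alpha> \<beta> p) = b' \<beta> p)"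
  proof (rule insert.IH)
    show "smooth I \<Omega> (H' \<alpha> \<beta>)" if "\<alpha> \<in> J" "\<beta> \<in> J" for \<alpha> \<beta>
      unfolding H'_def using that nz by (intro smooth_diff smooth_divide smooth_mult sm) auto
    show "anisotropic J (\<lambda>\<alpha> \<beta>. H' \<alpha> \<beta> p)" if "p \<in> \<Omega>" for p
      unfolding H'_def using anisotropic_schur[OF an[OF that] insert.hyps(2,1)] .
    show "smooth I \<Omega> (b' \<beta>)" if "\<beta> \<in> J" for \<beta>
      unfolding b'_def using that nz by (intro smooth_diff smooth_divide smooth_mult sm smb) auto
  qed
  then obtain x where xs: "\<And>\<alpha>. \<alpha> \<in> J \<Longrightarrow> smooth I \<Omega> (x \<alpha>)"
    and xe: "\<And>p \<beta>. p \<in> \<Omega> \<Longrightarrow> \<beta> \<in> J \<Longrightarrow> (\<Sum>\<alpha>\<in>J. x \<alpha> p * H' \<alpha> \<beta> p) = b' \<beta> p" by blast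
  \<comment> \<open>Back substitution: the equation with index \<open>a\<close> yields the
    eliminated unknown from the others.\<close>
  define y where "y = (\<lambda>\<alpha> p. if \<alpha> = a then (b a p - (\<Sum>\<alpha>\<in>J. x \<alpha> p * H \<alpha> a p)) / H a a p else x \<alpha> p)"
  have ys: "smooth I \<Omega> (y \<alpha>)" if "\<alpha> \<in> insert a J" for \<alpha>
  proof (cases "\<alpha> = a")
    case True
    have "smooth I \<Omega> (\<lambda>p. (b a p - (\<Sum>\<alpha>\<in>J. x \<alpha> p * H \<alpha> a p)) / H a a p)"
      using nz by (intro smooth_diff smooth_divide smooth_mult smooth_sum sm smb xs) auto
    then show ?thesis using True by (simp add: y_def)
  next
    case False
    then show ?thesis using xs that by (simp add: y_def)
  qed
  have yJ: "(\<Sum>\<alpha>\<in>J. y \<alpha> p * H \<alpha> \<beta> p) = (\<Sum>\<alpha>\<in>J. x \<alpha> p * H \<alpha> \<beta> p)" for p \<beta>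
    using insert.hyps(2) by (intro sum.cong) (auto simp: y_def)
  have "(\<Sum>\<alpha>\<in>insert a J. y \<alpha> p * H \<alpha> \<beta> p) = b \<beta> p" if p: "p \<in> \<Omega>" and \<beta>: "\<beta> \<in> insert a J" for p \<beta>
  proof -
    have *: "(\<Sum>\<alpha>\<in>insert a J. y \<alpha> p * H \<alpha> \<beta> p)
        = (b a p - (\<Sum>\<alpha>\<in>J. x \<alpha> p * H \<alpha> a p)) / H a a p * H a \<beta> p + (\<Sum>\<alpha>\<in>J. x \<alpha> p * H \<alpha> \<beta> p)"
      using insert.hyps yJ by (simp add: y_def)
    show ?thesis
    proof (cases "\<beta> = a")
      case True
      then show ?thesis using * nz[OF p] by simp
    next
      case False
      then have "(\<Sum>\<alpha>\<in>J. x \<alpha> p * H' \<alpha> \<beta> p) = b' \<beta> p" using xe p \<beta> by simp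
      then have "(\<Sum>\<alpha>\<in>J. x \<alpha> p * H \<alpha> \<beta> p) - (\<Sum>\<alpha>\<in>J. x \<alpha> p * H \<alpha> a p) * H a \<beta> p / H a a p = b' \<beta> p"
        by (simp add: H'_def right_diff_distrib sum_subtractf sum_distrib_right sum_divide_distrib mult.assoc)
      then show ?thesis unfolding * b'_def by (simp add: diff_divide_distrib left_diff_distrib diff_eq_eq)
    qed
  qed
  then show ?case using ys by (intro exI[of _ y]) blast
qed

section \<open>Wirtinger derivatives and the Chern connection of a Gram matrix\<close>

definition hpartial :: "'i \<Rightarrow> (('i \<Rightarrow> complex) \<Rightarrow> complex) \<Rightarrow> ('i \<Rightarrow> complex) \<Rightarrow> complex" where
  "hpartial i f p = (rpartial i 1 f p - \<i> * rpartial i \<i> f p) / 2"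

definition d_hol :: "'i set \<Rightarrow> (('i \<Rightarrow> complex) \<Rightarrow> complex) \<Rightarrow> ('i \<Rightarrow> complex) \<Rightarrow> 'i form1" where
  "d_hol I f p v = (\<Sum>i\<in>I. hpartial i f p * v i)"

text \<open>The (0,1)-part of \<open>df\<close> is written as the conjugate of the (1,0)-part of
  \<open>d (cnj f)\<close>. In this shape it matches the conjugated connection form in the metric
  compatibility.\<close>

lemma d_fun_decompose:
  assumes "\<And>i c. i \<in> I \<Longrightarrow> c \<in> {1, \<i>} \<Longrightarrow> pderiv_at i c f p (rpartial i c f p)"
  shows "d_fun I f p v = d_hol I f p v + cnj (d_hol I (\<lambda>q. cnj (f q)) p v)"
proof -
  have 1: "rpartial i c (\<lambda>q. cnj (f q)) p = cnj (rpartial i c f p)" if "i \<in> I" "c \<in> {1, \<i>}" for i c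
    using pderiv_at_cnj[OF assms[OF that]] by (rule pderiv_at_rpartial)
  have "rpartial i 1 f p * of_real (Re (v i)) + rpartial i \<i> f p * of_real (Im (v i))
     = hpartial i f p * v i + cnj (hpartial i (\<lambda>q. cnj (f q)) p * v i)" if "i \<in> I" for i
    using that by (simp add: hpartial_def 1 complex_eq_iff field_simps)
  then show ?thesis unfolding d_fun_def d_hol_def by (simp add: sum.distrib cnj_sum)
qed

context open_domain
begin

lemma d_fun_cong:
  assumes "p \<in> \<Omega>" "\<And>q. q \<in> \<Omega> \<Longrightarrow> f q = g q" "smooth I \<Omega> f"
  shows "d_fun I f p v = d_fun I g p v"
proof -
  have "rpartial i c g p = rpartial i c f p" if "i \<in> I" "c \<in> {1, \<i>}" for i c
    using rpartial_cong[OF assms(1) that(1) assms(2) smooth_pderiv_at[OF assms(3) that assms(1)]] by simp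
  then show ?thesis by (simp add: d_fun_def)
qed

lemma d_fun_add:
  assumes "p \<in> \<Omega>" "smooth I \<Omega> f" "smooth I \<Omega> g"
  shows "d_fun I (\<lambda>q. f q + g q) p v = d_fun I f p v + d_fun I g p v"
proof -
  have "rpartial i c (\<lambda>q. f q + g q) p = rpartial i c f p + rpartial i c g p" if "i \<in> I" "c \<in> {1, \<i>}" for i c
    using pderiv_at_add[OF smooth_pderiv_at[OF assms(2) that assms(1)] smooth_pderiv_at[OF assms(3) that assms(1)]]
    by (rule pderiv_at_rpartial)
  then show ?thesis by (simp add: d_fun_def sum.distrib algebra_simps)
qed

lemma d_fun_mult:
  assumes "p \<in> \<Omega>" "smooth I \<Omega> f" "smooth I \<Omega> g"
  shows "d_fun I (\<lambda>q. f q * g q) p v = f p * d_fun I g p v + d_fun I f p v * g p"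
proof -
  have "rpartial i c (\<lambda>q. f q * g q) p = f p * rpartial i c g p + rpartial i c f p * g p" if "i \<in> I" "c \<in> {1, \<i>}" for i c
    using pderiv_at_mult[OF smooth_pderiv_at[OF assms(2) that assms(1)] smooth_pderiv_at[OF assms(3) that assms(1)]]
    by (rule pderiv_at_rpartial)
  then show ?thesis by (simp add: d_fun_def sum.distrib sum_distrib_left sum_distrib_right algebra_simps)
qed

lemma d_fun_const: "d_fun I (\<lambda>_. a) p v = 0"
  by (simp add: d_fun_def pderiv_at_rpartial[OF pderiv_at_const, of _ _ a])

lemma d_fun_sum:
  assumes "p \<in> \<Omega>" "\<And>x. x \<in> S \<Longrightarrow> smooth I \<Omega> (f x)"
  shows "d_fun I (\<lambda>q. \<Sum>x\<in>S. f x q) p v = (\<Sum>x\<in>S. d_fun I (f x) p v)"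
  using assms(2)
proof (induction S rule: infinite_finite_induct)
  case (insert x S)
  have "d_fun I (\<lambda>q. f x q + (\<Sum>x\<in>S. f x q)) p v = d_fun I (f x) p v + d_fun I (\<lambda>q. \<Sum>x\<in>S. f x q) p v"
    using insert.prems by (intro d_fun_add assms(1) smooth_sum) auto
  then show ?case using insert by simp
qed (simp_all add: d_fun_const)

lemma smooth_hpartial: "smooth I \<Omega> f \<Longrightarrow> i \<in> I \<Longrightarrow> smooth I \<Omega> (hpartial i f)"
  unfolding hpartial_def by (intro smooth_divide smooth_diff smooth_mult smooth_const smooth_rpartial) auto

lemma smooth_d_hol: "smooth I \<Omega> f \<Longrightarrow> smooth I \<Omega> (\<lambda>q. d_hol I f q v)"
  unfolding d_hol_def by (intro smooth_sum smooth_mult smooth_const smooth_hpartial)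

text \<open>Type (1,0) and compatibility force
  \<open>\<Sum>\<gamma>. A \<gamma> \<alpha> * H \<gamma> \<beta>\<close> to be the (1,0)-part of
  \<open>d H \<alpha> \<beta>\<close>. For fixed \<open>i\<close> and \<open>\<alpha>\<close> this
  is a linear system with matrix \<open>H\<close>, which has a smooth solution; conjugating it and
  using Hermitian symmetry yields the (0,1)-part of compatibility. The equation itself is also
  returned, because the curvature is computed from it.\<close>

lemma chern_connection_exists:
  assumes "finite J"
    and sm: "\<And>\<alpha> \<beta>. \<alpha> \<in> J \<Longrightarrow> \<beta> \<in> J \<Longrightarrow> smooth I \<Omega> (H \<alpha> \<beta>)"
    and an: "\<And>p. p \<in> \<Omega> \<Longrightarrow> anisotropic J (\<lambda>\<alpha> \<beta>. H \<alpha> \<beta> p)"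
    and herm: "\<And>p \<alpha> \<beta>. p \<in> \<Omega> \<Longrightarrow> \<alpha> \<in> J \<Longrightarrow> \<beta> \<in> J \<Longrightarrow> H \<beta> \<alpha> p = cnj (H \<alpha> \<beta> p)"
  obtains a where "chern_connection I \<Omega> J H a"
    and "\<And>p \<alpha> \<beta> v. p \<in> \<Omega> \<Longrightarrow> \<alpha> \<in> J \<Longrightarrow> \<beta> \<in> J \<Longrightarrow>
      (\<Sum>\<gamma>\<in>J. conn_form I (a \<gamma> \<alpha>) p v * H \<gamma> \<beta> p) = d_hol I (H \<alpha> \<beta>) p v"
proof -
  have "\<exists>x. (\<forall>\<gamma>\<in>J. smooth I \<Omega> (x \<gamma>)) \<and>
      (\<forall>p\<in>\<Omega>. \<forall>\<beta>\<in>J. (\<Sum>\<gamma>\<in>J. x \<gamma> p * H \<gamma> \<beta> p) = hpartial i (H \<alpha> \<beta>) p)" if "i \<in> I" "\<alpha> \<in> J" for i \<alpha>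
    by (rule smooth_solve) (use assms that in \<open>auto intro: smooth_hpartial\<close>)
  then obtain x where xs: "\<And>i \<alpha> \<gamma>. i \<in> I \<Longrightarrow> \<alpha> \<in> J \<Longrightarrow> \<gamma> \<in> J \<Longrightarrow> smooth I \<Omega> (x i \<alpha> \<gamma>)"
    and xe: "\<And>i \<alpha> p \<beta>. i \<in> I \<Longrightarrow> \<alpha> \<in> J \<Longrightarrow> p \<in> \<Omega> \<Longrightarrow> \<beta> \<in> J \<Longrightarrow>
      (\<Sum>\<gamma>\<in>J. x i \<alpha> \<gamma> p * H \<gamma> \<beta> p) = hpartial i (H \<alpha> \<beta>) p" by metis
  define a where "a = (\<lambda>\<gamma> \<alpha> i. x i \<alpha> \<gamma>)"
  have eq: "(\<Sum>\<gamma>\<in>J. conn_form I (a \<gamma> \<alpha>) p v * H \<gamma> \<beta> p) = d_hol I (H \<alpha> \<beta>) p v"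
    if "p \<in> \<Omega>" "\<alpha> \<in> J" "\<beta> \<in> J" for p \<alpha> \<beta> v
  proof -
    have "(\<Sum>\<gamma>\<in>J. conn_form I (a \<gamma> \<alpha>) p v * H \<gamma> \<beta> p) = (\<Sum>\<gamma>\<in>J. \<Sum>i\<in>I. x i \<alpha> \<gamma> p * H \<gamma> \<beta> p * v i)"
      unfolding conn_form_def d_coord_def a_def sum_distrib_right by (intro sum.cong refl) simp
    also have "\<dots> = (\<Sum>i\<in>I. (\<Sum>\<gamma>\<in>J. x i \<alpha> \<gamma> p * H \<gamma> \<beta> p) * v i)"
      unfolding sum_distrib_right by (rule sum.swap)
    also have "\<dots> = d_hol I (H \<alpha> \<beta>) p v"
      unfolding d_hol_def using xe that by (intro sum.cong refl) metis
    finally show ?thesis .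
  qed
  \<comment> \<open>Hermitian symmetry holds on \<open>\<Omega>\<close> only, so the derivatives of
    the two functions have to be compared locally.\<close>
  have hc: "d_hol I (\<lambda>q. cnj (H \<alpha> \<beta> q)) p v = d_hol I (H \<beta> \<alpha>) p v"
    if "p \<in> \<Omega>" "\<alpha> \<in> J" "\<beta> \<in> J" for p \<alpha> \<beta> v
  proof -
    have "rpartial i c (H \<beta> \<alpha>) p = rpartial i c (\<lambda>q. cnj (H \<alpha> \<beta> q)) p" if "i \<in> I" "c \<in> {1, \<i>}" for i c
    proof (rule rpartial_cong[OF \<open>p \<in> \<Omega>\<close> \<open>i \<in> I\<close>])
      show "cnj (H \<alpha> \<beta> q) = H \<beta> \<alpha> q" if "q \<in> \<Omega>" for q
        using herm[OF that \<open>\<alpha> \<in> J\<close> \<open>\<beta> \<in> J\<close>] by (rule sym)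
      show "pderiv_at i c (\<lambda>q. cnj (H \<alpha> \<beta> q)) p (rpartial i c (\<lambda>q. cnj (H \<alpha> \<beta> q)) p)"
        by (intro smooth_pderiv_at smooth_cnj sm that \<open>p \<in> \<Omega>\<close> \<open>\<alpha> \<in> J\<close> \<open>\<beta> \<in> J\<close>)
    qed
    then show ?thesis by (simp add: d_hol_def hpartial_def)
  qed
  have "d_fun I (H \<alpha> \<beta>) p v = (\<Sum>\<gamma>\<in>J. conn_form I (a \<gamma> \<alpha>) p v * H \<gamma> \<beta> p) +
        (\<Sum>\<gamma>\<in>J. cnj (conn_form I (a \<gamma> \<beta>) p v) * H \<alpha> \<gamma> p)"
    if "p \<in> \<Omega>" "\<alpha> \<in> J" "\<beta> \<in> J" for p \<alpha> \<beta> v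
  proof -
    have "(\<Sum>\<gamma>\<in>J. cnj (conn_form I (a \<gamma> \<beta>) p v) * H \<alpha> \<gamma> p) = cnj (\<Sum>\<gamma>\<in>J. conn_form I (a \<gamma> \<beta>) p v * H \<gamma> \<alpha> p)"
      unfolding cnj_sum complex_cnj_mult
      by (intro sum.cong refl) (simp add: herm[OF that(1) _ that(2), symmetric])
    also have "\<dots> = cnj (d_hol I (\<lambda>q. cnj (H \<alpha> \<beta> q)) p v)"
      unfolding hc[OF that] by (simp only: eq[OF that(1,3,2)])
    finally show ?thesis
      using d_fun_decompose[of I "H \<alpha> \<beta>" p v] smooth_pderiv_at[OF sm[OF that(2,3)]] that by (simp add: eq)
  qed
  then have "chern_connection I \<Omega> J H a"
    unfolding chern_connection_def using xs by (auto simp: a_def)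
  then show ?thesis using that eq by blast
qed

text \<open>Let \<open>\<partial>\<close> denote the (1,0)-derivative. At \<open>p\<close> the Gram
  matrix is the identity, so \<open>A = \<partial>H\<close> there, and differentiating the identity
  \<open>A H = \<partial>H\<close> gives \<open>dA = d(\<partial>H) - A dH\<close>. The matrix
  \<open>H\<close> is never inverted.\<close>

lemma curvature_matrix_eq:
  assumes fJ: "finite J"
    and sm: "\<And>\<alpha> \<beta>. \<alpha> \<in> J \<Longrightarrow> \<beta> \<in> J \<Longrightarrow> smooth I \<Omega> (H \<alpha> \<beta>)"
    and conn: "chern_connection I \<Omega> J H a"
    and eq: "\<And>p \<alpha> \<beta> v. p \<in> \<Omega> \<Longrightarrow> \<alpha> \<in> J \<Longrightarrow> \<beta> \<in> J \<Longrightarrow>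
      (\<Sum>\<gamma>\<in>J. conn_form I (a \<gamma> \<alpha>) p v * H \<gamma> \<beta> p) = d_hol I (H \<alpha> \<beta>) p v"
    and p: "p \<in> \<Omega>"
    and one: "\<And>\<alpha> \<beta>. \<alpha> \<in> J \<Longrightarrow> \<beta> \<in> J \<Longrightarrow> H \<alpha> \<beta> p = (if \<alpha> = \<beta> then 1 else 0)"
    and \<alpha>\<beta>: "\<alpha> \<in> J" "\<beta> \<in> J"
  shows "curvature_matrix I J a p \<beta> \<alpha> u v =
     (d_fun I (\<lambda>q. d_hol I (H \<alpha> \<beta>) q v) p u - (\<Sum>\<gamma>\<in>J. d_hol I (H \<alpha> \<gamma>) p v * d_fun I (H \<gamma> \<beta>) p u))
   - (d_fun I (\<lambda>q. d_hol I (H \<alpha> \<beta>) q u) p v - (\<Sum>\<gamma>\<in>J. d_hol I (H \<alpha> \<gamma>) p u * d_fun I (H \<gamma> \<beta>) p v))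
   + (\<Sum>\<gamma>\<in>J. d_hol I (H \<gamma> \<beta>) p u * d_hol I (H \<alpha> \<gamma>) p v - d_hol I (H \<gamma> \<beta>) p v * d_hol I (H \<alpha> \<gamma>) p u)"
proof -
  have as: "smooth I \<Omega> (a \<beta> \<alpha> i)" if "\<alpha> \<in> J" "\<beta> \<in> J" "i \<in> I" for \<alpha> \<beta> i
    using conn that by (auto simp: chern_connection_def)
  have cs: "smooth I \<Omega> (\<lambda>q. conn_form I (a \<beta> \<alpha>) q v)" if "\<alpha> \<in> J" "\<beta> \<in> J" for \<alpha> \<beta> v
    unfolding conn_form_def using that by (intro smooth_sum smooth_mult smooth_const as)
  have A: "conn_form I (a \<beta> \<alpha>) p v = d_hol I (H \<alpha> \<beta>) p v" if "\<alpha> \<in> J" "\<beta> \<in> J" for \<alpha> \<beta> v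
  proof -
    have "(\<Sum>\<gamma>\<in>J. conn_form I (a \<gamma> \<alpha>) p v * H \<gamma> \<beta> p) = (\<Sum>\<gamma>\<in>J. if \<gamma> = \<beta> then conn_form I (a \<gamma> \<alpha>) p v else 0)"
      using that by (intro sum.cong) (auto simp: one)
    then show ?thesis using eq[OF p that, of v] fJ that by simp
  qed
  have D: "d_fun I (\<lambda>q. conn_form I (a \<beta> \<alpha>) q v) p u =
     d_fun I (\<lambda>q. d_hol I (H \<alpha> \<beta>) q v) p u - (\<Sum>\<gamma>\<in>J. d_hol I (H \<alpha> \<gamma>) p v * d_fun I (H \<gamma> \<beta>) p u)" for u v
  proof -
    have "d_fun I (\<lambda>q. d_hol I (H \<alpha> \<beta>) q v) p u = d_fun I (\<lambda>q. \<Sum>\<gamma>\<in>J. conn_form I (a \<gamma> \<alpha>) q v * H \<gamma> \<beta> q) p u"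
      using eq \<alpha>\<beta> sm by (intro d_fun_cong p smooth_d_hol) auto
    also have "\<dots> = (\<Sum>\<gamma>\<in>J. conn_form I (a \<gamma> \<alpha>) p v * d_fun I (H \<gamma> \<beta>) p u
        + d_fun I (\<lambda>q. conn_form I (a \<gamma> \<alpha>) q v) p u * H \<gamma> \<beta> p)"
      using \<alpha>\<beta> p sm cs by (subst d_fun_sum) (auto intro!: smooth_mult sum.cong d_fun_mult)
    also have "\<dots> = (\<Sum>\<gamma>\<in>J. d_hol I (H \<alpha> \<gamma>) p v * d_fun I (H \<gamma> \<beta>) p u)
        + (\<Sum>\<gamma>\<in>J. if \<gamma> = \<beta> then d_fun I (\<lambda>q. conn_form I (a \<gamma> \<alpha>) q v) p u else 0)"
      using \<alpha>\<beta> unfolding sum.distrib[symmetric] by (intro sum.cong) (auto simp: one A)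
    finally show ?thesis using fJ \<alpha>\<beta> by simp
  qed
  have E: "(\<Sum>i\<in>I. d_fun I (a \<beta> \<alpha> i) p u * v i) = d_fun I (\<lambda>q. conn_form I (a \<beta> \<alpha>) q v) p u" for u v
  proof -
    have "d_fun I (\<lambda>q. a \<beta> \<alpha> i q * v i) p u = d_fun I (a \<beta> \<alpha> i) p u * v i" if "i \<in> I" for i
      using d_fun_mult[OF p as[OF \<alpha>\<beta> that] smooth_const[of "v i"], of u] by (simp add: d_fun_const)
    then show ?thesis
      unfolding conn_form_def d_coord_def using p as \<alpha>\<beta> by (subst d_fun_sum) (auto intro!: smooth_mult)
  qed
  show ?thesis
    unfolding curvature_matrix_def wedge_def d_coord_def sum_subtractf E D
    using \<alpha>\<beta> by (simp add: A sum_subtractf)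
qed

end


section \<open>Second-order jets at the origin\<close>

text \<open>The \<open>l^1\<close> norm: it bounds every coordinate, and it dominates the Euclidean
  norm that occurs in \<open>normal_frame\<close>.\<close>

definition nrm :: "'i set \<Rightarrow> ('i \<Rightarrow> complex) \<Rightarrow> real" where
  "nrm I w = (\<Sum>i\<in>I. norm (w i))"

lemma nrm_nonneg: "nrm I w \<ge> 0"
  by (simp add: nrm_def sum_nonneg)

text \<open>The full neighbourhood filter, which includes the origin itself. A bound by a positive
  power of \<open>nrm\<close> therefore also forces the value at the origin to be zero.\<close>

abbreviation at_origin :: "'i set \<Rightarrow> ('i \<Rightarrow> complex) filter" where
  "at_origin I \<equiv> nhdsin (cspace I) (origin I)"

abbreviation bigO_pow :: "'i set \<Rightarrow> nat \<Rightarrow> (('i \<Rightarrow> complex) \<Rightarrow> complex) set" where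
  "bigO_pow I k \<equiv> O[at_origin I](\<lambda>w. of_real (nrm I w) ^ k)"

lemma origin_mem: "origin I \<in> topspace (cspace I)"
  by (auto simp: origin_def)

lemma filterlim_shift2:
  assumes "i \<in> I" "j \<in> I"
  shows "filterlim (\<lambda>t. shift i (of_real t * c) (shift j (of_real t * d) (origin I))) (at_origin I) (nhds (0::real))"
proof -
  let ?h = "\<lambda>t::real. shift i (of_real t * c) (shift j (of_real t * d) (origin I))"
  have "continuous_map euclidean euclidean (\<lambda>t::real. (complex_of_real t * c, complex_of_real t * d))"
    by (auto intro!: continuous_intros)
  from continuous_map_compose[OF this continuous_map_shift2[OF origin_mem assms]]
  have cm: "continuous_map euclidean (cspace I) ?h" by (simp add: o_def)
  show ?thesis
    unfolding filterlim_iff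
  proof (intro allI impI)
    fix P assume "eventually P (at_origin I)"
    then obtain S where S: "openin (cspace I) S" "origin I \<in> S" "\<And>x. x \<in> S \<Longrightarrow> P x"
      using origin_mem[of I] unfolding eventually_nhdsin by auto
    have "openin euclidean {t \<in> topspace euclidean. ?h t \<in> S}"
      by (rule openin_continuous_map_preimage[OF cm S(1)])
    then have "open {t. ?h t \<in> S}" by simp
    then show "eventually (\<lambda>t. P (?h t)) (nhds 0)"
      unfolding eventually_nhds using S by (intro exI[of _ "{t. ?h t \<in> S}"]) auto
  qed
qed

text \<open>Each of the two moves has length \<open>\<bar>t\<bar>\<close>, whether they affect the
  same coordinate or different ones; this is the origin of the factor 2.\<close>

lemma nrm_shift2_le:
  assumes "finite I" "i \<in> I" "j \<in> I" "c \<in> {1, \<i>}" "d \<in> {1, \<i>}"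
  shows "nrm I (shift i (of_real t * c) (shift j (of_real t * d) (origin I))) \<le> 2 * \<bar>t\<bar>"
proof -
  have n: "norm c = 1" "norm d = 1" using assms by auto
  have "norm (shift i (of_real t * c) (shift j (of_real t * d) (origin I)) k)
      \<le> (if k = i then \<bar>t\<bar> else 0) + (if k = j then \<bar>t\<bar> else 0)" if "k \<in> I" for k
  proof -
    have "norm (of_real t * d + of_real t * c) \<le> \<bar>t\<bar> + \<bar>t\<bar>"
      by (rule norm_triangle_le) (simp add: norm_mult n)
    then show ?thesis using that n by (auto simp: shift_def origin_def norm_mult)
  qed
  then have "nrm I (shift i (of_real t * c) (shift j (of_real t * d) (origin I)))
     \<le> (\<Sum>k\<in>I. (if k = i then \<bar>t\<bar> else 0) + (if k = j then \<bar>t\<bar> else 0))"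
    unfolding nrm_def by (rule sum_mono)
  then show ?thesis using assms by (simp add: sum.distrib)
qed

lemma real_vector_bound:
  fixes g :: "real \<Rightarrow> complex"
  assumes "0 \<le> t" "\<And>s. 0 \<le> s \<Longrightarrow> s \<le> t \<Longrightarrow> (g has_vector_derivative g' s) (at s)"
    and "\<And>s. 0 \<le> s \<Longrightarrow> s \<le> t \<Longrightarrow> norm (g' s) \<le> B"
  shows "norm (g t - g 0) \<le> B * t"
proof -
  have "norm (g t - g 0) \<le> B * norm (t - 0)"
  proof (rule differentiable_bound[where S = "{0..t}" and f' = "\<lambda>s h. h *\<^sub>R g' s"])
    fix s assume s: "s \<in> {0..t}"
    show "(g has_derivative (\<lambda>h. h *\<^sub>R g' s)) (at s within {0..t})"
      using assms(2)[of s] s by (auto simp: has_vector_derivative_def intro: has_derivative_at_withinI)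
    show "onorm (\<lambda>h. h *\<^sub>R g' s) \<le> B"
      using assms(3)[of s] s by (intro onorm_le) (auto simp: mult.commute[of B] intro: mult_left_mono)
  qed (use assms(1) in auto)
  then show ?thesis using assms(1) by simp
qed

text \<open>\<open>pderiv_at\<close> differentiates at parameter 0 only; translating the parameter
  by \<open>s\<close> makes derivatives available all along a line, as the mean value inequality
  requires.\<close>

lemma pderiv_at_line:
  assumes "pderiv_at i c f (shift i (of_real s * c) q) D"
  shows "((\<lambda>t. f (shift i (of_real t * c) q)) has_vector_derivative D) (at s)"
proof -
  have "(coord_line i c f (shift i (of_real s * c) q) has_vector_derivative D) (at (s - s))"
    using assms by (simp add: pderiv_at_def)
  moreover have "((\<lambda>t. t - s) has_vector_derivative 1) (at s)"
    by (auto intro!: derivative_eq_intros simp: has_vector_derivative_def)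
  ultimately have "((\<lambda>t. coord_line i c f (shift i (of_real s * c) q) (t - s)) has_vector_derivative D) (at s)"
    using vector_diff_chain_at[of "\<lambda>t. t - s" 1 s "coord_line i c f (shift i (of_real s * c) q)" D]
    by (simp add: o_def)
  moreover have "coord_line i c f (shift i (of_real s * c) q) (t - s) = f (shift i (of_real t * c) q)" for t
    by (simp add: coord_line_shift shift_add algebra_simps)
  ultimately show ?thesis by simp
qed

context open_domain
begin

lemma eventually_domain: "origin I \<in> \<Omega> \<Longrightarrow> eventually (\<lambda>w. w \<in> \<Omega>) (at_origin I)"
  unfolding eventually_nhdsin using openin_domain by auto

text \<open>Turns a Landau bound in many variables into an inequality in one real parameter, valid
  at \<open>t = 0\<close> as well.\<close>

lemma bigO_shift2:
  assumes "finite I" "f \<in> bigO_pow I k" "i \<in> I" "j \<in> I" "c \<in> {1, \<i>}" "d \<in> {1, \<i>}"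
  obtains C where "C \<ge> 0"
    "eventually (\<lambda>t. norm (f (shift i (of_real t * c) (shift j (of_real t * d) (origin I)))) \<le> C * \<bar>t\<bar> ^ k) (nhds (0::real))"
proof -
  obtain C where C: "C > 0" "eventually (\<lambda>w. norm (f w) \<le> C * norm (complex_of_real (nrm I w) ^ k)) (at_origin I)"
    using assms(2) by (auto elim!: landau_o.bigE)
  have "eventually (\<lambda>t::real. norm (f (shift i (of_real t * c) (shift j (of_real t * d) (origin I))))
      \<le> C * norm (complex_of_real (nrm I (shift i (of_real t * c) (shift j (of_real t * d) (origin I)))) ^ k)) (nhds 0)"
    using filterlim_shift2[OF assms(3,4), of c d] C(2) unfolding filterlim_iff by blast
  then have "eventually (\<lambda>t::real. norm (f (shift i (of_real t * c) (shift j (of_real t * d) (origin I))))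
     \<le> (C * 2 ^ k) * \<bar>t\<bar> ^ k) (nhds 0)"
  proof eventually_elim
    case (elim t)
    let ?n = "nrm I (shift i (of_real t * c) (shift j (of_real t * d) (origin I)))"
    have "?n ^ k \<le> (2 * \<bar>t\<bar>) ^ k"
      using nrm_shift2_le[OF assms(1,3-6)] nrm_nonneg by (intro power_mono) auto
    then have "C * ?n ^ k \<le> C * (2 * \<bar>t\<bar>) ^ k" using C(1) by simp
    moreover have "norm (complex_of_real ?n ^ k) = ?n ^ k" by (simp add: norm_power nrm_nonneg)
    ultimately show ?case using elim by (simp add: power_mult_distrib mult.assoc)
  qed
  then show ?thesis using that[of "C * 2 ^ k"] C(1) by simp
qed

text \<open>Along a coordinate line \<open>f\<close> is bounded by a multiple of
  \<open>t ^ 2\<close>, so its difference quotient tends to zero.\<close>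

lemma bigO_rpartial_eq_0:
  assumes fin: "finite I" and o: "origin I \<in> \<Omega>" and sm: "smooth I \<Omega> f" and O: "f \<in> bigO_pow I 2"
    and i: "i \<in> I" "c \<in> {1, \<i>}"
  shows "rpartial i c f (origin I) = 0"
proof -
  obtain C where C: "C \<ge> 0"
    "eventually (\<lambda>t. norm (f (shift i (of_real t * c) (shift i (of_real t * c) (origin I)))) \<le> C * \<bar>t\<bar> ^ 2) (nhds (0::real))"
    using bigO_shift2[OF fin O i(1) i(1) i(2) i(2)] .
  \<comment> \<open>Two equal moves along the same line amount to a move by \<open>2 * t\<close>,
    hence the factor 2 in the derivative of \<open>?g\<close>.\<close>
  let ?g = "\<lambda>t::real. f (shift i (of_real t * c) (shift i (of_real t * c) (origin I)))"
  have g0: "?g 0 = 0" using eventually_nhds_x_imp_x[OF C(2)] by simp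
  have "pderiv_at i c f (origin I) (rpartial i c f (origin I))"
    using smooth_pderiv_at[OF sm i o] .
  then have "(coord_line i c f (origin I) has_vector_derivative rpartial i c f (origin I)) (at (2 * 0))"
    by (simp add: pderiv_at_def)
  moreover have "((\<lambda>t. 2 * t) has_vector_derivative 2) (at (0::real))"
    by (auto intro!: derivative_eq_intros simp: has_vector_derivative_def)
  ultimately have "((\<lambda>t. coord_line i c f (origin I) (2 * t)) has_vector_derivative 2 *\<^sub>R rpartial i c f (origin I)) (at 0)"
    using vector_diff_chain_at[of "\<lambda>t. 2 * t" 2 0 "coord_line i c f (origin I)"]
    by (simp add: o_def)
  moreover have "coord_line i c f (origin I) (2 * t) = ?g t" for t
    by (simp add: coord_line_shift shift_add algebra_simps)
  ultimately have "(?g has_vector_derivative 2 *\<^sub>R rpartial i c f (origin I)) (at 0)" by simp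
  then have A: "((\<lambda>t. norm (?g t - t *\<^sub>R (2 *\<^sub>R rpartial i c f (origin I))) / norm t) \<longlongrightarrow> 0) (at 0)"
    using g0 unfolding has_vector_derivative_def has_derivative_at by simp
  have B: "((\<lambda>t. norm (?g t) / norm t) \<longlongrightarrow> 0) (at (0::real))"
  proof (rule Lim_null_comparison)
    have "eventually (\<lambda>t. norm (?g t) \<le> C * \<bar>t\<bar> ^ 2) (at 0)"
      unfolding eventually_at_filter using C(2) by (rule eventually_mono) simp
    then show "eventually (\<lambda>t. norm (norm (?g t) / norm t) \<le> C * \<bar>t\<bar>) (at 0)"
    proof eventually_elim
      case (elim t)
      then show ?case
        by (cases "t = 0") (simp_all add: pos_divide_le_eq power2_eq_square mult.assoc)
    qed
    show "((\<lambda>t. C * \<bar>t\<bar>) \<longlongrightarrow> 0) (at 0)" by (auto intro!: tendsto_eq_intros)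
  qed
  \<comment> \<open>A constant is squeezed between zero and two null functions, by the triangle
    inequality divided by \<open>norm t\<close>.\<close>
  have "((\<lambda>t. norm (2 *\<^sub>R rpartial i c f (origin I))) \<longlongrightarrow> 0) (at (0::real))"
  proof (rule Lim_null_comparison)
    show "((\<lambda>t. norm (?g t - t *\<^sub>R (2 *\<^sub>R rpartial i c f (origin I))) / norm t + norm (?g t) / norm t) \<longlongrightarrow> 0) (at 0)"
      using tendsto_add[OF A B] by simp
    have "eventually (\<lambda>t::real. t \<noteq> 0) (at 0)" by (simp add: eventually_at_filter)
    then show "eventually (\<lambda>t. norm (norm (2 *\<^sub>R rpartial i c f (origin I)))
        \<le> norm (?g t - t *\<^sub>R (2 *\<^sub>R rpartial i c f (origin I))) / norm t + norm (?g t) / norm t) (at 0)"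
    proof eventually_elim
      case (elim t)
      let ?r = "2 *\<^sub>R rpartial i c f (origin I)"
      have "norm (t *\<^sub>R ?r) \<le> norm (?g t - t *\<^sub>R ?r) + norm (?g t)"
        by (metis add.commute norm_minus_commute norm_triangle_sub)
      then have "norm t * norm ?r \<le> norm (?g t - t *\<^sub>R ?r) + norm (?g t)" by simp
      then show ?case
        using elim unfolding add_divide_distrib[symmetric] by (subst pos_le_divide_eq) (simp_all add: mult.commute)
    qed
  qed
  then show ?thesis by (simp add: tendsto_const_iff)
qed

text \<open>
  The double difference \<open>f(x + s + t) - f(x + s) - f(x + t) + f(x)\<close> is controlled by the second
  derivative through two applications of the mean value inequality; no symmetry of second
  derivatives is needed.
\<close>

lemma second_partial_estimate:
  assumes o: "origin I \<in> \<Omega>" and sm: "smooth I \<Omega> f"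
    and i: "i \<in> I" "c \<in> {1, \<i>}" and j: "j \<in> I" "d \<in> {1, \<i>}" and \<epsilon>: "\<epsilon> > 0"
  shows "eventually (\<lambda>t::real. norm
    (f (shift i (of_real t * c) (shift j (of_real t * d) (origin I))) - f (shift i (of_real t * c) (origin I))
     - f (shift j (of_real t * d) (origin I)) + f (origin I)
     - of_real t ^ 2 * rpartial j d (rpartial i c f) (origin I)) \<le> \<epsilon> * t ^ 2) (at_right 0)"
proof -
  let ?m = "rpartial j d (rpartial i c f) (origin I)"
  let ?P = "\<lambda>x y. shift i x (shift j y (origin I))"
  have smi: "smooth I \<Omega> (rpartial i c f)" using smooth_rpartial[OF sm i] .
  have smij: "smooth I \<Omega> (rpartial j d (rpartial i c f))" using smooth_rpartial[OF smi j] .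
  have "Ck 0 I \<Omega> (rpartial j d (rpartial i c f))" using smij unfolding smooth_def by blast
  then have "continuous_map (subtopology (cspace I) \<Omega>) euclidean (rpartial j d (rpartial i c f))" by simp
  then have "openin (subtopology (cspace I) \<Omega>)
      {q \<in> topspace (subtopology (cspace I) \<Omega>). rpartial j d (rpartial i c f) q \<in> ball ?m \<epsilon>}"
    by (rule openin_continuous_map_preimage) simp
  then have "openin (cspace I) {q \<in> topspace (subtopology (cspace I) \<Omega>). rpartial j d (rpartial i c f) q \<in> ball ?m \<epsilon>}"
    using openin_domain openin_trans_full by blast
  moreover define S where "S = {q \<in> topspace (subtopology (cspace I) \<Omega>). rpartial j d (rpartial i c f) q \<in> ball ?m \<epsilon>}"
  ultimately have "openin (cspace I) S" by simp
  then have "openin euclidean {xy \<in> topspace euclidean. (case xy of (x, y) \<Rightarrow> ?P x y) \<in> S}"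
    using continuous_map_shift2[OF origin_mem i(1) j(1)] openin_continuous_map_preimage by blast
  then have "open {xy. (case xy of (x, y) \<Rightarrow> ?P x y) \<in> S}" by simp
  moreover have "(0, 0) \<in> {xy. (case xy of (x, y) \<Rightarrow> ?P x y) \<in> S}"
    using o \<epsilon> domain_subset by (auto simp: S_def)
  ultimately obtain r where r: "r > 0" "ball (0, 0) r \<subseteq> {xy. (case xy of (x, y) \<Rightarrow> ?P x y) \<in> S}"
    unfolding open_contains_ball by blast
  \<comment> \<open>The bound \<open>r / 2\<close> on both parameters keeps the pair inside
    \<open>ball (0, 0) r\<close>.\<close>
  have PS: "?P (of_real x * c) (of_real y * d) \<in> \<Omega>"
      "norm (rpartial j d (rpartial i c f) (?P (of_real x * c) (of_real y * d)) - ?m) \<le> \<epsilon>"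
    if "\<bar>x\<bar> < r / 2" "\<bar>y\<bar> < r / 2" for x y :: real
  proof -
    have n: "norm c = 1" "norm d = 1" using i j by auto
    have "norm (of_real x * c, of_real y * d) \<le> norm (of_real x * c) + norm (of_real y * d)"
      by (rule norm_Pair_le)
    also have "\<dots> < r" using that n by (simp add: norm_mult)
    finally have "norm (of_real x * c, of_real y * d) < r" .
    moreover have "(0, 0) = (0 :: complex \<times> complex)" by (simp add: zero_prod_def)
    ultimately have "(of_real x * c, of_real y * d) \<in> ball (0, 0) r" by (simp only: mem_ball dist_0_norm)
    from subsetD[OF r(2) this] have "?P (of_real x * c) (of_real y * d) \<in> S"
      by (simp only: mem_Collect_eq prod.case)
    then have "?P (of_real x * c) (of_real y * d) \<in> \<Omega>"
      "dist ?m (rpartial j d (rpartial i c f) (?P (of_real x * c) (of_real y * d))) < \<epsilon>"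
      by (auto simp: S_def)
    then show "?P (of_real x * c) (of_real y * d) \<in> \<Omega>"
      "norm (rpartial j d (rpartial i c f) (?P (of_real x * c) (of_real y * d)) - ?m) \<le> \<epsilon>"
      by (auto simp: dist_norm[symmetric] dist_commute[of ?m])
  qed
  have est: "norm (f (?P (of_real t * c) (of_real t * d)) - f (?P (of_real t * c) 0)
     - f (?P 0 (of_real t * d)) + f (?P 0 0) - of_real t ^ 2 * ?m) \<le> \<epsilon> * t ^ 2" if t: "0 < t" "t < r / 2" for t :: real
  proof -
    have inner: "norm (rpartial i c f (?P (of_real s * c) (of_real t * d)) - rpartial i c f (?P (of_real s * c) 0) - of_real t * ?m) \<le> \<epsilon> * t"
      if s: "0 \<le> s" "s \<le> t" for s :: real
    proof -
      \<comment> \<open>Removing the linear term leaves a function whose derivative is the deviation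
        of the second partial from \<open>?m\<close>, at most \<open>\<epsilon>\<close> in
        norm.\<close>
      let ?h = "\<lambda>y::real. rpartial i c f (?P (of_real s * c) (of_real y * d)) - y *\<^sub>R ?m"
      have "norm (?h t - ?h 0) \<le> \<epsilon> * t"
      proof (rule real_vector_bound)
        fix y :: real assume y: "0 \<le> y" "y \<le> t"
        have "\<bar>s\<bar> < r / 2" "\<bar>y\<bar> < r / 2" using s y t by auto
        note P = PS[OF this]
        show "(?h has_vector_derivative (rpartial j d (rpartial i c f) (?P (of_real s * c) (of_real y * d)) - ?m)) (at y)"
        proof (intro has_vector_derivative_diff)
          have "((\<lambda>y. rpartial i c f (shift j (of_real y * d) (shift i (of_real s * c) (origin I)))) has_vector_derivative
              rpartial j d (rpartial i c f) (?P (of_real s * c) (of_real y * d))) (at y)"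
            by (rule pderiv_at_line) (use smooth_pderiv_at[OF smi j P(1)] in \<open>simp add: shift_commute[of i]\<close>)
          then show "((\<lambda>y. rpartial i c f (?P (of_real s * c) (of_real y * d))) has_vector_derivative
              rpartial j d (rpartial i c f) (?P (of_real s * c) (of_real y * d))) (at y)"
            by (simp add: shift_commute[of i])
          show "((\<lambda>y. y *\<^sub>R ?m) has_vector_derivative ?m) (at y)"
            by (auto simp: has_vector_derivative_def intro!: derivative_eq_intros)
        qed
        show "norm (rpartial j d (rpartial i c f) (?P (of_real s * c) (of_real y * d)) - ?m) \<le> \<epsilon>" by (rule P(2))
      qed (use t in simp)
      then show ?thesis by (simp add: scaleR_conv_of_real algebra_simps)
    qed
    let ?g = "\<lambda>s::real. f (?P (of_real s * c) (of_real t * d)) - f (?P (of_real s * c) 0) - s *\<^sub>R (of_real t * ?m)"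
    have "norm (?g t - ?g 0) \<le> (\<epsilon> * t) * t"
    proof (rule real_vector_bound)
      fix s :: real assume s: "0 \<le> s" "s \<le> t"
      have b: "\<bar>s\<bar> < r / 2" "\<bar>t\<bar> < r / 2" "\<bar>0::real\<bar> < r / 2" using s t by auto
      have 1: "?P (of_real s * c) (of_real t * d) \<in> \<Omega>" using PS(1)[OF b(1,2)] .
      have 2: "?P (of_real s * c) 0 \<in> \<Omega>" using PS(1)[OF b(1,3)] by simp
      show "(?g has_vector_derivative (rpartial i c f (?P (of_real s * c) (of_real t * d))
          - rpartial i c f (?P (of_real s * c) 0) - of_real t * ?m)) (at s)"
        by (intro has_vector_derivative_diff pderiv_at_line smooth_pderiv_at[OF sm i] 1 2)
          (auto simp: has_vector_derivative_def intro!: derivative_eq_intros)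
      show "norm (rpartial i c f (?P (of_real s * c) (of_real t * d))
          - rpartial i c f (?P (of_real s * c) 0) - of_real t * ?m) \<le> \<epsilon> * t" using inner[OF s] .
    qed (use t in simp)
    then show ?thesis by (simp add: scaleR_conv_of_real algebra_simps power2_eq_square)
  qed
  have "eventually (\<lambda>t. t \<in> {0<..<r / 2}) (at_right (0::real))"
    using r(1) by (intro eventually_at_right_real) simp
  then show ?thesis
    by eventually_elim (use est in auto)
qed

text \<open>The double difference is bounded by a multiple of \<open>t ^ 3\<close>, yet it equals
  \<open>t ^ 2\<close> times the second partial up to \<open>\<epsilon> * t ^ 2\<close>. For small
  \<open>t\<close> this bounds the partial by \<open>\<epsilon> + \<epsilon>\<close>, for every
  positive \<open>\<epsilon>\<close>.\<close>

lemma bigO_second_rpartial_eq_0: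
  assumes fin: "finite I" and o: "origin I \<in> \<Omega>" and sm: "smooth I \<Omega> f" and O: "f \<in> bigO_pow I 3"
    and i: "i \<in> I" "c \<in> {1, \<i>}" and j: "j \<in> I" "d \<in> {1, \<i>}"
  shows "rpartial j d (rpartial i c f) (origin I) = 0"
proof -
  let ?m = "rpartial j d (rpartial i c f) (origin I)"
  let ?P = "\<lambda>x y. shift i x (shift j y (origin I))"
  obtain C1 where C1: "C1 \<ge> 0" "eventually (\<lambda>t. norm (f (?P (of_real t * c) (of_real t * d))) \<le> C1 * \<bar>t\<bar> ^ 3) (nhds (0::real))"
    using bigO_shift2[OF fin O i(1) j(1) i(2) j(2)] .
  \<comment> \<open>\<open>bigO_shift2\<close> speaks of two moves; a single move by
    \<open>t\<close> is two equal moves by \<open>t / 2\<close>.\<close>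
  have half: "\<exists>C\<ge>0. eventually (\<lambda>t. norm (f (shift i (of_real t * c) (origin I))) \<le> C * \<bar>t\<bar> ^ 3) (nhds (0::real))"
    if ic: "i \<in> I" "c \<in> {1, \<i>}" for i c
  proof -
    obtain C where C: "C \<ge> 0" "eventually (\<lambda>t. norm (f (shift i (of_real t * c) (shift i (of_real t * c) (origin I)))) \<le> C * \<bar>t\<bar> ^ 3) (nhds (0::real))"
      using bigO_shift2[OF fin O ic(1) ic(1) ic(2) ic(2)] .
    have "filterlim (\<lambda>t::real. t / 2) (nhds 0) (nhds 0)"
      using tendsto_divide[OF filterlim_ident[of "nhds (0::real)"] tendsto_const[of 2]] by simp
    then have "eventually (\<lambda>t. norm (f (shift i (of_real (t/2) * c) (shift i (of_real (t/2) * c) (origin I)))) \<le> C * \<bar>t/2\<bar> ^ 3) (nhds (0::real))"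
      using C(2) unfolding filterlim_iff by blast
    then have "eventually (\<lambda>t. norm (f (shift i (of_real t * c) (origin I))) \<le> C * \<bar>t\<bar> ^ 3) (nhds (0::real))"
    proof eventually_elim
      case (elim t)
      have "of_real (t/2) * c + of_real (t/2) * c = of_real t * c" by (simp add: field_simps)
      then have "norm (f (shift i (of_real t * c) (origin I))) \<le> C * \<bar>t/2\<bar> ^ 3"
        using elim by (simp only: shift_add)
      also have "\<dots> \<le> C * \<bar>t\<bar> ^ 3" using C(1) by (intro mult_left_mono power_mono) auto
      finally show ?case .
    qed
    then show ?thesis using C(1) by blast
  qed
  obtain C2 where C2: "C2 \<ge> 0" "eventually (\<lambda>t. norm (f (shift i (of_real t * c) (origin I))) \<le> C2 * \<bar>t\<bar> ^ 3) (nhds (0::real))"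
    using half[OF i] by blast
  obtain C3 where C3: "C3 \<ge> 0" "eventually (\<lambda>t. norm (f (shift j (of_real t * d) (origin I))) \<le> C3 * \<bar>t\<bar> ^ 3) (nhds (0::real))"
    using half[OF j] by blast
  have f0: "f (origin I) = 0" using eventually_nhds_x_imp_x[OF C2(2)] by simp
  have right: "eventually Q (at_right (0::real))" if "eventually Q (nhds (0::real))" for Q
    unfolding eventually_at_filter using that by (rule eventually_mono) simp
  have le: "norm ?m \<le> \<epsilon> + \<epsilon>" if \<epsilon>: "\<epsilon> > 0" for \<epsilon>
  proof -
    let ?K = "C1 + C2 + C3"
    \<comment> \<open>On this interval \<open>?K * t \<le> \<epsilon>\<close>; the summand 1 keeps
      the denominator positive when \<open>?K = 0\<close>.\<close>
    have "eventually (\<lambda>t. t \<in> {0<..<\<epsilon> / (?K + 1)}) (at_right (0::real))"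
      using \<epsilon> C1 C2 C3 by (intro eventually_at_right_real) (auto intro!: divide_pos_pos)
    with right[OF C1(2)] right[OF C2(2)] right[OF C3(2)] second_partial_estimate[OF o sm i j \<epsilon>]
    have "eventually (\<lambda>t. norm ?m \<le> \<epsilon> + \<epsilon>) (at_right (0::real))"
    proof eventually_elim
      case (elim t)
      let ?D = "f (?P (of_real t * c) (of_real t * d)) - f (shift i (of_real t * c) (origin I)) - f (shift j (of_real t * d) (origin I)) + f (origin I)"
      have t: "0 < t" "t < \<epsilon> / (?K + 1)" using elim by auto
      have "norm ?D \<le> norm (f (?P (of_real t * c) (of_real t * d))) + norm (f (shift i (of_real t * c) (origin I))) + norm (f (shift j (of_real t * d) (origin I)))"
        unfolding f0 by (smt (verit) norm_triangle_ineq4 add_0_right)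
      also have "\<dots> \<le> ?K * t ^ 3" using elim t by (simp add: algebra_simps)
      finally have D: "norm ?D \<le> ?K * t ^ 3" .
      have "norm (of_real t ^ 2 * ?m) \<le> norm ?D + norm (?D - of_real t ^ 2 * ?m)"
        by (metis norm_triangle_sub norm_minus_commute)
      also have "\<dots> \<le> ?K * t ^ 3 + \<epsilon> * t ^ 2" using D elim by linarith
      also have "\<dots> = t ^ 2 * (?K * t + \<epsilon>)" by (simp add: algebra_simps power2_eq_square power3_eq_cube)
      finally have "t ^ 2 * norm ?m \<le> t ^ 2 * (?K * t + \<epsilon>)" by (simp add: norm_mult norm_power)
      then have "norm ?m \<le> ?K * t + \<epsilon>" using t by simp
      moreover have "?K * t \<le> \<epsilon>"
      proof -
        have "?K * t \<le> (?K + 1) * t" using t by simp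
        also have "\<dots> \<le> \<epsilon>" using t C1 C2 C3 by (simp add: pos_less_divide_eq mult.commute less_imp_le)
        finally show ?thesis .
      qed
      ultimately show ?case by linarith
    qed
    then show ?thesis
      using eventually_happens[of _ "at_right (0::real)"] trivial_limit_at_right_real by auto
  qed
  have "norm ?m \<le> 0"
  proof (rule field_le_epsilon)
    fix \<epsilon> :: real assume "\<epsilon> > 0"
    then show "norm ?m \<le> 0 + \<epsilon>" using le[of "\<epsilon> / 2"] by simp
  qed
  then show ?thesis by simp
qed

end

text \<open>The coefficients are hidden behind an existential quantifier, so that the jet and its
  derivatives can be stated by values \<open>L v\<close>, \<open>B v\<close> and
  \<open>S v u\<close> alone.\<close>

definition lin_form :: "'i set \<Rightarrow> (('i \<Rightarrow> complex) \<Rightarrow> complex) \<Rightarrow> bool" where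
  "lin_form I L \<longleftrightarrow> (\<exists>a. \<forall>v. L v = (\<Sum>i\<in>I. a i * v i))"

definition antilin_form :: "'i set \<Rightarrow> (('i \<Rightarrow> complex) \<Rightarrow> complex) \<Rightarrow> bool" where
  "antilin_form I B \<longleftrightarrow> (\<exists>b. \<forall>v. B v = (\<Sum>i\<in>I. b i * cnj (v i)))"

definition sesq_form :: "'i set \<Rightarrow> (('i \<Rightarrow> complex) \<Rightarrow> ('i \<Rightarrow> complex) \<Rightarrow> complex) \<Rightarrow> bool" where
  "sesq_form I S \<longleftrightarrow> (\<exists>M. \<forall>u v. S u v = (\<Sum>i\<in>I. \<Sum>j\<in>I. M i j * (u i * cnj (v j))))"

lemma lin_form_zero: "lin_form I (\<lambda>_. 0)"
  unfolding lin_form_def by (intro exI[of _ "\<lambda>_. 0"]) simp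

lemma antilin_form_zero: "antilin_form I (\<lambda>_. 0)"
  unfolding antilin_form_def by (intro exI[of _ "\<lambda>_. 0"]) simp

lemma sesq_form_zero: "sesq_form I (\<lambda>_ _. 0)"
  unfolding sesq_form_def by (intro exI[of _ "\<lambda>_ _. 0"]) simp

lemma lin_form_coord: "finite I \<Longrightarrow> k \<in> I \<Longrightarrow> lin_form I (\<lambda>v. v k)"
  unfolding lin_form_def by (intro exI[of _ "\<lambda>i. if i = k then 1 else 0"]) (simp add: if_distrib[of "\<lambda>x. x * _"] cong: if_cong)

lemma antilin_form_coord: "finite I \<Longrightarrow> k \<in> I \<Longrightarrow> antilin_form I (\<lambda>v. cnj (v k))"
  unfolding antilin_form_def by (intro exI[of _ "\<lambda>i. if i = k then 1 else 0"]) (simp add: if_distrib[of "\<lambda>x. x * _"] cong: if_cong)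

lemma sesq_form_coord:
  assumes "finite I" "k \<in> I" "l \<in> I"
  shows "sesq_form I (\<lambda>u v. u k * cnj (v l))"
  unfolding sesq_form_def
proof (intro exI[of _ "\<lambda>i j. if i = k then (if j = l then 1 else 0) else 0"] allI)
  fix u v :: "'a \<Rightarrow> complex"
  have "(\<Sum>i\<in>I. \<Sum>j\<in>I. (if i = k then (if j = l then 1 else 0) else 0) * (u i * cnj (v j)))
     = (\<Sum>i\<in>I. if i = k then (\<Sum>j\<in>I. if j = l then u k * cnj (v l) else 0) else 0)"
    by (intro sum.cong refl) (auto intro!: sum.cong)
  then show "u k * cnj (v l) = (\<Sum>i\<in>I. \<Sum>j\<in>I. (if i = k then (if j = l then 1 else 0) else 0) * (u i * cnj (v j)))"
    using assms by simp
qed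

lemma sesq_form_add: "sesq_form I S \<Longrightarrow> sesq_form I T \<Longrightarrow> sesq_form I (\<lambda>u v. S u v + T u v)"
proof -
  assume "sesq_form I S" "sesq_form I T"
  then obtain M N where "\<And>u v. S u v = (\<Sum>i\<in>I. \<Sum>j\<in>I. M i j * (u i * cnj (v j)))"
    "\<And>u v. T u v = (\<Sum>i\<in>I. \<Sum>j\<in>I. N i j * (u i * cnj (v j)))" unfolding sesq_form_def by blast
  then show ?thesis unfolding sesq_form_def
    by (intro exI[of _ "\<lambda>i j. M i j + N i j"]) (simp add: sum.distrib distrib_right)
qed

lemma sesq_form_cmult: "sesq_form I S \<Longrightarrow> sesq_form I (\<lambda>u v. c * S u v)"
proof -
  assume "sesq_form I S"
  then obtain M where "\<And>u v. S u v = (\<Sum>i\<in>I. \<Sum>j\<in>I. M i j * (u i * cnj (v j)))"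
    unfolding sesq_form_def by blast
  then show ?thesis unfolding sesq_form_def
    by (intro exI[of _ "\<lambda>i j. c * M i j"]) (simp add: sum_distrib_left mult.assoc)
qed

lemma sesq_form_diff: "sesq_form I S \<Longrightarrow> sesq_form I T \<Longrightarrow> sesq_form I (\<lambda>u v. S u v - T u v)"
  using sesq_form_add[OF _ sesq_form_cmult[of I T "- 1"]] by simp

lemma sesq_form_sum: "(\<And>x. x \<in> A \<Longrightarrow> sesq_form I (S x)) \<Longrightarrow> sesq_form I (\<lambda>u v. \<Sum>x\<in>A. S x u v)"
  by (induction A rule: infinite_finite_induct) (auto intro: sesq_form_add sesq_form_zero)

lemma pderiv_at_sum:
  "(\<And>x. x \<in> A \<Longrightarrow> pderiv_at i c (f x) p (D x)) \<Longrightarrow> pderiv_at i c (\<lambda>p. \<Sum>x\<in>A. f x p) p (\<Sum>x\<in>A. D x)"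
  by (induction A rule: infinite_finite_induct) (auto intro: pderiv_at_add pderiv_at_const)

lemma pderiv_at_cmult: "pderiv_at i c f p D \<Longrightarrow> pderiv_at i c (\<lambda>p. a * f p) p (a * D)"
  using pderiv_at_mult[OF pderiv_at_const, of i c f p D a] by simp

lemma pderiv_at_cnj_coord: "pderiv_at i c (\<lambda>p. cnj (p j)) p (if i = j then cnj c else 0)"
  using pderiv_at_cnj[OF pderiv_at_coord, of i c j p] by (simp split: if_splits)

lemma bigO_pow_coord:
  assumes "finite I" "i \<in> I"
  shows "(\<lambda>w. w i) \<in> bigO_pow I 1"
proof (rule landau_o.bigI[of 1])
  have "norm (w i) \<le> nrm I w" for w :: "'a \<Rightarrow> complex"
    unfolding nrm_def using assms by (intro member_le_sum) auto
  then show "eventually (\<lambda>w. norm (w i) \<le> 1 * norm (complex_of_real (nrm I w) ^ 1)) (at_origin I)"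
    by (simp add: nrm_nonneg)
qed simp

lemma bigO_pow_mult: "f \<in> bigO_pow I a \<Longrightarrow> g \<in> bigO_pow I b \<Longrightarrow> (\<lambda>w. f w * g w) \<in> bigO_pow I (a + b)"
  unfolding power_add by (rule landau_o.big.mult)

lemma bigO_pow_cnj: "f \<in> bigO_pow I a \<Longrightarrow> (\<lambda>w. cnj (f w)) \<in> bigO_pow I a"
  by (subst landau_o.big.norm_iff[symmetric], subst (asm) landau_o.big.norm_iff[symmetric]) simp

context open_domain
begin

lemma hpartial_add:
  assumes "p \<in> \<Omega>" "smooth I \<Omega> f" "smooth I \<Omega> g" "i \<in> I"
  shows "hpartial i (\<lambda>q. f q + g q) p = hpartial i f p + hpartial i g p"
proof -
  have "rpartial i c (\<lambda>q. f q + g q) p = rpartial i c f p + rpartial i c g p" if "c \<in> {1, \<i>}" for c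
    using pderiv_at_add[OF smooth_pderiv_at[OF assms(2,4) that assms(1)] smooth_pderiv_at[OF assms(3,4) that assms(1)]]
    by (rule pderiv_at_rpartial)
  then show ?thesis by (simp add: hpartial_def field_simps)
qed

lemma d_hol_add:
  assumes "p \<in> \<Omega>" "smooth I \<Omega> f" "smooth I \<Omega> g"
  shows "d_hol I (\<lambda>q. f q + g q) p v = d_hol I f p v + d_hol I g p v"
  using hpartial_add[OF assms] by (simp add: d_hol_def sum.distrib distrib_right)

lemma continuous_tendsto_origin:
  fixes f :: "('i \<Rightarrow> complex) \<Rightarrow> complex"
  assumes o: "origin I \<in> \<Omega>" and f: "continuous_map (subtopology (cspace I) \<Omega>) euclidean f"
  shows "(f \<longlongrightarrow> f (origin I)) (at_origin I)"
  unfolding tendsto_def eventually_nhdsin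
proof (intro allI impI disjI2)
  fix V assume V: "open V" "f (origin I) \<in> V"
  let ?S = "{w \<in> topspace (subtopology (cspace I) \<Omega>). f w \<in> V}"
  have "openin (subtopology (cspace I) \<Omega>) ?S"
    using V(1) by (intro openin_continuous_map_preimage[OF f]) simp
  then have "openin (cspace I) ?S" using openin_domain openin_trans_full by blast
  moreover have "origin I \<in> ?S" using V(2) o origin_mem[of I] by simp
  ultimately show "\<exists>S. openin (cspace I) S \<and> origin I \<in> S \<and> (\<forall>w\<in>S. f w \<in> V)" by blast
qed

lemma tendsto_nrm:
  assumes fin: "finite I" and o: "origin I \<in> \<Omega>"
  shows "((\<lambda>w. complex_of_real (nrm I w)) \<longlongrightarrow> 0) (at_origin I)"
proof -
  have "continuous_map (cspace I) euclidean (\<lambda>w. complex_of_real (nrm I w))"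
    unfolding nrm_def of_real_sum
  proof (intro continuous_map_sum fin)
    fix i assume "i \<in> I"
    have "continuous_map euclidean euclidean (\<lambda>x::complex. complex_of_real (norm x))"
      by (auto intro!: continuous_intros)
    from continuous_map_compose[OF continuous_map_product_projection[OF \<open>i \<in> I\<close>] this]
    show "continuous_map (cspace I) euclidean (\<lambda>w. complex_of_real (norm (w i)))" by (simp add: o_def)
  qed
  then have "continuous_map (subtopology (cspace I) \<Omega>) euclidean (\<lambda>w. complex_of_real (nrm I w))"
    by (rule continuous_map_from_subtopology)
  moreover have "nrm I (origin I) = 0" by (simp add: nrm_def origin_def)
  ultimately show ?thesis using continuous_tendsto_origin[OF o] by fastforce
qed

lemma bigO_pow_mono:
  assumes fin: "finite I" and o: "origin I \<in> \<Omega>" and ab: "a \<le> b"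
  shows "bigO_pow I b \<subseteq> bigO_pow I a"
proof -
  \<comment> \<open>The limit is \<open>0 ^ (b - a)\<close>, which is 1 for \<open>a = b\<close> and
    0 otherwise; in both cases the function is bounded near the origin.\<close>
  have "(\<lambda>w. complex_of_real (nrm I w) ^ (b - a)) \<in> O[at_origin I](\<lambda>_. 1)"
    by (rule bigoI_tendsto[where c = "0 ^ (b - a)"]) (auto intro!: tendsto_power tendsto_nrm[OF fin o])
  from landau_o.big.mult[OF this landau_o.big_refl[of "\<lambda>w. complex_of_real (nrm I w) ^ a"]]
  have "(\<lambda>w. complex_of_real (nrm I w) ^ b) \<in> bigO_pow I a"
    using ab by (simp add: power_add[symmetric])
  then show ?thesis using landau_o.big_trans by blast
qed

lemma smooth_bigO_0:
  assumes o: "origin I \<in> \<Omega>" and f: "smooth I \<Omega> f"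
  shows "f \<in> bigO_pow I 0"
proof -
  have "Ck 0 I \<Omega> f" using f unfolding smooth_def by blast
  then have "(f \<longlongrightarrow> f (origin I)) (at_origin I)" by (intro continuous_tendsto_origin[OF o]) simp
  then show ?thesis by (intro bigoI_tendsto[where c = "f (origin I)"]) auto
qed

text \<open>\<open>d_hol\<close> and \<open>d_fun\<close> together produce combinations of iterated
  \<open>rpartial\<close>s of second order, and each of these vanishes for a smooth remainder of
  order 3.\<close>

lemma bigO_jet_zero:
  assumes fin: "finite I" and o: "origin I \<in> \<Omega>" and sm: "smooth I \<Omega> f" and O: "f \<in> bigO_pow I 3"
  shows "d_fun I f (origin I) v = 0" "d_hol I f (origin I) v = 0" "d_fun I (\<lambda>q. d_hol I f q v) (origin I) u = 0"
proof -
  have O2: "f \<in> bigO_pow I 2" using bigO_pow_mono[OF fin o, of 2 3] O by auto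
  have z: "rpartial i c f (origin I) = 0" if "i \<in> I" "c \<in> {1, \<i>}" for i c
    using bigO_rpartial_eq_0[OF fin o sm O2 that] .
  show "d_fun I f (origin I) v = 0" "d_hol I f (origin I) v = 0"
    using z by (simp_all add: d_fun_def d_hol_def hpartial_def)
  have h: "rpartial j d (hpartial i f) (origin I) = 0" if i: "i \<in> I" and j: "j \<in> I" "d \<in> {1, \<i>}" for i j d
  proof -
    have "pderiv_at j d (rpartial i c f) (origin I) 0" if c: "c \<in> {1, \<i>}" for c
      using smooth_pderiv_at[OF smooth_rpartial[OF sm i c] j o] bigO_second_rpartial_eq_0[OF fin o sm O i c j] by simp
    then have 1: "pderiv_at j d (rpartial i 1 f) (origin I) 0" "pderiv_at j d (rpartial i \<i> f) (origin I) 0" by auto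
    have "pderiv_at j d (\<lambda>p. (1/2) * rpartial i 1 f p + (- \<i> / 2) * rpartial i \<i> f p) (origin I) ((1/2) * 0 + (- \<i> / 2) * 0)"
      by (intro pderiv_at_add pderiv_at_cmult 1)
    moreover have "(\<lambda>p. (1/2) * rpartial i 1 f p + (- \<i> / 2) * rpartial i \<i> f p) = hpartial i f"
      by (auto simp: hpartial_def fun_eq_iff field_simps)
    ultimately show ?thesis by (intro pderiv_at_rpartial) simp
  qed
  have "d_fun I (\<lambda>q. d_hol I f q v) (origin I) u = (\<Sum>i\<in>I. d_fun I (\<lambda>q. hpartial i f q * v i) (origin I) u)"
    unfolding d_hol_def by (intro d_fun_sum o smooth_mult smooth_hpartial sm smooth_const)
  also have "\<dots> = (\<Sum>i\<in>I. 0)"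
  proof (intro sum.cong refl)
    fix i assume i: "i \<in> I"
    have "d_fun I (\<lambda>q. hpartial i f q * v i) (origin I) u
       = hpartial i f (origin I) * d_fun I (\<lambda>_. v i) (origin I) u + d_fun I (hpartial i f) (origin I) u * v i"
      by (intro d_fun_mult o smooth_hpartial sm i smooth_const)
    also have "\<dots> = 0" unfolding d_fun_const using h[OF i] by (simp add: d_fun_def)
    finally show "d_fun I (\<lambda>q. hpartial i f q * v i) (origin I) u = 0" .
  qed
  finally show "d_fun I (\<lambda>q. d_hol I f q v) (origin I) u = 0" by simp
qed

text \<open>The quadratic part is purely of type (1,1). The (1,0)-derivative of the polynomial in
  direction \<open>v\<close> is therefore a constant plus a term in the conjugate coordinates, and
  its real differential in direction \<open>u\<close> is exactly \<open>S v u\<close>, already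
  antilinear in \<open>u\<close>.\<close>

lemma jet_derivatives:
  assumes fin: "finite I" and o: "origin I \<in> \<Omega>" and sm: "smooth I \<Omega> f"
    and L: "lin_form I L" and B: "antilin_form I B" and S: "sesq_form I S"
    and O: "(\<lambda>w. f w - (c0 + L w + B w + S w w)) \<in> bigO_pow I 3"
  shows "f (origin I) = c0" "d_fun I f (origin I) v = L v + B v" "d_hol I f (origin I) v = L v"
    "d_fun I (\<lambda>q. d_hol I f q v) (origin I) u = S v u"
proof -
  obtain a where a: "\<And>v. L v = (\<Sum>i\<in>I. a i * v i)" using L unfolding lin_form_def by blast
  obtain b where b: "\<And>v. B v = (\<Sum>i\<in>I. b i * cnj (v i))" using B unfolding antilin_form_def by blast
  obtain M where M: "\<And>u v. S u v = (\<Sum>i\<in>I. \<Sum>j\<in>I. M i j * (u i * cnj (v j)))"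
    using S unfolding sesq_form_def by blast
  define P where "P = (\<lambda>w. c0 + L w + B w + S w w)"
  define R where "R = (\<lambda>w. f w - P w)"
  have smP: "smooth I \<Omega> P"
    unfolding P_def a b M by (intro smooth_add smooth_sum smooth_mult smooth_const smooth_cnj smooth_coord)
  have smR: "smooth I \<Omega> R" unfolding R_def by (intro smooth_diff sm smP)
  have OR: "R \<in> bigO_pow I 3" using O unfolding R_def P_def .
  have f: "f = (\<lambda>w. P w + R w)" by (simp add: R_def)
  note jR = bigO_jet_zero[OF fin o smR OR]
  have pdP: "pderiv_at i c P q (a i * c + b i * cnj c + (\<Sum>j\<in>I. M i j * cnj (q j)) * c + (\<Sum>k\<in>I. M k i * q k) * cnj c)"
    if i: "i \<in> I" for i c q
  proof -
    have "pderiv_at i c P q (0 + (\<Sum>k\<in>I. a k * (if i = k then c else 0)) + (\<Sum>k\<in>I. b k * (if i = k then cnj c else 0))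
       + (\<Sum>k\<in>I. \<Sum>j\<in>I. M k j * (q k * (if i = j then cnj c else 0) + (if i = k then c else 0) * cnj (q j))))"
      unfolding P_def a b M
      by (intro pderiv_at_add pderiv_at_const pderiv_at_sum pderiv_at_cmult pderiv_at_mult pderiv_at_coord pderiv_at_cnj_coord)
    moreover have "(\<Sum>k\<in>I. \<Sum>j\<in>I. M k j * (q k * (if i = j then cnj c else 0) + (if i = k then c else 0) * cnj (q j)))
       = (\<Sum>k\<in>I. (\<Sum>j\<in>I. if i = j then M k j * q k * cnj c else 0) + (if i = k then (\<Sum>j\<in>I. M k j * cnj (q j) * c) else 0))"
      by (intro sum.cong refl) (auto simp: sum.distrib[symmetric] algebra_simps intro!: sum.cong)
    moreover have "\<dots> = (\<Sum>j\<in>I. M i j * cnj (q j)) * c + (\<Sum>k\<in>I. M k i * q k) * cnj c"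
      using fin i by (simp add: sum.distrib sum_distrib_right)
    moreover have "(\<Sum>k\<in>I. a k * (if i = k then c else 0)) = a i * c" "(\<Sum>k\<in>I. b k * (if i = k then cnj c else 0)) = b i * cnj c"
      using fin i by (simp_all add: if_distrib[of "\<lambda>x. _ * x"] cong: if_cong)
    ultimately show ?thesis by (simp add: add.assoc)
  qed
  have rp: "rpartial i c P q = a i * c + b i * cnj c + (\<Sum>j\<in>I. M i j * cnj (q j)) * c + (\<Sum>k\<in>I. M k i * q k) * cnj c"
    if i: "i \<in> I" for i c q using pdP[OF that] by (rule pderiv_at_rpartial)
  have hp: "hpartial i P q = a i + (\<Sum>j\<in>I. M i j * cnj (q j))" if "i \<in> I" for i q
    by (simp add: hpartial_def rp[OF that] algebra_simps)
  have zero: "origin I i = 0" if "i \<in> I" for i using that by (simp add: origin_def)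
  have rp0: "rpartial i c P (origin I) = a i * c + b i * cnj c" if i: "i \<in> I" for i c
    using zero by (simp add: rp[OF i])
  have hp0: "hpartial i P (origin I) = a i" if i: "i \<in> I" for i
    using zero by (simp add: hp[OF i])
  have dP: "d_fun I P (origin I) v = L v + B v"
  proof -
    have "rpartial i 1 P (origin I) * of_real (Re (v i)) + rpartial i \<i> P (origin I) * of_real (Im (v i))
       = a i * v i + b i * cnj (v i)" if "i \<in> I" for i
      by (simp add: rp0[OF that] complex_eq_iff algebra_simps)
    then show ?thesis by (simp add: d_fun_def a b sum.distrib)
  qed
  have hP: "d_hol I P (origin I) v = L v" by (simp add: d_hol_def hp0 a)
  have ddP: "d_fun I (\<lambda>q. d_hol I P q v) (origin I) u = S v u"
  proof -
    have eq: "(\<lambda>q. d_hol I P q v) = (\<lambda>q. \<Sum>i\<in>I. a i * v i + (\<Sum>j\<in>I. (M i j * v i) * cnj (q j)))"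
      by (simp add: d_hol_def hp fun_eq_iff distrib_right sum_distrib_right sum_distrib_left algebra_simps)
    have "rpartial j c (\<lambda>q. d_hol I P q v) (origin I) = (\<Sum>i\<in>I. M i j * v i * cnj c)" if j: "j \<in> I" for j c
    proof -
      have "pderiv_at j c (\<lambda>q. d_hol I P q v) (origin I)
          (\<Sum>i\<in>I. 0 + (\<Sum>k\<in>I. (M i k * v i) * (if j = k then cnj c else 0)))"
        unfolding eq by (intro pderiv_at_sum pderiv_at_add pderiv_at_const pderiv_at_cmult pderiv_at_cnj_coord)
      then show ?thesis
        using fin j by (simp add: pderiv_at_rpartial if_distrib[of "\<lambda>x. _ * x"] cong: if_cong)
    qed
    then have "d_fun I (\<lambda>q. d_hol I P q v) (origin I) u
       = (\<Sum>j\<in>I. (\<Sum>i\<in>I. M i j * v i * cnj 1) * of_real (Re (u j)) + (\<Sum>i\<in>I. M i j * v i * cnj \<i>) * of_real (Im (u j)))"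
      by (simp add: d_fun_def)
    also have "\<dots> = (\<Sum>j\<in>I. \<Sum>i\<in>I. M i j * (v i * cnj (u j)))"
    proof (intro sum.cong refl)
      fix j
      have c: "cnj (u j) = of_real (Re (u j)) - \<i> * of_real (Im (u j))" by (simp add: complex_eq_iff)
      have "M i j * v i * cnj 1 * of_real (Re (u j)) + M i j * v i * cnj \<i> * of_real (Im (u j)) = M i j * (v i * cnj (u j))" for i
        unfolding c by (simp add: algebra_simps)
      then show "(\<Sum>i\<in>I. M i j * v i * cnj 1) * of_real (Re (u j)) + (\<Sum>i\<in>I. M i j * v i * cnj \<i>) * of_real (Im (u j))
          = (\<Sum>i\<in>I. M i j * (v i * cnj (u j)))"
        unfolding sum_distrib_right sum.distrib[symmetric] by (intro sum.cong refl)
    qed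
    finally show ?thesis unfolding M by (subst sum.swap)
  qed
  \<comment> \<open>The filter contains the origin, where the bound \<open>nrm I w ^ 3\<close> is
    zero.\<close>
  have R0: "R (origin I) = 0"
  proof -
    obtain C where "eventually (\<lambda>w. norm (R w) \<le> C * norm (complex_of_real (nrm I w) ^ 3)) (at_origin I)"
      using OR by (auto elim!: landau_o.bigE)
    then have "norm (R (origin I)) \<le> C * norm (complex_of_real (nrm I (origin I)) ^ 3)"
      unfolding eventually_nhdsin using origin_mem[of I] by blast
    then show ?thesis by (simp add: nrm_def origin_def)
  qed
  show "f (origin I) = c0" using R0 zero by (simp add: f P_def a b M)
  show "d_fun I f (origin I) v = L v + B v" unfolding f d_fun_add[OF o smP smR] using dP jR(1) by simp
  show "d_hol I f (origin I) v = L v" unfolding f d_hol_add[OF o smP smR] using hP jR(2) by simp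
  have "d_fun I (\<lambda>q. d_hol I f q v) (origin I) u = d_fun I (\<lambda>q. d_hol I P q v + d_hol I R q v) (origin I) u"
    by (rule d_fun_cong[OF o _ smooth_d_hol[OF sm]]) (simp add: f d_hol_add[OF _ smP smR])
  also have "\<dots> = S v u"
    using ddP jR(3) by (simp add: d_fun_add[OF o smooth_d_hol[OF smP] smooth_d_hol[OF smR]])
  finally show "d_fun I (\<lambda>q. d_hol I f q v) (origin I) u = S v u" .
qed

text \<open>The terms quadratic in \<open>L\<close>, coming from \<open>dA\<close> and from \<open>A \<and> A\<close>, cancel.\<close>

lemma chern_curvature_of_jet:
  assumes fin: "finite I" "finite J" and o: "origin I \<in> \<Omega>"
    and sm: "\<And>\<alpha> \<beta>. \<alpha> \<in> J \<Longrightarrow> \<beta> \<in> J \<Longrightarrow> smooth I \<Omega> (H \<alpha> \<beta>)"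
    and an: "\<And>p. p \<in> \<Omega> \<Longrightarrow> anisotropic J (\<lambda>\<alpha> \<beta>. H \<alpha> \<beta> p)"
    and herm: "\<And>p \<alpha> \<beta>. p \<in> \<Omega> \<Longrightarrow> \<alpha> \<in> J \<Longrightarrow> \<beta> \<in> J \<Longrightarrow> H \<beta> \<alpha> p = cnj (H \<alpha> \<beta> p)"
    and L: "\<And>\<alpha> \<beta>. \<alpha> \<in> J \<Longrightarrow> \<beta> \<in> J \<Longrightarrow> lin_form I (L \<alpha> \<beta>)"
    and B: "\<And>\<alpha> \<beta>. \<alpha> \<in> J \<Longrightarrow> \<beta> \<in> J \<Longrightarrow> antilin_form I (B \<alpha> \<beta>)"
    and S: "\<And>\<alpha> \<beta>. \<alpha> \<in> J \<Longrightarrow> \<beta> \<in> J \<Longrightarrow> sesq_form I (S \<alpha> \<beta>)"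
    and O: "\<And>\<alpha> \<beta>. \<alpha> \<in> J \<Longrightarrow> \<beta> \<in> J \<Longrightarrow>
      (\<lambda>w. H \<alpha> \<beta> w - ((if \<alpha> = \<beta> then 1 else 0) + L \<alpha> \<beta> w + B \<alpha> \<beta> w + S \<alpha> \<beta> w w)) \<in> bigO_pow I 3"
  obtains a where "chern_connection I \<Omega> J H a"
    "\<And>\<alpha> \<beta> u v. \<alpha> \<in> J \<Longrightarrow> \<beta> \<in> J \<Longrightarrow> curvature_matrix I J a (origin I) \<beta> \<alpha> u v =
       S \<alpha> \<beta> v u - S \<alpha> \<beta> u v - (\<Sum>\<gamma>\<in>J. L \<alpha> \<gamma> v * B \<gamma> \<beta> u - L \<alpha> \<gamma> u * B \<gamma> \<beta> v)"
proof -
  obtain a where a: "chern_connection I \<Omega> J H a"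
    and eq: "\<And>p \<alpha> \<beta> v. p \<in> \<Omega> \<Longrightarrow> \<alpha> \<in> J \<Longrightarrow> \<beta> \<in> J \<Longrightarrow>
      (\<Sum>\<gamma>\<in>J. conn_form I (a \<gamma> \<alpha>) p v * H \<gamma> \<beta> p) = d_hol I (H \<alpha> \<beta>) p v"
    using chern_connection_exists[OF fin(2) sm an herm] by blast
  note j = jet_derivatives[OF fin(1) o sm L B S O]
  have one: "H \<alpha> \<beta> (origin I) = (if \<alpha> = \<beta> then 1 else 0)" if "\<alpha> \<in> J" "\<beta> \<in> J" for \<alpha> \<beta>
    using j(1)[OF that that that that that] .
  have "curvature_matrix I J a (origin I) \<beta> \<alpha> u v =
       S \<alpha> \<beta> v u - S \<alpha> \<beta> u v - (\<Sum>\<gamma>\<in>J. L \<alpha> \<gamma> v * B \<gamma> \<beta> u - L \<alpha> \<gamma> u * B \<gamma> \<beta> v)"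
    if \<alpha>\<beta>: "\<alpha> \<in> J" "\<beta> \<in> J" for \<alpha> \<beta> u v
  proof -
    have "(\<Sum>\<gamma>\<in>J. d_hol I (H \<alpha> \<gamma>) (origin I) v * d_fun I (H \<gamma> \<beta>) (origin I) u) = (\<Sum>\<gamma>\<in>J. L \<alpha> \<gamma> v * (L \<gamma> \<beta> u + B \<gamma> \<beta> u))" for u v
      using \<alpha>\<beta> by (intro sum.cong refl) (simp add: j)
    moreover have "(\<Sum>\<gamma>\<in>J. d_hol I (H \<gamma> \<beta>) (origin I) u * d_hol I (H \<alpha> \<gamma>) (origin I) v
        - d_hol I (H \<gamma> \<beta>) (origin I) v * d_hol I (H \<alpha> \<gamma>) (origin I) u)
       = (\<Sum>\<gamma>\<in>J. L \<gamma> \<beta> u * L \<alpha> \<gamma> v - L \<gamma> \<beta> v * L \<alpha> \<gamma> u)"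
      using \<alpha>\<beta> by (intro sum.cong refl) (simp add: j)
    moreover have "d_fun I (\<lambda>q. d_hol I (H \<alpha> \<beta>) q v) (origin I) u = S \<alpha> \<beta> v u" for u v
      using j(4)[OF \<alpha>\<beta> \<alpha>\<beta> \<alpha>\<beta> \<alpha>\<beta> \<alpha>\<beta>] .
    moreover note curvature_matrix_eq[OF fin(2) sm a eq o one \<alpha>\<beta>, of u v]
    ultimately show ?thesis by (simp add: sum_subtractf sum.distrib distrib_left mult.commute)
  qed
  then show ?thesis using that a by blast
qed

end


section \<open>Bases of complex vector spaces\<close>

lemma complex_ring_simps [simp]:
  "carrier complex_ring = UNIV" "x \<otimes>\<^bsub>complex_ring\<^esub> y = x * y" "\<one>\<^bsub>complex_ring\<^esub> = 1"
  "\<zero>\<^bsub>complex_ring\<^esub> = 0" "x \<oplus>\<^bsub>complex_ring\<^esub> y = x + y"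
  by (simp_all add: complex_ring_def)

locale complex_module = module complex_ring V for V :: "(complex, 'v) module" (structure)
begin

lemma smult_mem [simp, intro]: "x \<in> carrier V \<Longrightarrow> c \<odot> x \<in> carrier V"
  using smult_closed[of c x] by simp

lemma smult_add_left: "x \<in> carrier V \<Longrightarrow> (c + d) \<odot> x = c \<odot> x \<oplus> d \<odot> x"
  using smult_l_distr[of c d x] by simp

lemma smult_add_right:
  "x \<in> carrier V \<Longrightarrow> y \<in> carrier V \<Longrightarrow> c \<odot> (x \<oplus> y) = c \<odot> x \<oplus> c \<odot> y"
  using smult_r_distr[of c x y] by simp

lemma smult_smult: "x \<in> carrier V \<Longrightarrow> c \<odot> (d \<odot> x) = (c * d) \<odot> x"
  using smult_assoc1[of c d x] by simp

lemma smult_0_left [simp]: "x \<in> carrier V \<Longrightarrow> 0 \<odot> x = \<zero>"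
  using smult_l_null[of x] by simp

lemma smult_0_right [simp]: "c \<odot> \<zero> = \<zero>"
  using smult_r_null[of c] by simp

lemma smult_1 [simp]: "x \<in> carrier V \<Longrightarrow> 1 \<odot> x = x"
  using smult_one[of x] by simp

lemma smult_minus_1: "x \<in> carrier V \<Longrightarrow> (- 1) \<odot> x = \<ominus> x"
proof -
  assume x: "x \<in> carrier V"
  have "(- 1) \<odot> x \<oplus> x = \<zero>"
    using smult_add_left[OF x, of "- 1" 1] x by simp
  then show ?thesis using x by (metis M.minus_equality smult_mem)
qed

lemma lincomb_empty [simp]: "lincomb V {} c b = \<zero>"
  by (simp add: lincomb_def)

lemma lincomb_closed [simp, intro]: "b \<in> J \<rightarrow> carrier V \<Longrightarrow> lincomb V J c b \<in> carrier V"
  unfolding lincomb_def by (intro M.finsum_closed) auto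

lemma lincomb_insert:
  "finite J \<Longrightarrow> a \<notin> J \<Longrightarrow> b \<in> insert a J \<rightarrow> carrier V \<Longrightarrow>
    lincomb V (insert a J) c b = c a \<odot> b a \<oplus> lincomb V J c b"
  unfolding lincomb_def by (intro M.finsum_insert) auto

lemma lincomb_cong:
  "(\<And>\<alpha>. \<alpha> \<in> J \<Longrightarrow> c \<alpha> = c' \<alpha>) \<Longrightarrow> (\<And>\<alpha>. \<alpha> \<in> J \<Longrightarrow> b \<alpha> = b' \<alpha>) \<Longrightarrow> b' \<in> J \<rightarrow> carrier V \<Longrightarrow>
    lincomb V J c b = lincomb V J c' b'"
  unfolding lincomb_def by (intro M.finsum_cong') auto

lemma lincomb_add:
  assumes "b \<in> J \<rightarrow> carrier V"
  shows "lincomb V J c b \<oplus> lincomb V J d b = lincomb V J (\<lambda>\<alpha>. c \<alpha> + d \<alpha>) b"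
proof -
  have "lincomb V J (\<lambda>\<alpha>. c \<alpha> + d \<alpha>) b = (\<Oplus>\<alpha>\<in>J. c \<alpha> \<odot> b \<alpha> \<oplus> d \<alpha> \<odot> b \<alpha>)"
    unfolding lincomb_def using assms by (intro M.finsum_cong') (auto simp: smult_add_left Pi_iff)
  then show ?thesis unfolding lincomb_def using assms by (simp add: M.finsum_addf Pi_iff)
qed

lemma lincomb_smult:
  assumes "finite J" "b \<in> J \<rightarrow> carrier V"
  shows "a \<odot> lincomb V J c b = lincomb V J (\<lambda>\<alpha>. a * c \<alpha>) b"
  using assms
proof (induction J rule: finite_induct)
  case (insert x J)
  then show ?case by (simp add: lincomb_insert smult_add_right smult_smult Pi_iff)
qed simp

lemma lincomb_zero_coeff:
  assumes "finite J" "b \<in> J \<rightarrow> carrier V" "\<And>\<alpha>. \<alpha> \<in> J \<Longrightarrow> c \<alpha> = 0"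
  shows "lincomb V J c b = \<zero>"
  using assms
proof (induction J rule: finite_induct)
  case (insert x J)
  then show ?case by (simp add: lincomb_insert Pi_iff)
qed simp

lemma lincomb_minus:
  assumes "finite J" "b \<in> J \<rightarrow> carrier V"
  shows "\<ominus> lincomb V J c b = lincomb V J (\<lambda>\<alpha>. - c \<alpha>) b"
  using lincomb_smult[OF assms, of "- 1" c] smult_minus_1[of "lincomb V J c b"] assms by simp

lemma lincomb_mono:
  assumes "finite K" "J \<subseteq> K" "b \<in> K \<rightarrow> carrier V" "\<And>\<alpha>. \<alpha> \<in> K - J \<Longrightarrow> c \<alpha> = 0"
  shows "lincomb V K c b = lincomb V J c b"
  unfolding lincomb_def
  by (rule M.add.finprod_mono_neutral_cong_right[simplified])
    (use assms in \<open>auto simp: Pi_iff\<close>)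

lemma lincomb_union:
  assumes "finite J" "finite K" "J \<inter> K = {}" "b \<in> J \<union> K \<rightarrow> carrier V"
  shows "lincomb V (J \<union> K) c b = lincomb V J c b \<oplus> lincomb V K c b"
  unfolding lincomb_def using assms by (intro M.finsum_Un_disjoint) (auto simp: Pi_iff)

lemma lincomb_single:
  assumes "finite J" "a \<in> J" "b \<in> J \<rightarrow> carrier V"
  shows "lincomb V J (\<lambda>\<alpha>. if \<alpha> = a then x else 0) b = x \<odot> b a"
proof -
  have "lincomb V J (\<lambda>\<alpha>. if \<alpha> = a then x else 0) b = lincomb V {a} (\<lambda>\<alpha>. if \<alpha> = a then x else 0) b"
    using assms by (intro lincomb_mono) auto
  also have "\<dots> = x \<odot> b a" using lincomb_insert[of "{}" a b] assms by (simp add: Pi_iff)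
  finally show ?thesis .
qed

lemma lincomb_lincomb:
  assumes "finite J" "finite K" "b \<in> K \<rightarrow> carrier V"
  shows "lincomb V J c (\<lambda>\<alpha>. lincomb V K (N \<alpha>) b) = lincomb V K (\<lambda>\<gamma>. \<Sum>\<alpha>\<in>J. c \<alpha> * N \<alpha> \<gamma>) b"
  using assms(1)
proof (induction J rule: finite_induct)
  case empty
  then show ?case using assms by (simp add: lincomb_zero_coeff)
next
  case (insert x J)
  have "lincomb V (insert x J) c (\<lambda>\<alpha>. lincomb V K (N \<alpha>) b)
     = c x \<odot> lincomb V K (N x) b \<oplus> lincomb V K (\<lambda>\<gamma>. \<Sum>\<alpha>\<in>J. c \<alpha> * N \<alpha> \<gamma>) b"
    using insert assms by (subst lincomb_insert) auto
  then show ?case using insert assms by (simp add: lincomb_smult lincomb_add)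
qed

section \<open>Linear independence, spans and submodules\<close>

definition indep :: "nat set \<Rightarrow> (nat \<Rightarrow> 'v) \<Rightarrow> bool" where
  "indep J b \<longleftrightarrow> finite J \<and> b \<in> J \<rightarrow> carrier V \<and>
     (\<forall>c. lincomb V J c b = \<zero> \<longrightarrow> (\<forall>\<alpha>\<in>J. c \<alpha> = 0))"

lemma indep_unique:
  assumes "indep J b" "lincomb V J c b = lincomb V J d b" "\<alpha> \<in> J"
  shows "c \<alpha> = d \<alpha>"
proof -
  have f: "finite J" "b \<in> J \<rightarrow> carrier V" using assms(1) by (auto simp: indep_def)
  have "lincomb V J (\<lambda>\<alpha>. c \<alpha> + - d \<alpha>) b = lincomb V J c b \<oplus> \<ominus> lincomb V J d b"
    using f by (simp add: lincomb_minus lincomb_add)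
  also have "\<dots> = \<zero>" using assms(2) f by (simp add: M.r_neg)
  finally have "\<forall>\<alpha>\<in>J. c \<alpha> + - d \<alpha> = 0" using assms(1) unfolding indep_def by blast
  then show ?thesis using assms(3) by simp
qed

lemma indep_subset:
  assumes "indep K b" "J \<subseteq> K"
  shows "indep J b"
proof -
  have f: "finite K" "b \<in> K \<rightarrow> carrier V" using assms(1) by (auto simp: indep_def)
  have "c \<alpha> = 0" if "lincomb V J c b = \<zero>" "\<alpha> \<in> J" for c \<alpha>
  proof -
    define c' where "c' = (\<lambda>\<alpha>. if \<alpha> \<in> J then c \<alpha> else 0)"
    have "lincomb V K c' b = lincomb V J c' b"
      using f assms(2) by (intro lincomb_mono) (auto simp: c'_def)
    also have "\<dots> = lincomb V J c b" using f assms(2) by (intro lincomb_cong) (auto simp: c'_def)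
    finally have "c' \<alpha> = 0" using that assms f unfolding indep_def by auto
    then show ?thesis using that by (simp add: c'_def)
  qed
  then show ?thesis using f assms(2) finite_subset unfolding indep_def by blast
qed

text \<open>\<open>is_basis\<close> speaks of coefficient functions that are
  \<open>undefined\<close> outside \<open>J\<close>; restricting arbitrary coefficients to
  \<open>J\<close> translates between this and independence plus spanning.\<close>

lemma is_basis_iff:
  "is_basis V J b \<longleftrightarrow> indep J b \<and> (\<forall>v\<in>carrier V. \<exists>c. v = lincomb V J c b)"
proof
  assume B: "is_basis V J b"
  then have f: "finite J" "b \<in> J \<rightarrow> carrier V" by (auto simp: is_basis_def)
  have u: "\<And>v. v \<in> carrier V \<Longrightarrow> \<exists>!c. c \<in> J \<rightarrow>\<^sub>E UNIV \<and> v = lincomb V J c b"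
    using B by (auto simp: is_basis_def)
  have "c \<alpha> = 0" if "lincomb V J c b = \<zero>" "\<alpha> \<in> J" for c \<alpha>
  proof -
    have "lincomb V J (restrict c J) b = lincomb V J c b" using f by (intro lincomb_cong) auto
    moreover have "lincomb V J (restrict (\<lambda>_. 0) J) b = \<zero>" using f by (intro lincomb_zero_coeff) auto
    moreover have "restrict c J \<in> J \<rightarrow>\<^sub>E UNIV" "restrict (\<lambda>_. 0) J \<in> J \<rightarrow>\<^sub>E (UNIV :: complex set)" by auto
    ultimately have "restrict c J = restrict (\<lambda>_. 0) J" using u[of "\<zero>"] that(1) M.zero_closed by metis
    then show ?thesis using that(2) by (metis restrict_apply')
  qed
  then show "indep J b \<and> (\<forall>v\<in>carrier V. \<exists>c. v = lincomb V J c b)"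
    using f u unfolding indep_def by blast
next
  assume R: "indep J b \<and> (\<forall>v\<in>carrier V. \<exists>c. v = lincomb V J c b)"
  then have f: "finite J" "b \<in> J \<rightarrow> carrier V" by (auto simp: indep_def)
  have "\<exists>!c. c \<in> J \<rightarrow>\<^sub>E UNIV \<and> v = lincomb V J c b" if v: "v \<in> carrier V" for v
  proof -
    obtain c where c: "v = lincomb V J c b" using R v by blast
    have "lincomb V J (restrict c J) b = lincomb V J c b" using f by (intro lincomb_cong) auto
    then have 1: "restrict c J \<in> J \<rightarrow>\<^sub>E UNIV \<and> v = lincomb V J (restrict c J) b" using c by auto
    have 2: "d = e" if "d \<in> J \<rightarrow>\<^sub>E UNIV \<and> v = lincomb V J d b" "e \<in> J \<rightarrow>\<^sub>E UNIV \<and> v = lincomb V J e b" for d e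
    proof (rule PiE_ext[where k = J and s = "\<lambda>_. UNIV"])
      show "d \<alpha> = e \<alpha>" if "\<alpha> \<in> J" for \<alpha>
        using indep_unique[of J b d e \<alpha>] R \<open>d \<in> _ \<and> _\<close> \<open>e \<in> _ \<and> _\<close> that by simp
    qed (use that in auto)
    show ?thesis using 1 2 by blast
  qed
  then show "is_basis V J b" using f unfolding is_basis_def by blast
qed

text \<open>The coefficient of \<open>b a\<close> in \<open>v\<close> is 1, so this is an elementary
  unipotent change: coefficients transform by adding \<open>c a * d \<alpha>\<close>, and
  subtracting the same term inverts it.\<close>

lemma is_basis_replace:
  assumes B: "is_basis V J b" and a: "a \<in> J" and v: "v = b a \<oplus> lincomb V (J - {a}) d b"
  shows "is_basis V J (b(a := v))"
proof -
  have I: "indep J b" and sp: "\<And>v. v \<in> carrier V \<Longrightarrow> \<exists>c. v = lincomb V J c b"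
    using B by (auto simp: is_basis_iff)
  have f: "finite J" "b \<in> J \<rightarrow> carrier V" using I by (auto simp: indep_def)
  have vc: "v \<in> carrier V" unfolding v using f a by (intro M.add.m_closed lincomb_closed) auto
  have f': "b(a := v) \<in> J \<rightarrow> carrier V" using f vc by auto
  have J: "J = insert a (J - {a})" using a by auto
  have key: "lincomb V J c (b(a := v)) = lincomb V J (\<lambda>\<alpha>. if \<alpha> = a then c a else c \<alpha> + c a * d \<alpha>) b" for c
  proof -
    have "lincomb V J c (b(a := v)) = c a \<odot> v \<oplus> lincomb V (J - {a}) c (b(a := v))"
      using f f' by (subst J, subst lincomb_insert) (auto simp: Pi_iff vc)
    also have "lincomb V (J - {a}) c (b(a := v)) = lincomb V (J - {a}) c b"
      using f by (intro lincomb_cong) auto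
    also have "c a \<odot> v = c a \<odot> b a \<oplus> lincomb V (J - {a}) (\<lambda>\<alpha>. c a * d \<alpha>) b"
      unfolding v using f a by (subst smult_add_right) (auto simp: lincomb_smult Pi_iff)
    also have "\<dots> \<oplus> lincomb V (J - {a}) c b
       = c a \<odot> b a \<oplus> lincomb V (J - {a}) (\<lambda>\<alpha>. c a * d \<alpha> + c \<alpha>) b"
    proof -
      have m: "c a \<odot> b a \<in> carrier V" "b \<in> J - {a} \<rightarrow> carrier V" using f a by auto
      show ?thesis using m by (simp add: M.a_assoc lincomb_add)
    qed
    also have "lincomb V (J - {a}) (\<lambda>\<alpha>. c a * d \<alpha> + c \<alpha>) b
       = lincomb V (J - {a}) (\<lambda>\<alpha>. if \<alpha> = a then c a else c \<alpha> + c a * d \<alpha>) b"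
      using f by (intro lincomb_cong) auto
    also have "c a \<odot> b a \<oplus> \<dots> = lincomb V J (\<lambda>\<alpha>. if \<alpha> = a then c a else c \<alpha> + c a * d \<alpha>) b"
      using f a by (subst (2) J, subst lincomb_insert) (auto simp: Pi_iff)
    finally show ?thesis .
  qed
  have "c \<alpha> = 0" if "lincomb V J c (b(a := v)) = \<zero>" "\<alpha> \<in> J" for c \<alpha>
  proof -
    have z: "(if \<alpha> = a then c a else c \<alpha> + c a * d \<alpha>) = 0" if "\<alpha> \<in> J" for \<alpha>
      using I \<open>lincomb V J c (b(a := v)) = \<zero>\<close> that unfolding key indep_def by blast
    have "c a = 0" using z[OF a] by simp
    then show ?thesis using z[OF that(2)] by (simp split: if_splits)
  qed
  moreover have "\<exists>c. w = lincomb V J c (b(a := v))" if w: "w \<in> carrier V" for w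
  proof -
    obtain c where c: "w = lincomb V J c b" using sp[OF w] by blast
    have "w = lincomb V J (\<lambda>\<alpha>. if \<alpha> = a then c a else c \<alpha> - c a * d \<alpha>) (b(a := v))"
      unfolding key c using f by (intro lincomb_cong) auto
    then show ?thesis by blast
  qed
  ultimately show ?thesis using f f' unfolding is_basis_iff indep_def by blast
qed

lemma lspan_closed: "b \<in> J \<rightarrow> carrier V \<Longrightarrow> lspan V J b \<subseteq> carrier V"
  by (auto simp: lspan_def)

lemma lspan_mono:
  assumes "finite K" "J \<subseteq> K" "b \<in> K \<rightarrow> carrier V"
  shows "lspan V J b \<subseteq> lspan V K b"
proof
  fix v assume "v \<in> lspan V J b"
  then obtain c where c: "v = lincomb V J c b" by (auto simp: lspan_def)
  have "lincomb V K (\<lambda>\<alpha>. if \<alpha> \<in> J then c \<alpha> else 0) b = lincomb V J (\<lambda>\<alpha>. if \<alpha> \<in> J then c \<alpha> else 0) b"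
    using assms by (intro lincomb_mono) auto
  also have "\<dots> = v" unfolding c using assms by (intro lincomb_cong) auto
  finally show "v \<in> lspan V K b" unfolding lspan_def by blast
qed

lemma lspan_base:
  assumes "finite J" "b \<in> J \<rightarrow> carrier V" "a \<in> J"
  shows "b a \<in> lspan V J b"
proof -
  have "b a \<in> carrier V" using assms by auto
  then have "b a = lincomb V J (\<lambda>\<alpha>. if \<alpha> = a then 1 else 0) b"
    using lincomb_single[OF assms(1,3,2), of 1] by simp
  then show ?thesis unfolding lspan_def by blast
qed

lemma submodule_lspan:
  assumes "finite J" "b \<in> J \<rightarrow> carrier V"
  shows "submodule (lspan V J b) complex_ring V"
proof (rule submoduleI)
  show "lspan V J b \<subseteq> carrier V" using assms by (rule_tac lspan_closed)
  show "\<zero> \<in> lspan V J b"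
    using lincomb_zero_coeff[OF assms, of "\<lambda>_. 0"] unfolding lspan_def by (metis rangeI)
  show "\<ominus> a \<in> lspan V J b" if "a \<in> lspan V J b" for a
    using that lincomb_minus[OF assms] unfolding lspan_def by auto
  show "a \<oplus> b' \<in> lspan V J b" if "a \<in> lspan V J b" "b' \<in> lspan V J b" for a b'
    using that lincomb_add[OF assms(2)] unfolding lspan_def by auto
  show "a \<odot> x \<in> lspan V J b" if "a \<in> carrier complex_ring" "x \<in> lspan V J b" for a x
    using that lincomb_smult[OF assms] unfolding lspan_def by auto
qed

lemma complex_module_submodule:
  assumes "submodule S complex_ring V"
  shows "complex_module (V\<lparr>carrier := S\<rparr>)"
  using submodule.submodule_is_module[OF assms module_axioms] by (rule complex_module.intro)

text \<open>A finite sum in a module refers to its carrier, so sums in the submodule and in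
  \<open>V\<close> have to be compared term by term; this uses that \<open>b\<close> takes values in
  \<open>S\<close>.\<close>

lemma lincomb_submodule:
  assumes "submodule S complex_ring V" "finite J" "b \<in> J \<rightarrow> S"
  shows "lincomb (V\<lparr>carrier := S\<rparr>) J c b = lincomb V J c b"
proof -
  interpret S: complex_module "V\<lparr>carrier := S\<rparr>" by (rule complex_module_submodule[OF assms(1)])
  have sub: "S \<subseteq> carrier V" using submoduleE(1)[OF assms(1)] .
  show ?thesis
    using assms(2,3)
  proof (induction J rule: finite_induct)
    case empty
    then show ?case using S.lincomb_empty by simp
  next
    case (insert x J)
    have "b \<in> insert x J \<rightarrow> carrier V" using insert.prems sub by auto
    then show ?case using insert S.lincomb_insert[of J x b c] lincomb_insert[of J x b c] by auto
  qed
qed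

lemma is_basis_submodule:
  assumes "submodule S complex_ring V" "indep J b" "S = lspan V J b"
  shows "is_basis (V\<lparr>carrier := S\<rparr>) J b"
proof -
  interpret S: complex_module "V\<lparr>carrier := S\<rparr>" by (rule complex_module_submodule[OF assms(1)])
  have f: "finite J" "b \<in> J \<rightarrow> carrier V" using assms(2) by (auto simp: indep_def)
  have bS: "b \<in> J \<rightarrow> S" using lspan_base[OF f] assms(3) by auto
  note lc = lincomb_submodule[OF assms(1) f(1) bS]
  have "S.indep J b" using assms(2) f bS unfolding S.indep_def indep_def lc by simp
  moreover have "\<exists>c. v = lincomb (V\<lparr>carrier := S\<rparr>) J c b" if "v \<in> S" for v
  proof -
    obtain c where "v = lincomb V J c b" using \<open>v \<in> S\<close> assms(3) unfolding lspan_def by blast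
    then show ?thesis using lc by auto
  qed
  ultimately show ?thesis unfolding S.is_basis_iff by simp
qed

text \<open>\<open>has_dim\<close> asks for a basis indexed by \<open>{1..k}\<close>, while the
  flags are spanned by vectors indexed by \<open>{r - \<rho> i<..r}\<close>.\<close>

lemma indep_reindex:
  assumes "indep J b" "bij_betw g J' J"
  shows "indep J' (b \<circ> g)" "lspan V J' (b \<circ> g) = lspan V J b"
proof -
  have f: "finite J" "b \<in> J \<rightarrow> carrier V" using assms(1) by (auto simp: indep_def)
  have f': "finite J'" using assms(2) f(1) bij_betw_finite by blast
  have inj: "inj_on g J'" and im: "g ` J' = J" using assms(2) by (auto simp: bij_betw_def)
  have lc: "lincomb V J c b = lincomb V J' (c \<circ> g) (b \<circ> g)" for c
    unfolding lincomb_def using f(2) im inj M.finsum_reindex[of "\<lambda>\<alpha>. c \<alpha> \<odot> b \<alpha>" g J'] by (auto simp: Pi_iff)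
  have bg: "b \<circ> g \<in> J' \<rightarrow> carrier V" using f(2) im by auto
  have lc': "lincomb V J' c (b \<circ> g) = lincomb V J (c \<circ> inv_into J' g) b" for c
    unfolding lc using bg inj by (intro lincomb_cong) auto
  show "indep J' (b \<circ> g)"
    unfolding indep_def
  proof (intro conjI allI impI ballI f' bg)
    fix c \<alpha> assume "lincomb V J' c (b \<circ> g) = \<zero>" "\<alpha> \<in> J'"
    then have "(c \<circ> inv_into J' g) (g \<alpha>) = 0" using assms(1) im unfolding lc' indep_def by blast
    then show "c \<alpha> = 0" using inj \<open>\<alpha> \<in> J'\<close> by simp
  qed
  show "lspan V J' (b \<circ> g) = lspan V J b"
    unfolding lspan_def using lc lc' by (auto simp: image_iff)
qed

lemma has_dim_lspan:
  assumes "indep J b"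
  shows "has_dim (V\<lparr>carrier := lspan V J b\<rparr>) (card J)"
proof -
  have f: "finite J" "b \<in> J \<rightarrow> carrier V" using assms by (auto simp: indep_def)
  obtain g where g: "bij_betw g {1..card J} J" using finite_same_card_bij[OF _ f(1), of "{1..card J}"] by auto
  show ?thesis
    unfolding has_dim_def
    using is_basis_submodule[OF submodule_lspan[OF f] indep_reindex(1)[OF assms g]]
      indep_reindex(2)[OF assms g] by auto
qed

end


section \<open>Quotients and quotient metrics\<close>

lemma quot_module_simps [simp]:
  "carrier (quot_module V W) = a_rcosets\<^bsub>V\<^esub> W" "zero (quot_module V W) = W" "add (quot_module V W) = set_add V"
  "smult (quot_module V W) c S = (\<Union>u\<in>S. W +>\<^bsub>V\<^esub> (c \<odot>\<^bsub>V\<^esub> u))"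
  by (simp_all add: quot_module_def)

text \<open>Cosets ignore the carrier, so a class formed inside a step of the flag is the same set
  as the class formed in the whole fibre.\<close>

lemma a_r_coset_carrier_update [simp]: "W +>\<^bsub>V\<lparr>carrier := S\<rparr>\<^esub> x = W +>\<^bsub>V\<^esub> x"
  by (simp add: a_r_coset_def')

context complex_module
begin

lemma abelian_subgroup_submodule: "submodule W complex_ring V \<Longrightarrow> abelian_subgroup W V"
  by (intro abelian_subgroupI3 additive_subgroup.intro M.abelian_group_axioms submodule.axioms(1))

lemma mem_coset_iff:
  assumes "submodule W complex_ring V" "x \<in> carrier V"
  shows "u \<in> W +> x \<longleftrightarrow> (\<exists>w\<in>W. u = w \<oplus> x)"
  by (auto simp: a_r_coset_def')

lemma coset_eqI:
  assumes W: "submodule W complex_ring V" and x: "x \<in> carrier V" and y: "y \<in> carrier V"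
    and w: "w \<in> W" "x = w \<oplus> y"
  shows "W +> x = W +> y"
proof -
  interpret W: abelian_subgroup W V by (rule abelian_subgroup_submodule[OF W])
  have "x \<in> W +> y" using mem_coset_iff[OF W y] w by blast
  then show ?thesis
    using a_repr_independence[OF _ y] submodule.axioms(1)[OF W] by simp
qed

lemma coset_eqD:
  assumes W: "submodule W complex_ring V" and x: "x \<in> carrier V" and y: "y \<in> carrier V"
    and e: "W +> x = W +> y"
  obtains w where "w \<in> W" "x = w \<oplus> y"
proof -
  interpret W: abelian_subgroup W V by (rule abelian_subgroup_submodule[OF W])
  have "x \<in> W +> x" by (rule W.a_rcos_self[OF x])
  then show ?thesis using that mem_coset_iff[OF W y] e by blast
qed

lemma quot_add:
  assumes "submodule W complex_ring V" "x \<in> carrier V" "y \<in> carrier V"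
  shows "(W +> x) \<oplus>\<^bsub>quot_module V W\<^esub> (W +> y) = W +> (x \<oplus> y)"
proof -
  interpret W: abelian_subgroup W V by (rule abelian_subgroup_submodule[OF assms(1)])
  show ?thesis using W.a_rcos_sum[OF assms(2,3)] by simp
qed

text \<open>Scalar multiplication is a union over all representatives. The classes in this union
  coincide and the union is over a nonempty set, so it collapses to one class.\<close>

lemma quot_smult:
  assumes W: "submodule W complex_ring V" and x: "x \<in> carrier V"
  shows "c \<odot>\<^bsub>quot_module V W\<^esub> (W +> x) = W +> (c \<odot> x)"
proof -
  interpret W: abelian_subgroup W V by (rule abelian_subgroup_submodule[OF W])
  have sub: "W \<subseteq> carrier V" using submoduleE(1)[OF W] .
  have "W +> (c \<odot> u) = W +> (c \<odot> x)" if u: "u \<in> W +> x" for u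
  proof -
    obtain w where w: "w \<in> W" "u = w \<oplus> x" using u mem_coset_iff[OF W x] by blast
    have "c \<odot> w \<in> W" using submoduleE(4)[OF W, of c w] w by simp
    then show ?thesis using w sub x by (intro coset_eqI[OF W]) (auto simp: smult_add_right)
  qed
  then have "(\<Union>u\<in>W +> x. W +> (c \<odot> u)) = (\<Union>u\<in>W +> x. W +> (c \<odot> x))"
    by (intro SUP_cong refl)
  moreover have "W +> x \<noteq> {}" using W.a_rcos_self[OF x] by (metis empty_iff)
  ultimately show ?thesis by (simp only: quot_module_simps UN_constant if_False)
qed

lemma quot_carrierE:
  assumes "S \<in> carrier (quot_module V W)"
  obtains x where "x \<in> carrier V" "S = W +> x"
  using assms by (auto simp: A_RCOSETS_def')

lemma quot_carrierI: "x \<in> carrier V \<Longrightarrow> W +> x \<in> carrier (quot_module V W)"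
  by (auto simp: A_RCOSETS_def')

lemma quot_zero: "submodule W complex_ring V \<Longrightarrow> \<zero>\<^bsub>quot_module V W\<^esub> = W +> \<zero>"
  using submoduleE(1) by simp

lemma complex_module_quot:
  assumes W: "submodule W complex_ring V"
  shows "complex_module (quot_module V W)"
proof -
  note q = quot_add[OF W] quot_smult[OF W] quot_zero[OF W]
  have "abelian_group (quot_module V W)"
  proof (rule abelian_groupI)
    fix S T R assume S: "S \<in> carrier (quot_module V W)" and T: "T \<in> carrier (quot_module V W)"
      and R: "R \<in> carrier (quot_module V W)"
    obtain x where x: "x \<in> carrier V" "S = W +> x" using S by (rule quot_carrierE)
    obtain y where y: "y \<in> carrier V" "T = W +> y" using T by (rule quot_carrierE)
    obtain z where z: "z \<in> carrier V" "R = W +> z" using R by (rule quot_carrierE)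
    show "S \<oplus>\<^bsub>quot_module V W\<^esub> T \<oplus>\<^bsub>quot_module V W\<^esub> R = S \<oplus>\<^bsub>quot_module V W\<^esub> (T \<oplus>\<^bsub>quot_module V W\<^esub> R)"
      using x(1) y(1) z(1) unfolding x(2) y(2) z(2) by (simp only: q M.add.m_closed M.a_assoc)
  next
    fix S T assume S: "S \<in> carrier (quot_module V W)" and T: "T \<in> carrier (quot_module V W)"
    obtain x where x: "x \<in> carrier V" "S = W +> x" using S by (rule quot_carrierE)
    obtain y where y: "y \<in> carrier V" "T = W +> y" using T by (rule quot_carrierE)
    show "S \<oplus>\<^bsub>quot_module V W\<^esub> T = T \<oplus>\<^bsub>quot_module V W\<^esub> S"
      unfolding x(2) y(2) using q(1)[OF x(1) y(1)] q(1)[OF y(1) x(1)] M.a_comm[OF x(1) y(1)] by simp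
    show "S \<oplus>\<^bsub>quot_module V W\<^esub> T \<in> carrier (quot_module V W)"
      unfolding x(2) y(2) q(1)[OF x(1) y(1)] using x y by (intro quot_carrierI) simp
  next
    show "\<zero>\<^bsub>quot_module V W\<^esub> \<in> carrier (quot_module V W)"
      unfolding q(3) by (rule quot_carrierI) simp
  next
    fix S assume S: "S \<in> carrier (quot_module V W)"
    obtain x where x: "x \<in> carrier V" "S = W +> x" using S by (rule quot_carrierE)
    show "\<zero>\<^bsub>quot_module V W\<^esub> \<oplus>\<^bsub>quot_module V W\<^esub> S = S"
      unfolding x(2) q(3) using q(1)[OF M.zero_closed x(1)] x(1) by simp
    show "\<exists>T\<in>carrier (quot_module V W). T \<oplus>\<^bsub>quot_module V W\<^esub> S = \<zero>\<^bsub>quot_module V W\<^esub>"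
    proof (rule bexI)
      show "W +> (\<ominus> x) \<in> carrier (quot_module V W)" using x by (intro quot_carrierI) simp
      show "(W +> (\<ominus> x)) \<oplus>\<^bsub>quot_module V W\<^esub> S = \<zero>\<^bsub>quot_module V W\<^esub>"
        unfolding x(2) q(3) using q(1)[of "\<ominus> x" x] x(1) by (simp add: M.l_neg)
    qed
  qed
  then have "module complex_ring (quot_module V W)"
  proof (rule moduleI[OF R.is_cring])
    fix c d S T assume S: "S \<in> carrier (quot_module V W)" and T: "T \<in> carrier (quot_module V W)"
    obtain x where x: "x \<in> carrier V" "S = W +> x" using S by (rule quot_carrierE)
    obtain y where y: "y \<in> carrier V" "T = W +> y" using T by (rule quot_carrierE)
    show "c \<odot>\<^bsub>quot_module V W\<^esub> (S \<oplus>\<^bsub>quot_module V W\<^esub> T)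
        = c \<odot>\<^bsub>quot_module V W\<^esub> S \<oplus>\<^bsub>quot_module V W\<^esub> c \<odot>\<^bsub>quot_module V W\<^esub> T"
      unfolding x(2) y(2) using x(1) y(1) by (simp only: q M.add.m_closed smult_mem smult_add_right)
  next
    fix c d S assume S: "S \<in> carrier (quot_module V W)"
    obtain x where x: "x \<in> carrier V" "S = W +> x" using S by (rule quot_carrierE)
    show "c \<odot>\<^bsub>quot_module V W\<^esub> S \<in> carrier (quot_module V W)"
      unfolding x(2) q(2)[OF x(1)] using x by (intro quot_carrierI) simp
    show "(c \<oplus>\<^bsub>complex_ring\<^esub> d) \<odot>\<^bsub>quot_module V W\<^esub> S
        = c \<odot>\<^bsub>quot_module V W\<^esub> S \<oplus>\<^bsub>quot_module V W\<^esub> d \<odot>\<^bsub>quot_module V W\<^esub> S"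
      unfolding x(2) complex_ring_simps using x(1) by (simp only: q smult_mem smult_add_left)
    show "(c \<otimes>\<^bsub>complex_ring\<^esub> d) \<odot>\<^bsub>quot_module V W\<^esub> S = c \<odot>\<^bsub>quot_module V W\<^esub> (d \<odot>\<^bsub>quot_module V W\<^esub> S)"
      unfolding x(2) complex_ring_simps using x(1) by (simp only: q smult_mem smult_smult)
    show "\<one>\<^bsub>complex_ring\<^esub> \<odot>\<^bsub>quot_module V W\<^esub> S = S"
      unfolding x(2) complex_ring_simps using x(1) by (simp only: q smult_1)
  qed
  then show ?thesis by (rule complex_module.intro)
qed

lemma lincomb_quot:
  assumes W: "submodule W complex_ring V" and "finite J" "t \<in> J \<rightarrow> carrier V"
  shows "lincomb (quot_module V W) J c (\<lambda>\<alpha>. W +> t \<alpha>) = W +> lincomb V J c t"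
proof -
  interpret Q: complex_module "quot_module V W" by (rule complex_module_quot[OF W])
  show ?thesis
    using assms(2,3)
  proof (induction J rule: finite_induct)
    case empty
    then show ?case using quot_zero[OF W] Q.lincomb_empty lincomb_empty by metis
  next
    case (insert x J)
    have tQ: "(\<lambda>\<alpha>. W +> t \<alpha>) \<in> insert x J \<rightarrow> carrier (quot_module V W)"
      using insert.prems by (auto intro: quot_carrierI simp del: quot_module_simps)
    have m: "t x \<in> carrier V" "lincomb V J c t \<in> carrier V" using insert.prems by auto
    have "lincomb (quot_module V W) (insert x J) c (\<lambda>\<alpha>. W +> t \<alpha>)
       = c x \<odot>\<^bsub>quot_module V W\<^esub> (W +> t x) \<oplus>\<^bsub>quot_module V W\<^esub> (W +> lincomb V J c t)"
      using Q.lincomb_insert[OF insert.hyps tQ, of c] insert.IH insert.prems by (simp del: quot_module_simps)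
    also have "\<dots> = W +> (c x \<odot> t x \<oplus> lincomb V J c t)"
      unfolding quot_smult[OF W m(1)] using m by (intro quot_add[OF W]) auto
    also have "\<dots> = W +> lincomb V (insert x J) c t"
      using lincomb_insert[OF insert.hyps insert.prems, of c] by simp
    finally show ?case .
  qed
qed

text \<open>A relation between the classes says that a combination over \<open>J\<close> lies in the
  span over \<open>K\<close>; joining both coefficient families yields a relation over
  \<open>J \<union> K\<close>. For spanning, the \<open>K\<close>-part of any vector is absorbed by
  the class.\<close>

lemma is_basis_quot:
  assumes I: "indep (J \<union> K) t" and JK: "J \<inter> K = {}" and W: "W = lspan V K t"
    and all: "carrier V = lspan V (J \<union> K) t"
  shows "is_basis (quot_module V W) J (\<lambda>\<alpha>. W +> t \<alpha>)"
proof -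
  have f: "finite J" "finite K" "t \<in> J \<union> K \<rightarrow> carrier V" "t \<in> J \<rightarrow> carrier V" "t \<in> K \<rightarrow> carrier V"
    using I by (auto simp: indep_def)
  have sW: "submodule W complex_ring V" unfolding W by (rule submodule_lspan[OF f(2,5)])
  interpret Q: complex_module "quot_module V W" by (rule complex_module_quot[OF sW])
  interpret W: abelian_subgroup W V by (rule abelian_subgroup_submodule[OF sW])
  note lq = lincomb_quot[OF sW f(1,4)]
  have "Q.indep J (\<lambda>\<alpha>. W +> t \<alpha>)"
    unfolding Q.indep_def
  proof (intro conjI allI impI ballI f(1))
    show "(\<lambda>\<alpha>. W +> t \<alpha>) \<in> J \<rightarrow> carrier (quot_module V W)"
      using f(4) by (auto intro: quot_carrierI simp del: quot_module_simps)
    fix c \<alpha> assume z: "lincomb (quot_module V W) J c (\<lambda>\<alpha>. W +> t \<alpha>) = \<zero>\<^bsub>quot_module V W\<^esub>" and \<alpha>: "\<alpha> \<in> J"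
    have "W +> lincomb V J c t = W +> \<zero>" using z unfolding lq quot_zero[OF sW] .
    then obtain w where w: "w \<in> W" "lincomb V J c t = w \<oplus> \<zero>"
      using coset_eqD[OF sW lincomb_closed[OF f(4)] M.zero_closed] by metis
    then have "lincomb V J c t \<in> W" using W.a_subset by auto
    then obtain d where d: "lincomb V J c t = lincomb V K d t" unfolding W lspan_def by blast
    define c' where "c' = (\<lambda>\<alpha>. if \<alpha> \<in> J then c \<alpha> else - d \<alpha>)"
    have "lincomb V (J \<union> K) c' t = lincomb V J c' t \<oplus> lincomb V K c' t"
      using f JK by (intro lincomb_union) auto
    also have "lincomb V J c' t = lincomb V J c t" using f by (intro lincomb_cong) (auto simp: c'_def)
    also have "lincomb V K c' t = lincomb V K (\<lambda>\<alpha>. - d \<alpha>) t"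
      using f JK by (intro lincomb_cong) (auto simp: c'_def)
    also have "lincomb V J c t \<oplus> lincomb V K (\<lambda>\<alpha>. - d \<alpha>) t = \<zero>"
      unfolding d lincomb_add[OF f(5)] using f by (intro lincomb_zero_coeff) auto
    finally have "c' \<alpha> = 0" using I \<alpha> unfolding indep_def by blast
    then show "c \<alpha> = 0" using \<alpha> by (simp add: c'_def)
  qed
  moreover have "\<exists>c. S = lincomb (quot_module V W) J c (\<lambda>\<alpha>. W +> t \<alpha>)"
    if S: "S \<in> carrier (quot_module V W)" for S
  proof -
    obtain x where x: "x \<in> carrier V" "S = W +> x" using S by (rule quot_carrierE)
    obtain c where c: "x = lincomb V (J \<union> K) c t" using x(1) all unfolding lspan_def by blast
    have "x = lincomb V K c t \<oplus> lincomb V J c t"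
      unfolding c using lincomb_union[OF f(1,2) JK f(3)] f by (simp add: M.a_comm)
    then have "W +> x = W +> lincomb V J c t"
      using x(1) f W by (intro coset_eqI[OF sW]) (auto simp: lspan_def)
    then show ?thesis unfolding x(2) lq by blast
  qed
  ultimately show ?thesis unfolding Q.is_basis_iff by blast
qed

end

section \<open>Hermitian spaces and orthogonal representatives\<close>

locale hermitian_module = complex_module V for V :: "(complex, 'v) module" (structure) +
  fixes h :: "'v \<Rightarrow> 'v \<Rightarrow> complex"
  assumes hermitian: "hermitian_inner V h"
begin

lemma herm_add_left: "u \<in> carrier V \<Longrightarrow> v \<in> carrier V \<Longrightarrow> w \<in> carrier V \<Longrightarrow> h (u \<oplus> v) w = h u w + h v w"
  and herm_smult_left: "u \<in> carrier V \<Longrightarrow> v \<in> carrier V \<Longrightarrow> h (c \<odot> u) v = c * h u v"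
  and herm_cnj: "u \<in> carrier V \<Longrightarrow> v \<in> carrier V \<Longrightarrow> h v u = cnj (h u v)"
  and herm_pos: "u \<in> carrier V \<Longrightarrow> u \<noteq> \<zero> \<Longrightarrow> Re (h u u) > 0"
  using hermitian unfolding hermitian_inner_def by blast+

lemma herm_zero_left: "v \<in> carrier V \<Longrightarrow> h \<zero> v = 0"
  using herm_smult_left[of "\<zero>" v 0] by simp

lemma herm_lincomb_left:
  "finite J \<Longrightarrow> b \<in> J \<rightarrow> carrier V \<Longrightarrow> w \<in> carrier V \<Longrightarrow> h (lincomb V J c b) w = (\<Sum>\<alpha>\<in>J. c \<alpha> * h (b \<alpha>) w)"
proof (induction J rule: finite_induct)
  case (insert x J)
  have "b x \<in> carrier V" "b \<in> J \<rightarrow> carrier V" using insert.prems by auto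
  then show ?case
    using insert by (simp add: lincomb_insert herm_add_left herm_smult_left)
qed (simp add: herm_zero_left)

lemma herm_lincomb_right:
  assumes "finite J" "b \<in> J \<rightarrow> carrier V" "w \<in> carrier V"
  shows "h w (lincomb V J c b) = (\<Sum>\<alpha>\<in>J. cnj (c \<alpha>) * h w (b \<alpha>))"
proof -
  have "h w (lincomb V J c b) = cnj (\<Sum>\<alpha>\<in>J. c \<alpha> * h (b \<alpha>) w)"
    using assms by (subst herm_cnj[of "lincomb V J c b" w]) (auto simp: herm_lincomb_left)
  also have "\<dots> = (\<Sum>\<alpha>\<in>J. cnj (c \<alpha>) * h w (b \<alpha>))"
    unfolding cnj_sum complex_cnj_mult
  proof (intro sum.cong refl)
    fix \<alpha> assume "\<alpha> \<in> J"
    then have "cnj (h (b \<alpha>) w) = h w (b \<alpha>)" using assms by (intro herm_cnj[symmetric]) auto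
    then show "cnj (c \<alpha>) * cnj (h (b \<alpha>) w) = cnj (c \<alpha>) * h w (b \<alpha>)" by simp
  qed
  finally show ?thesis .
qed

text \<open>The form at \<open>x\<close> is the square length of the combination with coefficients
  \<open>x\<close>, a nonzero vector by independence.\<close>

lemma gram_anisotropic:
  assumes "indep J b"
  shows "anisotropic J (\<lambda>\<alpha> \<beta>. h (b \<alpha>) (b \<beta>))"
  unfolding anisotropic_def
proof (intro allI impI)
  fix x :: "nat \<Rightarrow> complex" assume "\<exists>\<alpha>\<in>J. x \<alpha> \<noteq> 0"
  then have nz: "lincomb V J x b \<noteq> \<zero>" using assms unfolding indep_def by blast
  have f: "finite J" "b \<in> J \<rightarrow> carrier V" using assms by (auto simp: indep_def)
  have "h (lincomb V J x b) (lincomb V J x b) = (\<Sum>\<alpha>\<in>J. x \<alpha> * (\<Sum>\<beta>\<in>J. cnj (x \<beta>) * h (b \<alpha>) (b \<beta>)))"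
    using f by (subst herm_lincomb_left) (auto intro!: sum.cong simp: herm_lincomb_right Pi_iff)
  also have "\<dots> = (\<Sum>\<alpha>\<in>J. \<Sum>\<beta>\<in>J. x \<alpha> * cnj (x \<beta>) * h (b \<alpha>) (b \<beta>))"
    by (simp add: sum_distrib_left mult.assoc)
  finally have "\<dots> = h (lincomb V J x b) (lincomb V J x b)" ..
  moreover have "Re (h (lincomb V J x b) (lincomb V J x b)) > 0" using nz f by (intro herm_pos) auto
  ultimately show "(\<Sum>\<alpha>\<in>J. \<Sum>\<beta>\<in>J. x \<alpha> * cnj (x \<beta>) * h (b \<alpha>) (b \<beta>)) \<noteq> 0" by auto
qed

text \<open>\<open>c\<close> solves the normal equations for the projection of \<open>x\<close> to
  \<open>W\<close>, so subtracting that combination makes \<open>x\<close> orthogonal to all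
  \<open>t \<nu>\<close>. Uniqueness, required by the definite description, holds because two
  orthogonal representatives differ by an element of \<open>W\<close> that is orthogonal to
  itself.\<close>

lemma orth_rep_eq:
  assumes f: "finite K" "t \<in> K \<rightarrow> carrier V" and W: "W = lspan V K t" and x: "x \<in> carrier V"
    and c: "\<And>\<nu>. \<nu> \<in> K \<Longrightarrow> (\<Sum>\<mu>\<in>K. c \<mu> * h (t \<mu>) (t \<nu>)) = h x (t \<nu>)"
  shows "orth_rep h W (W +> x) = x \<oplus> lincomb V K (\<lambda>\<mu>. - c \<mu>) t"
    and "\<And>w. w \<in> W \<Longrightarrow> h (x \<oplus> lincomb V K (\<lambda>\<mu>. - c \<mu>) t) w = 0"
proof -
  let ?u = "x \<oplus> lincomb V K (\<lambda>\<mu>. - c \<mu>) t"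
  have sW: "submodule W complex_ring V" unfolding W by (rule submodule_lspan[OF f])
  have sub: "W \<subseteq> carrier V" using submoduleE(1)[OF sW] .
  have uc: "?u \<in> carrier V" using f x by auto
  have ut: "h ?u (t \<nu>) = 0" if "\<nu> \<in> K" for \<nu>
  proof -
    have "t \<nu> \<in> carrier V" using f that by auto
    then show ?thesis
      using f x c[OF that] by (simp add: herm_add_left herm_lincomb_left sum_negf)
  qed
  show perp: "h ?u w = 0" if w: "w \<in> W" for w
  proof -
    obtain d where "w = lincomb V K d t" using w unfolding W lspan_def by blast
    then show ?thesis using ut f uc by (simp add: herm_lincomb_right)
  qed
  have mem: "?u \<in> W +> x"
    unfolding mem_coset_iff[OF sW x] using f x
    by (intro bexI[of _ "lincomb V K (\<lambda>\<mu>. - c \<mu>) t"]) (auto simp: M.a_comm W lspan_def)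
  show "orth_rep h W (W +> x) = ?u"
    unfolding orth_rep_def
  proof (rule the_equality)
    show "?u \<in> W +> x \<and> (\<forall>w\<in>W. h ?u w = 0)" using mem perp by blast
    fix u assume u: "u \<in> W +> x \<and> (\<forall>w\<in>W. h u w = 0)"
    obtain w where w: "w \<in> W" "u = w \<oplus> x" using u mem_coset_iff[OF sW x] by blast
    obtain w' where w': "w' \<in> W" "?u = w' \<oplus> x" using mem mem_coset_iff[OF sW x] by blast
    have cw: "w \<in> carrier V" "w' \<in> carrier V" using w w' sub by auto
    have uc': "u \<in> carrier V" using w x cw by simp
    define d where "d = w \<oplus> (\<ominus> w')"
    have dW: "d \<in> W" unfolding d_def using submoduleE(3,5)[OF sW] w(1) w'(1) by blast
    have dc: "d \<in> carrier V" using dW sub by auto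
    have ud: "u = d \<oplus> ?u"
      unfolding w'(2) w(2) d_def using cw x by (simp add: M.a_assoc M.l_neg M.r_neg1 M.r_neg2)
    have "h u d = h d d + h ?u d" by (subst ud, rule herm_add_left[OF dc uc dc])
    then have "h d d = 0" using u dW perp[OF dW] by simp
    then have "d = \<zero>" using herm_pos[OF dc] by (metis less_irrefl zero_complex.simps(1))
    then show "u = ?u" using ud uc by simp
  qed
qed

end


section \<open>Flag coordinates\<close>

lemma dimension_sequenceD:
  assumes "dimension_sequence r m \<rho>"
  shows "\<rho> 0 = 0" "\<rho> m = r" "i \<le> j \<Longrightarrow> j \<le> m \<Longrightarrow> \<rho> i \<le> \<rho> j" "i < j \<Longrightarrow> j \<le> m \<Longrightarrow> \<rho> i < \<rho> j" "i \<le> m \<Longrightarrow> \<rho> i \<le> r"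
proof -
  have sm: "strict_mono_on {..m} \<rho>" and "\<rho> 0 = 0" "\<rho> m = r"
    using assms by (auto simp: dimension_sequence_def)
  then show "\<rho> 0 = 0" "\<rho> m = r" by auto
  show lt: "\<rho> i < \<rho> j" if "i < j" "j \<le> m" for i j
    using sm that by (auto simp: strict_mono_on_def)
  show le: "\<rho> i \<le> \<rho> j" if "i \<le> j" "j \<le> m" for i j
    using lt[of i j] that by (cases "i = j") auto
  show "\<rho> i \<le> r" if "i \<le> m" using le[OF that] \<open>\<rho> m = r\<close> by simp
qed

lemma admissible_bounds:
  "(\<nu>, \<mu>) \<in> admissible r m \<rho> \<Longrightarrow> 1 \<le> \<nu> \<and> \<nu> < \<mu> \<and> \<mu> \<le> r"
  by (auto simp: admissible_def)

text \<open>\<open>admissible\<close> counts steps from the top: the step \<open>l\<close>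
  corresponds to \<open>q = m - l\<close>, and only the proper steps occur.\<close>

lemma admissibleI:
  assumes "0 < l" "l < m" "1 \<le> \<nu>" "\<nu> \<le> r - \<rho> l" "r - \<rho> l < \<mu>" "\<mu> \<le> r"
  shows "(\<nu>, \<mu>) \<in> admissible r m \<rho>"
  using assms unfolding admissible_def by (auto intro!: bexI[of _ "m - l"])

lemma finite_admissible: "finite (admissible r m \<rho>)"
proof (rule finite_subset)
  show "admissible r m \<rho> \<subseteq> {1..r} \<times> {1..r}" using admissible_bounds by fastforce
qed simp

lemma finite_flag_index: "finite (flag_index n r m \<rho>)"
  by (simp add: flag_index_def finite_admissible)

text \<open>The coordinates extended by zero to all pairs, so that sums may run over
  \<open>{1..r}\<close>. The indices are in the order of \<zeta>; \<open>eps_coeff\<close> reverses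
  them, so that \<open>eps_coeff r m \<rho> \<zeta> \<alpha>\<close> is the coefficient family of
  one vector.\<close>

definition eps_off :: "nat \<Rightarrow> nat \<Rightarrow> (nat \<Rightarrow> nat) \<Rightarrow> (nat \<times> nat \<Rightarrow> complex) \<Rightarrow> nat \<Rightarrow> nat \<Rightarrow> complex" where
  "eps_off r m \<rho> \<zeta> \<gamma> \<alpha> = (if (\<gamma>, \<alpha>) \<in> admissible r m \<rho> then \<zeta> (\<gamma>, \<alpha>) else 0)"

definition eps_coeff :: "nat \<Rightarrow> nat \<Rightarrow> (nat \<Rightarrow> nat) \<Rightarrow> (nat \<times> nat \<Rightarrow> complex) \<Rightarrow> nat \<Rightarrow> nat \<Rightarrow> complex" where
  "eps_coeff r m \<rho> \<zeta> \<alpha> \<gamma> = (if \<gamma> = \<alpha> then 1 else 0) + eps_off r m \<rho> \<zeta> \<gamma> \<alpha>"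

context complex_module
begin

text \<open>The free choice of \<open>S\<close> allows the full index set as well as initial
  segments \<open>{1..s}\<close>, on which partly modified bases still coincide with
  \<open>b\<close>.\<close>

lemma eps_eq_lincomb_off:
  assumes b: "b \<in> {1..r} \<rightarrow> carrier V" and \<alpha>: "\<alpha> \<in> {1..r}" and S: "finite S" "S \<subseteq> {1..r}"
    "\<And>\<gamma>. (\<gamma>, \<alpha>) \<in> admissible r m \<rho> \<Longrightarrow> \<gamma> \<in> S"
  shows "eps V r m \<rho> b \<zeta> \<alpha> = b \<alpha> \<oplus> lincomb V S (\<lambda>\<gamma>. eps_off r m \<rho> \<zeta> \<gamma> \<alpha>) b"
proof -
  let ?S = "{\<nu>. \<nu> < \<alpha> \<and> (\<nu>, \<alpha>) \<in> admissible r m \<rho>}"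
  have "lincomb V S (\<lambda>\<gamma>. eps_off r m \<rho> \<zeta> \<gamma> \<alpha>) b = lincomb V ?S (\<lambda>\<gamma>. eps_off r m \<rho> \<zeta> \<gamma> \<alpha>) b"
    by (rule lincomb_mono) (use S b in \<open>auto simp: eps_off_def dest: admissible_bounds\<close>)
  also have "\<dots> = lincomb V ?S (\<lambda>\<nu>. \<zeta> (\<nu>, \<alpha>)) b"
    by (rule lincomb_cong) (use S b in \<open>auto simp: eps_off_def\<close>)
  finally show ?thesis by (simp add: eps_def)
qed

lemma eps_eq_lincomb:
  assumes b: "b \<in> {1..r} \<rightarrow> carrier V" and \<alpha>: "\<alpha> \<in> {1..r}"
  shows "eps V r m \<rho> b \<zeta> \<alpha> = lincomb V {1..r} (eps_coeff r m \<rho> \<zeta> \<alpha>) b"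
proof -
  have "b \<alpha> \<in> carrier V" using b \<alpha> by auto
  then have "b \<alpha> = lincomb V {1..r} (\<lambda>\<gamma>. if \<gamma> = \<alpha> then 1 else 0) b"
    using lincomb_single[OF _ \<alpha> b, of 1] by simp
  moreover have "eps V r m \<rho> b \<zeta> \<alpha> = b \<alpha> \<oplus> lincomb V {1..r} (\<lambda>\<gamma>. eps_off r m \<rho> \<zeta> \<gamma> \<alpha>) b"
    by (rule eps_eq_lincomb_off[OF b \<alpha>]) (auto dest: admissible_bounds)
  ultimately have "eps V r m \<rho> b \<zeta> \<alpha>
      = lincomb V {1..r} (\<lambda>\<gamma>. (if \<gamma> = \<alpha> then 1 else 0) + eps_off r m \<rho> \<zeta> \<gamma> \<alpha>) b"
    using lincomb_add[OF b] by metis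
  moreover have "eps_coeff r m \<rho> \<zeta> \<alpha> = (\<lambda>\<gamma>. (if \<gamma> = \<alpha> then 1 else 0) + eps_off r m \<rho> \<zeta> \<gamma> \<alpha>)"
    by (simp add: eps_coeff_def fun_eq_iff)
  ultimately show ?thesis by (simp only:)
qed

lemma eps_closed: "b \<in> {1..r} \<rightarrow> carrier V \<Longrightarrow> \<alpha> \<in> {1..r} \<Longrightarrow> eps V r m \<rho> b \<zeta> \<alpha> \<in> carrier V"
  by (simp add: eps_eq_lincomb)

text \<open>
  The change of basis is unipotent; replacing the basis vectors one at a time, from the last one
  downwards, avoids inverting it.
\<close>

lemma is_basis_eps_partial:
  assumes B: "is_basis V {1..r} b" and s: "s \<le> r"
  shows "is_basis V {1..r} (\<lambda>\<alpha>. if \<alpha> \<le> s then b \<alpha> else eps V r m \<rho> b \<zeta> \<alpha>)"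
  using s
proof (induction s rule: inc_induct)
  have b: "b \<in> {1..r} \<rightarrow> carrier V" using B by (simp add: is_basis_def)
  {
    case base
    have f: "b \<in> {1..r} \<rightarrow> carrier V" by (rule b)
    have "lincomb V {1..r} c (\<lambda>\<alpha>. if \<alpha> \<le> r then b \<alpha> else eps V r m \<rho> b \<zeta> \<alpha>) = lincomb V {1..r} c b" for c
      using b by (intro lincomb_cong) auto
    then show ?case using B b unfolding is_basis_iff indep_def by (auto simp: Pi_iff)
  next
    case (step s)
    let ?F = "\<lambda>s \<alpha>. if \<alpha> \<le> s then b \<alpha> else eps V r m \<rho> b \<zeta> \<alpha>"
    let ?a = "Suc s"
    have a: "?a \<in> {1..r}" using step by auto
    have F: "?F (Suc s) \<in> {1..r} \<rightarrow> carrier V"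
    proof (rule Pi_I)
      fix x assume x: "x \<in> {1..r}"
      show "?F (Suc s) x \<in> carrier V" using funcset_mem[OF b x] eps_closed[OF b x] by simp
    qed
    \<comment> \<open>The new vector involves only \<open>b \<gamma>\<close> with
      \<open>\<gamma> \<le> s\<close>, and these have not been replaced at stage
      \<open>Suc s\<close>.\<close>
    have "eps V r m \<rho> b \<zeta> ?a = b ?a \<oplus> lincomb V {1..s} (\<lambda>\<gamma>. eps_off r m \<rho> \<zeta> \<gamma> ?a) b"
      using step by (intro eps_eq_lincomb_off[OF b a]) (auto dest: admissible_bounds)
    also have "lincomb V {1..s} (\<lambda>\<gamma>. eps_off r m \<rho> \<zeta> \<gamma> ?a) b = lincomb V {1..s} (\<lambda>\<gamma>. eps_off r m \<rho> \<zeta> \<gamma> ?a) (?F (Suc s))"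
      using F step by (intro lincomb_cong) auto
    also have "\<dots> = lincomb V ({1..r} - {?a}) (\<lambda>\<gamma>. eps_off r m \<rho> \<zeta> \<gamma> ?a) (?F (Suc s))"
    proof (rule lincomb_mono[symmetric])
      show "eps_off r m \<rho> \<zeta> \<gamma> ?a = 0" if "\<gamma> \<in> {1..r} - {?a} - {1..s}" for \<gamma>
        using that by (auto simp: eps_off_def dest: admissible_bounds)
      show "?F (Suc s) \<in> {1..r} - {?a} \<rightarrow> carrier V" using F by auto
    qed (use step in auto)
    finally have "eps V r m \<rho> b \<zeta> ?a = ?F (Suc s) ?a
        \<oplus> lincomb V ({1..r} - {?a}) (\<lambda>\<gamma>. eps_off r m \<rho> \<zeta> \<gamma> ?a) (?F (Suc s))" by simp
    from is_basis_replace[OF step.IH a this]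
    have "is_basis V {1..r} ((?F (Suc s))(?a := eps V r m \<rho> b \<zeta> ?a))" .
    moreover have "(?F (Suc s))(?a := eps V r m \<rho> b \<zeta> ?a) = ?F s" by (auto simp: fun_eq_iff)
    ultimately show ?case by simp
  }
qed

lemma indep_eps:
  assumes "is_basis V {1..r} b" "J \<subseteq> {1..r}"
  shows "indep J (eps V r m \<rho> b \<zeta>)"
proof -
  have b: "b \<in> {1..r} \<rightarrow> carrier V" using assms by (simp add: is_basis_def)
  \<comment> \<open>Stage 0 of the replacement, at which every index of \<open>{1..r}\<close> has
    been treated.\<close>
  let ?F = "\<lambda>\<alpha>. if \<alpha> \<le> 0 then b \<alpha> else eps V r m \<rho> b \<zeta> \<alpha>"
  have F: "indep {1..r} ?F" using is_basis_eps_partial[OF assms(1), of 0 m \<rho> \<zeta>] by (auto simp: is_basis_iff)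
  have "lincomb V {1..r} c ?F = lincomb V {1..r} c (eps V r m \<rho> b \<zeta>)" for c
    using b by (intro lincomb_cong) (auto intro: eps_closed[OF b] simp del: One_nat_def)
  then have "indep {1..r} (eps V r m \<rho> b \<zeta>)"
    using F eps_closed[OF b] unfolding indep_def by (simp add: Pi_iff del: One_nat_def)
  then show ?thesis using assms(2) by (rule indep_subset)
qed

lemma lspan_eps_all:
  assumes "is_basis V {1..r} b"
  shows "lspan V {1..r} (eps V r m \<rho> b \<zeta>) = carrier V"
proof -
  have b: "b \<in> {1..r} \<rightarrow> carrier V" using assms by (simp add: is_basis_def)
  let ?F = "\<lambda>\<alpha>. if \<alpha> \<le> 0 then b \<alpha> else eps V r m \<rho> b \<zeta> \<alpha>"
  have F: "\<forall>v\<in>carrier V. \<exists>c. v = lincomb V {1..r} c ?F"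
    using is_basis_eps_partial[OF assms(1), of 0 m \<rho> \<zeta>] by (auto simp: is_basis_iff)
  have eq: "lincomb V {1..r} c ?F = lincomb V {1..r} c (eps V r m \<rho> b \<zeta>)" for c
    using b by (intro lincomb_cong) (auto intro: eps_closed[OF b] simp del: One_nat_def)
  have "eps V r m \<rho> b \<zeta> \<in> {1..r} \<rightarrow> carrier V" using b by (auto intro: eps_closed[OF b] simp del: One_nat_def)
  then show ?thesis using F lspan_closed unfolding eq lspan_def by fast
qed

text \<open>
  Both versions of \<open>\<epsilon>\<^sub>\<mu>\<close> lie in the first step of the flag that involves them, and they differ by a
  combination of the \<open>b\<^sub>\<gamma>\<close> with \<open>\<gamma> \<le> s\<close>, which span a complement of that step.
\<close>

lemma eps_coordinates_unique:
  assumes D: "dimension_sequence r m \<rho>" and B: "is_basis V {1..r} b"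
    and eq: "\<And>i. i \<le> m \<Longrightarrow> lspan V {r - \<rho> i<..r} (eps V r m \<rho> b \<zeta>) = lspan V {r - \<rho> i<..r} (eps V r m \<rho> b \<zeta>')"
    and adm: "(\<nu>, \<mu>) \<in> admissible r m \<rho>"
  shows "\<zeta> (\<nu>, \<mu>) = \<zeta>' (\<nu>, \<mu>)"
proof -
  have b: "b \<in> {1..r} \<rightarrow> carrier V" using B by (simp add: is_basis_def)
  note Dm = dimension_sequenceD[OF D]
  have \<mu>: "\<mu> \<in> {1..r}" using admissible_bounds[OF adm] by auto
  \<comment> \<open>The first step of the flag whose spanning vectors include the one with index
    \<open>\<mu>\<close>.\<close>
  define i where "i = (LEAST i. r - \<rho> i < \<mu>)"
  have ex: "r - \<rho> m < \<mu>" using \<mu> Dm(2) by simp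
  have i: "r - \<rho> i < \<mu>" unfolding i_def using ex by (rule LeastI)
  have im: "i \<le> m" unfolding i_def using ex by (rule Least_le)
  define s where "s = r - \<rho> i"
  \<comment> \<open>The step that witnesses admissibility also involves \<open>\<mu>\<close>, so it
    is not below \<open>i\<close>; monotonicity of \<open>\<rho>\<close> turns this into
    \<open>\<gamma> \<le> s\<close>.\<close>
  have small: "\<gamma> \<le> s" if "(\<gamma>, \<mu>) \<in> admissible r m \<rho>" for \<gamma>
  proof -
    obtain q where q: "\<gamma> \<le> r - \<rho> (m - q)" "r - \<rho> (m - q) < \<mu>" using \<open>(\<gamma>, \<mu>) \<in> _\<close> by (auto simp: admissible_def)
    have "i \<le> m - q" unfolding i_def using q(2) by (rule Least_le)
    then have "\<rho> i \<le> \<rho> (m - q)" using Dm(3) by simp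
    then show ?thesis using q(1) by (simp add: s_def)
  qed
  let ?e = "eps V r m \<rho> b \<zeta>" and ?e' = "eps V r m \<rho> b \<zeta>'"
  let ?F = "\<lambda>\<alpha>. if \<alpha> \<le> s then b \<alpha> else ?e' \<alpha>"
  have sr: "s \<le> r" "s < \<mu>" using i by (auto simp: s_def)
  have F: "indep {1..r} ?F" using is_basis_eps_partial[OF B sr(1), of m \<rho> \<zeta>'] by (auto simp: is_basis_iff)
  have Fc: "?F \<in> {1..r} \<rightarrow> carrier V" using F by (auto simp: indep_def)
  have ec: "?e \<in> {s<..r} \<rightarrow> carrier V" "?e' \<in> {s<..r} \<rightarrow> carrier V" using b by (auto intro: eps_closed[OF b] simp del: One_nat_def)
  have "?e \<mu> \<in> lspan V {s<..r} ?e" using ec \<mu> sr by (intro lspan_base) auto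
  then have "?e \<mu> \<in> lspan V {s<..r} ?e'" using eq[OF im] by (simp add: s_def)
  then obtain c where c: "?e \<mu> = lincomb V {s<..r} c ?e'" by (auto simp: lspan_def)
  have 1: "?e \<mu> = lincomb V {1..r} (\<lambda>\<gamma>. if \<gamma> \<le> s then 0 else c \<gamma>) ?F"
  proof -
    have "lincomb V {1..r} (\<lambda>\<gamma>. if \<gamma> \<le> s then 0 else c \<gamma>) ?F = lincomb V {s<..r} (\<lambda>\<gamma>. if \<gamma> \<le> s then 0 else c \<gamma>) ?F"
      using Fc by (intro lincomb_mono) auto
    also have "\<dots> = lincomb V {s<..r} c ?e'" using ec by (intro lincomb_cong) auto
    finally show ?thesis using c by simp
  qed
  have off: "eps V r m \<rho> b \<xi> \<mu> = b \<mu> \<oplus> lincomb V {1..s} (\<lambda>\<gamma>. eps_off r m \<rho> \<xi> \<gamma> \<mu>) b" for \<xi>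
    using small sr \<mu> by (intro eps_eq_lincomb_off[OF b]) (auto dest: admissible_bounds)
  have b\<mu>: "b \<mu> \<in> carrier V" using b \<mu> by auto
  have bs: "b \<in> {1..s} \<rightarrow> carrier V" using b sr by auto
  have "?e \<mu> = ?e' \<mu> \<oplus> lincomb V {1..s} (\<lambda>\<gamma>. eps_off r m \<rho> \<zeta> \<gamma> \<mu> - eps_off r m \<rho> \<zeta>' \<gamma> \<mu>) b"
    unfolding off using b\<mu> bs by (simp add: M.a_assoc lincomb_add)
  also have "?e' \<mu> = lincomb V {1..r} (\<lambda>\<gamma>. if \<gamma> = \<mu> then 1 else 0) ?F"
  proof -
    have "?e' \<mu> \<in> carrier V" using b \<mu> by (rule eps_closed)
    then show ?thesis using lincomb_single[OF _ \<mu> Fc, of 1] sr by simp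
  qed
  also have "lincomb V {1..s} (\<lambda>\<gamma>. eps_off r m \<rho> \<zeta> \<gamma> \<mu> - eps_off r m \<rho> \<zeta>' \<gamma> \<mu>) b
     = lincomb V {1..s} (\<lambda>\<gamma>. eps_off r m \<rho> \<zeta> \<gamma> \<mu> - eps_off r m \<rho> \<zeta>' \<gamma> \<mu>) ?F"
    using Fc sr by (intro lincomb_cong) auto
  also have "\<dots> = lincomb V {1..r} (\<lambda>\<gamma>. eps_off r m \<rho> \<zeta> \<gamma> \<mu> - eps_off r m \<rho> \<zeta>' \<gamma> \<mu>) ?F"
    using small sr Fc by (intro lincomb_mono[symmetric]) (auto simp: eps_off_def)
  also have "lincomb V {1..r} (\<lambda>\<gamma>. if \<gamma> = \<mu> then 1 else 0) ?F \<oplus> \<dots>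
     = lincomb V {1..r} (\<lambda>\<gamma>. (if \<gamma> = \<mu> then 1 else 0) + (eps_off r m \<rho> \<zeta> \<gamma> \<mu> - eps_off r m \<rho> \<zeta>' \<gamma> \<mu>)) ?F"
    using Fc by (rule lincomb_add)
  finally have 2: "?e \<mu> = \<dots>" .
  have \<nu>: "\<nu> \<in> {1..r}" "\<nu> \<noteq> \<mu>" "\<nu> \<le> s" using admissible_bounds[OF adm] small[OF adm] by auto
  \<comment> \<open>Comparison of coefficients at \<open>\<nu> \<le> s\<close>: the first expansion
    has 0 there, the second the difference of the two coordinates.\<close>
  have "(if \<nu> \<le> s then 0 else c \<nu>) = (if \<nu> = \<mu> then 1 else 0) + (eps_off r m \<rho> \<zeta> \<nu> \<mu> - eps_off r m \<rho> \<zeta>' \<nu> \<mu>)"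
    by (rule indep_unique[OF F _ \<nu>(1)]) (use 1 2 in simp)
  then show ?thesis using \<nu> adm by (simp add: eps_off_def)
qed

end

section \<open>Functions pulled back from the base coordinates\<close>

definition base_coords :: "'j set \<Rightarrow> ('j + 'k \<Rightarrow> complex) \<Rightarrow> 'j \<Rightarrow> complex" where
  "base_coords K w = (\<lambda>j\<in>K. w (Inl j))"

lemma continuous_map_base_coords:
  assumes "Inl ` K \<subseteq> I"
  shows "continuous_map (cspace I) (cspace K) (base_coords K)"
proof -
  have "continuous_map (cspace I) euclidean (\<lambda>w. base_coords K w j)" if "j \<in> K" for j
    using that assms continuous_map_product_projection[of "Inl j" I "\<lambda>_. euclidean :: complex topology"]
    by (auto simp: base_coords_def)
  then show ?thesis by (auto simp: continuous_map_componentwise base_coords_def)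
qed

lemma openin_base_coords_preimage:
  assumes "Inl ` K \<subseteq> I" "openin (cspace K) \<Omega>"
  shows "openin (cspace I) {w \<in> topspace (cspace I). base_coords K w \<in> \<Omega>}"
  using openin_continuous_map_preimage[OF continuous_map_base_coords[OF assms(1)] assms(2)] .

text \<open>Composition with a coordinate projection commutes with partial derivatives in base
  directions and is annihilated by those in fibre directions, so the class passes on by induction
  over all \<open>f\<close> at once.\<close>

lemma Ck_base_coords:
  assumes K: "Inl ` K \<subseteq> I" and \<Omega>: "openin (cspace K) \<Omega>" and f: "Ck k K \<Omega> f"
  shows "Ck k I {w \<in> topspace (cspace I). base_coords K w \<in> \<Omega>} (\<lambda>w. f (base_coords K w))"
  using f
proof (induction k arbitrary: f)
  let ?D = "{w \<in> topspace (cspace I). base_coords K w \<in> \<Omega>}"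
  interpret D: open_domain I ?D
    by unfold_locales (rule openin_base_coords_preimage[OF K \<Omega>])
  interpret O: open_domain K \<Omega>
    by unfold_locales (rule \<Omega>)
  have cont: "continuous_map (subtopology (cspace I) ?D) euclidean (\<lambda>w. f (base_coords K w))"
    if "continuous_map (subtopology (cspace K) \<Omega>) euclidean f" for f :: "('a \<Rightarrow> complex) \<Rightarrow> complex"
  proof -
    have "continuous_map (subtopology (cspace I) ?D) (subtopology (cspace K) \<Omega>) (base_coords K)"
      using continuous_map_base_coords[OF K]
      by (auto simp: continuous_map_in_subtopology intro: continuous_map_from_subtopology)
    from continuous_map_compose[OF this that] show ?thesis by (simp add: o_def)
  qed
  {
    case 0
    then show ?case using cont by simp
  next
    case (Suc k)
    let ?R = "\<lambda>i c w. case i of Inl j \<Rightarrow> if j \<in> K then rpartial j c f (base_coords K w) else 0 | Inr _ \<Rightarrow> 0"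
    have line: "coord_line i c (\<lambda>w. f (base_coords K w)) p =
        (case i of Inl j \<Rightarrow> if j \<in> K then coord_line j c f (base_coords K p) else (\<lambda>_. f (base_coords K p))
         | Inr _ \<Rightarrow> (\<lambda>_. f (base_coords K p)))" for i c p
    proof (cases i)
      case (Inl j)
      have upd: "base_coords K (p(Inl j := x)) = (if j \<in> K then (base_coords K p)(j := x) else base_coords K p)" for x
        by (auto simp: base_coords_def fun_eq_iff)
      have "base_coords K p j = p (Inl j)" if "j \<in> K" using that by (simp add: base_coords_def)
      then show ?thesis by (cases "j \<in> K") (simp_all add: Inl coord_line_def upd)
    next
      case (Inr q)
      have upd: "base_coords K (p(Inr q := x)) = base_coords K p" for x
        by (auto simp: base_coords_def fun_eq_iff)
      show ?thesis by (simp add: Inr coord_line_def upd)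
    qed
    show ?case
    proof (rule D.Ck_SucI[where D = ?R])
      show "continuous_map (subtopology (cspace I) ?D) euclidean (\<lambda>w. f (base_coords K w))"
        using cont[OF O.Ck_continuous[OF Suc.prems]] .
    next
      fix i :: "'a + 'b" and c p assume "i \<in> I" "c \<in> {1, \<i>}" "p \<in> ?D"
      then show "pderiv_at i c (\<lambda>w. f (base_coords K w)) p (?R i c p)"
        using O.Ck_pderiv_at[OF Suc.prems, of _ c "base_coords K p"]
        by (auto simp: pderiv_at_def line split: sum.split)
    next
      fix i :: "'a + 'b" and c :: complex assume i: "i \<in> I" "c \<in> {1, \<i>}"
      show "Ck k I ?D (?R i c)"
      proof (cases "\<exists>j\<in>K. i = Inl j")
        case True
        then obtain j where j: "j \<in> K" "i = Inl j" by blast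
        have "Ck k I ?D (\<lambda>w. rpartial j c f (base_coords K w))"
          by (rule Suc.IH[OF O.Ck_rpartial[OF Suc.prems j(1) i(2)]])
        then show ?thesis using j by simp
      next
        case False
        then show ?thesis by (intro D.Ck_cong[OF _ D.Ck_const[of k 0]]) (auto split: sum.split)
      qed
    qed
  }
qed

lemma smooth_base_coords:
  "Inl ` K \<subseteq> I \<Longrightarrow> openin (cspace K) \<Omega> \<Longrightarrow> smooth K \<Omega> f \<Longrightarrow>
    smooth I {w \<in> topspace (cspace I). base_coords K w \<in> \<Omega>} (\<lambda>w. f (base_coords K w))"
  unfolding smooth_def using Ck_base_coords by blast

context open_domain
begin

lemma holo_const: "holo I \<Omega> (\<lambda>_. a)"
  by (auto simp: holo_def)

lemma holo_coord: "i \<in> I \<Longrightarrow> holo I \<Omega> (\<lambda>p. p i)"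
proof -
  assume i: "i \<in> I"
  have "(\<lambda>w. (p(j := w)) i) field_differentiable (at (p j))" for p :: "'i \<Rightarrow> complex" and j
    by (cases "i = j") auto
  then show ?thesis using i by (simp add: holo_def smooth_coord)
qed

lemma holo_const_add: 
  assumes "holo I \<Omega> f"
  shows "holo I \<Omega> (\<lambda>p. a + f p)"
  using assms by (auto simp: holo_def intro!: smooth_add derivative_intros field_differentiable_add)

end


section \<open>The frame of the quotient bundle\<close>

locale flag_frame =
  fixes n r m k l :: nat and \<rho> :: "nat \<Rightarrow> nat"
    and X :: "'x set" and A :: "('x, nat) chart set" and E :: "('x, 'v) hbundle"
    and U :: "'x set" and z :: "'x \<Rightarrow> nat \<Rightarrow> complex" and e :: "nat \<Rightarrow> 'x \<Rightarrow> 'v"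
    and x\<^sub>0 :: 'x and f\<^sub>0 :: "nat \<Rightarrow> 'v set"
    and c :: "nat \<Rightarrow> nat \<Rightarrow> nat \<Rightarrow> nat \<Rightarrow> complex"
  assumes manifold: "complex_manifold {1..n} X A"
    and vb: "hermitian_holomorphic_bundle {1..n} X A E" and idx: "idx E = {1..r}"
    and dims: "dimension_sequence r m \<rho>"
    and flag: "(x\<^sub>0, f\<^sub>0) \<in> flag_bundle X E m \<rho>"
    and chart: "(U, z) \<in> A" and normal: "normal_frame n (U, z) E e x\<^sub>0 c"
    and flag_eq: "\<forall>i\<le>m. f\<^sub>0 i = lspan (fib E x\<^sub>0) {r - \<rho> i<..r} (\<lambda>\<alpha>. e \<alpha> x\<^sub>0)"
    and kl: "k < l" and lm: "l \<le> m"
begin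

definition "I = flag_index n r m \<rho>"
definition "D = flag_dom n r m \<rho> (U, z)"
definition "P = flag_param n r m \<rho> E (U, z) e"
definition pt :: "(nat + nat \<times> nat \<Rightarrow> complex) \<Rightarrow> 'x" where "pt w = inv_into U z (base_coords {1..n} w)"
definition "fibre w = fib E (pt w)"
definition "hmet w = herm E (pt w)"
definition "frame w \<alpha> = e \<alpha> (pt w)"
definition "ep w = eps (fibre w) r m \<rho> (frame w) (\<lambda>p. w (Inr p))"
definition "sub w i = lspan (fibre w) {r - \<rho> i<..r} (ep w)"
text \<open>\<open>K\<close> indexes the frame of the lower bundle, \<open>J \<union> K\<close> that
  of the upper one, and \<open>J\<close> that of their quotient.\<close>

definition "J = {r - \<rho> l<..r - \<rho> k}"
definition "K = {r - \<rho> k<..r}"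

lemma finite_I: "finite I"
  unfolding I_def by (rule finite_flag_index)

lemma finite_JK: "finite J" "finite K"
  by (simp_all add: J_def K_def)

lemma \<rho>_mono: "\<rho> k \<le> \<rho> l" "\<rho> l \<le> r"
  using dimension_sequenceD[OF dims] kl lm by auto

lemma JK: "J \<union> K = {r - \<rho> l<..r}" "J \<inter> K = {}" "J \<union> K \<subseteq> {1..r}"
  using \<rho>_mono by (auto simp: J_def K_def)

lemma P_eq: "P w = (pt w, \<lambda>i\<in>{..m}. sub w i)"
  unfolding P_def flag_param_def pt_def sub_def ep_def fibre_def frame_def base_coords_def Let_def by simp

lemma chart_props: "U \<subseteq> X" "inj_on z U" "openin (cspace {1..n}) (z ` U)"
proof -
  have "is_chart {1..n} X (U, z)" using manifold chart unfolding complex_manifold_def by blast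
  then show "U \<subseteq> X" "inj_on z U" "openin (cspace {1..n}) (z ` U)" by (simp_all add: is_chart_def)
qed

lemma D_eq: "D = {w \<in> topspace (cspace I). base_coords {1..n} w \<in> z ` U}"
  by (simp add: D_def flag_dom_def I_def base_coords_def)

lemma Inl_subset: "Inl ` {1..n} \<subseteq> I"
  by (auto simp: I_def flag_index_def)

lemma Inr_mem: "(\<gamma>, \<alpha>) \<in> admissible r m \<rho> \<Longrightarrow> Inr (\<gamma>, \<alpha>) \<in> I"
  by (auto simp: I_def flag_index_def)

sublocale open_domain I D
  unfolding D_eq by unfold_locales (rule openin_base_coords_preimage[OF Inl_subset chart_props(3)])

lemma pt_mem: "w \<in> D \<Longrightarrow> pt w \<in> U" "w \<in> D \<Longrightarrow> z (pt w) = base_coords {1..n} w"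
  unfolding D_eq pt_def by (auto intro: inv_into_into f_inv_into_f)

lemma frame_mem: "(U, e) \<in> frames E" and x0_mem: "x\<^sub>0 \<in> U" and z_x0: "z x\<^sub>0 = origin {1..n}"
  using normal by (simp_all add: normal_frame_def)

lemma fibre_hermitian: "w \<in> D \<Longrightarrow> hermitian_module (fibre w) (hmet w)"
proof -
  assume w: "w \<in> D"
  have "\<forall>x\<in>X. module complex_ring (fib E x) \<and> hermitian_inner (fib E x) (herm E x)"
    using vb unfolding hermitian_holomorphic_bundle_def by blast
  moreover have "pt w \<in> X" using pt_mem(1)[OF w] chart_props(1) by blast
  ultimately show ?thesis unfolding fibre_def hmet_def
    by (intro hermitian_module.intro complex_module.intro hermitian_module_axioms.intro) blast+
qed

lemma fibre_basis: "w \<in> D \<Longrightarrow> is_basis (fibre w) {1..r} (frame w)"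
proof -
  assume w: "w \<in> D"
  have "is_frame {1..n} A E (U, e)" using vb frame_mem unfolding hermitian_holomorphic_bundle_def by blast
  then show ?thesis using pt_mem(1)[OF w] unfolding is_frame_def fibre_def frame_def idx by auto
qed

lemma frame_closed: "w \<in> D \<Longrightarrow> frame w \<in> {1..r} \<rightarrow> carrier (fibre w)"
  using fibre_basis by (simp add: is_basis_def)

lemma ep_closed: "w \<in> D \<Longrightarrow> S \<subseteq> {1..r} \<Longrightarrow> ep w \<in> S \<rightarrow> carrier (fibre w)"
proof -
  assume w: "w \<in> D" and S: "S \<subseteq> {1..r}"
  interpret hermitian_module "fibre w" "hmet w" by (rule fibre_hermitian[OF w])
  show ?thesis unfolding ep_def using S eps_closed[OF frame_closed[OF w]] by blast
qed

lemma ep_indep: "w \<in> D \<Longrightarrow> S \<subseteq> {1..r} \<Longrightarrow> complex_module.indep (fibre w) S (ep w)"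
proof -
  assume w: "w \<in> D" and S: "S \<subseteq> {1..r}"
  interpret hermitian_module "fibre w" "hmet w" by (rule fibre_hermitian[OF w])
  show ?thesis unfolding ep_def by (rule indep_eps[OF fibre_basis[OF w] S])
qed

text \<open>Equal flags lie over the same base point, which settles the base coordinates; the fibre
  coordinates are then compared inside one fibre. Only this makes \<open>inv_into D P\<close> a
  genuine inverse, that is, a chart.\<close>

lemma inj_P: "inj_on P D"
proof (rule inj_onI)
  fix w w' assume w: "w \<in> D" and w': "w' \<in> D" and eq: "P w = P w'"
  interpret hermitian_module "fibre w" "hmet w" by (rule fibre_hermitian[OF w])
  have pt: "pt w = pt w'" and fl: "(\<lambda>i\<in>{..m}. sub w i) = (\<lambda>i\<in>{..m}. sub w' i)" using eq by (simp_all add: P_eq)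
  have same: "fibre w' = fibre w" "frame w' = frame w" using pt by (simp_all add: fibre_def frame_def fun_eq_iff)
  have "sub w i = sub w' i" if "i \<le> m" for i using fun_cong[OF fl, of i] that by simp
  then have sp: "lspan (fibre w) {r - \<rho> i<..r} (eps (fibre w) r m \<rho> (frame w) (\<lambda>p. w (Inr p)))
     = lspan (fibre w) {r - \<rho> i<..r} (eps (fibre w) r m \<rho> (frame w) (\<lambda>p. w' (Inr p)))" if "i \<le> m" for i
    using that unfolding sub_def ep_def same by simp
  have base: "base_coords {1..n} w = base_coords {1..n} w'" using pt_mem(2)[OF w] pt_mem(2)[OF w'] pt by simp
  show "w = w'"
  proof (rule PiE_ext[where k = I and s = "\<lambda>_. UNIV"])
    fix i assume i: "i \<in> I"
    show "w i = w' i"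
    proof (cases i)
      case (Inl j)
      then have "j \<in> {1..n}" using i by (auto simp: I_def flag_index_def)
      then show ?thesis using fun_cong[OF base, of j] Inl by (simp add: base_coords_def)
    next
      case (Inr q)
      then obtain \<nu> \<mu> where q: "q = (\<nu>, \<mu>)" "(\<nu>, \<mu>) \<in> admissible r m \<rho>"
        using i by (cases q) (auto simp: I_def flag_index_def)
      then show ?thesis
        using eps_coordinates_unique[OF dims fibre_basis[OF w] sp q(2)] Inr by simp
    qed
  qed (use w w' D_eq in auto)
qed

lemma chart_eq: "flag_chart n r m \<rho> E (U, z) e = (P ` D, inv_into D P)"
  by (simp add: flag_chart_def P_def D_def)

lemma inv_P: "w \<in> D \<Longrightarrow> inv_into D P (P w) = w"
  using inj_P by (rule inv_into_f_f)

lemma inv_P_image: "inv_into D P ` P ` D = D"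
  using inv_P by force

text \<open>\<open>has_chern_curvature\<close> inverts the chart map by \<open>inv_into\<close>, and
  the chart map is itself an \<open>inv_into\<close>; the double inversion leads back to
  \<open>P\<close>.\<close>

lemma inv_inv_P: "w \<in> D \<Longrightarrow> inv_into (P ` D) (inv_into D P) w = P w"
proof -
  assume w: "w \<in> D"
  have "inj_on (inv_into D P) (P ` D)" by (rule inj_on_inv_into) simp
  then show ?thesis using inv_into_f_f[of "inv_into D P" "P ` D" "P w"] w inv_P[OF w] by simp
qed

lemma sub_submodule:
  assumes w: "w \<in> D"
  shows "submodule (sub w i) complex_ring (fibre w)"
proof -
  interpret hermitian_module "fibre w" "hmet w" by (rule fibre_hermitian[OF w])
  have "{r - \<rho> i<..r} \<subseteq> {1..r}" by auto
  then show ?thesis unfolding sub_def by (intro submodule_lspan ep_closed[OF w]) auto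
qed

lemma P_mem: "P ` D \<subseteq> flag_bundle X E m \<rho>"
proof
  fix y assume "y \<in> P ` D"
  then obtain w where w: "w \<in> D" "y = P w" by blast
  interpret hermitian_module "fibre w" "hmet w" by (rule fibre_hermitian[OF w(1)])
  note Dm = dimension_sequenceD[OF dims]
  have S: "{r - \<rho> i<..r} \<subseteq> {1..r}" for i by auto
  have "sub w 0 = {\<zero>\<^bsub>fibre w\<^esub>}" using Dm(1) by (simp add: sub_def lspan_def)
  moreover have "sub w m = carrier (fibre w)"
  proof -
    have "{r - \<rho> m<..r} = {1..r}" using Dm(2) by auto
    then show ?thesis unfolding sub_def ep_def using lspan_eps_all[OF fibre_basis[OF w(1)]] by simp
  qed
  moreover have "sub w i \<subseteq> sub w (Suc i)" if "i < m" for i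
    unfolding sub_def using Dm(3)[of i "Suc i"] that
    by (intro lspan_mono ep_closed[OF w(1) S]) auto
  moreover have "has_dim ((fibre w)\<lparr>carrier := sub w i\<rparr>) (\<rho> i)" if "i \<le> m" for i
  proof -
    have "card {r - \<rho> i<..r} = \<rho> i" using Dm(5)[OF that] by simp
    then show ?thesis
      unfolding sub_def using has_dim_lspan[OF ep_indep[OF w(1) S[of i]]] by simp
  qed
  ultimately show "y \<in> flag_bundle X E m \<rho>"
    using pt_mem(1)[OF w(1)] chart_props(1) sub_submodule[OF w(1)]
    unfolding w(2) P_eq flag_bundle_def fibre_def by (auto simp: Suc_leI)
qed

definition "quot_frame \<alpha> y = snd y k +>\<^bsub>fib E (fst y)\<^esub> ep (inv_into D P y) \<alpha>"

lemma quot_frame_P: "w \<in> D \<Longrightarrow> quot_frame \<alpha> (P w) = sub w k +>\<^bsub>fibre w\<^esub> ep w \<alpha>"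
  using kl lm by (simp add: quot_frame_def inv_P) (simp add: P_eq fibre_def)

lemma sub_k: "sub w k = lspan (fibre w) K (ep w)"
  by (simp add: sub_def K_def)

lemma taut_fib_P: "taut_fib E l (P w) = (fibre w)\<lparr>carrier := sub w l\<rparr>"
  using lm by (simp add: taut_fib_def P_eq fibre_def)

lemma snd_P_k: "snd (P w) k = sub w k"
  using kl lm by (simp add: P_eq)

text \<open>The quotient is formed inside the upper bundle, so independence and spans are first
  transferred from the fibre of \<open>E\<close> to the submodule \<open>sub w l\<close>.\<close>

lemma quot_frame_basis:
  assumes w: "w \<in> D"
  shows "is_basis (quot_module (taut_fib E l (P w)) (snd (P w) k)) J (\<lambda>\<alpha>. quot_frame \<alpha> (P w))"
proof -
  interpret hermitian_module "fibre w" "hmet w" by (rule fibre_hermitian[OF w])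
  let ?M = "(fibre w)\<lparr>carrier := sub w l\<rparr>"
  have sl: "submodule (sub w l) complex_ring (fibre w)" by (rule sub_submodule[OF w])
  interpret M: complex_module ?M by (rule complex_module_submodule[OF sl])
  have sub_l: "sub w l = lspan (fibre w) (J \<union> K) (ep w)" by (simp add: sub_def JK(1))
  have B: "is_basis ?M (J \<union> K) (ep w)"
    by (rule is_basis_submodule[OF sl ep_indep[OF w JK(3)] sub_l])
  then have I: "M.indep (J \<union> K) (ep w)" by (simp add: M.is_basis_iff)
  have epJK: "ep w \<in> J \<union> K \<rightarrow> sub w l" using I by (auto simp: M.indep_def)
  have lK: "lspan ?M K (ep w) = sub w k"
    using epJK lincomb_submodule[OF sl finite_JK(2), of "ep w"] unfolding sub_k lspan_def by auto
  have lJK: "lspan ?M (J \<union> K) (ep w) = sub w l"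
    using epJK lincomb_submodule[OF sl, of "J \<union> K" "ep w"] finite_JK unfolding sub_l lspan_def by auto
  have "is_basis (quot_module ?M (sub w k)) J (\<lambda>\<alpha>. sub w k +>\<^bsub>?M\<^esub> ep w \<alpha>)"
    by (rule M.is_basis_quot[OF I JK(2)]) (simp_all add: lK lJK)
  then show ?thesis by (simp add: taut_fib_P snd_P_k quot_frame_P[OF w])
qed

lemma coeff_holo: "holo I D (\<lambda>w. eps_coeff r m \<rho> (\<lambda>p. w (Inr p)) \<alpha> \<gamma>)"
proof (cases "(\<gamma>, \<alpha>) \<in> admissible r m \<rho>")
  case True
  then have "holo I D (\<lambda>w. (if \<gamma> = \<alpha> then 1 else 0) + w (Inr (\<gamma>, \<alpha>)))"
    by (intro holo_const_add holo_coord Inr_mem)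
  then show ?thesis using True by (simp add: eps_coeff_def eps_off_def)
next
  case False
  then show ?thesis by (simp add: eps_coeff_def eps_off_def holo_const)
qed

lemma ep_lincomb:
  "w \<in> D \<Longrightarrow> \<alpha> \<in> {1..r} \<Longrightarrow> ep w \<alpha> = lincomb (fibre w) {1..r} (eps_coeff r m \<rho> (\<lambda>p. w (Inr p)) \<alpha>) (frame w)"
proof -
  assume w: "w \<in> D" and \<alpha>: "\<alpha> \<in> {1..r}"
  interpret hermitian_module "fibre w" "hmet w" by (rule fibre_hermitian[OF w])
  show ?thesis unfolding ep_def by (rule eps_eq_lincomb[OF frame_closed[OF w] \<alpha>])
qed

text \<open>The given chart and frame test holomorphy at all points simultaneously: in them the
  coefficients of the section are constants or single coordinates.\<close>

lemma pullback_section: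
  assumes \<alpha>: "\<alpha> \<in> {1..r}"
  shows "holo_pullback_section n r m \<rho> A E (P ` D) (\<lambda>y. ep (inv_into D P y) \<alpha>)"
  unfolding holo_pullback_section_def
proof (intro ballI bexI[of _ "(U, z)"] exI conjI)
  fix y assume y: "y \<in> P ` D"
  show "(fst (U, z), e) \<in> frames E" using frame_mem by simp
  show "(P ` D, inv_into D P) = flag_chart n r m \<rho> E (U, z) e" by (rule chart_eq[symmetric])
  show "y \<in> P ` D" by (rule y)
  show "P ` D \<subseteq> fst (P ` D, inv_into D P) \<inter> P ` D" by simp
  show "openin (cspace (flag_index n r m \<rho>)) (snd (P ` D, inv_into D P) ` P ` D)"
    using openin_domain unfolding I_def by (simp add: inv_P_image)
  show "holo (flag_index n r m \<rho>) (snd (P ` D, inv_into D P) ` P ` D) (\<lambda>w. eps_coeff r m \<rho> (\<lambda>p. w (Inr p)) \<alpha> \<gamma>)" for \<gamma>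
    using coeff_holo unfolding I_def by (simp add: inv_P_image)
  fix y' assume "y' \<in> P ` D"
  then obtain w where w: "w \<in> D" "y' = P w" by blast
  show "ep (inv_into D P y') \<alpha> = lincomb (fib E (fst y')) (idx E)
      (\<lambda>\<gamma>. eps_coeff r m \<rho> (\<lambda>p. snd (P ` D, inv_into D P) y' (Inr p)) \<alpha> \<gamma>) (\<lambda>\<gamma>. e \<gamma> (fst y'))"
  proof -
    have "frame w = (\<lambda>\<gamma>. e \<gamma> (pt w))" by (simp add: frame_def fun_eq_iff)
    then show ?thesis
      using ep_lincomb[OF w(1) \<alpha>] unfolding w(2) idx by (simp add: inv_P[OF w(1)]) (simp add: P_eq fibre_def)
  qed
qed (rule chart)

lemma quot_frame_mem: "(P ` D, quot_frame) \<in> frames (taut_quotient n r m \<rho> X A E l k)"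
proof -
  have sec: "\<exists>N t. y \<in> N \<and> N \<subseteq> P ` D \<and> (\<forall>\<alpha>\<in>J. holo_pullback_section n r m \<rho> A E N (t \<alpha>) \<and>
      (\<forall>y'\<in>N. t \<alpha> y' \<in> snd y' l \<and> quot_frame \<alpha> y' = snd y' k +>\<^bsub>fib E (fst y')\<^esub> t \<alpha> y'))"
    if y: "y \<in> P ` D" for y
  \<comment> \<open>The sections \<open>ep\<close> are a lift over the whole chart domain, so no
    shrinking of neighbourhoods is involved.\<close>
  proof (intro exI[of _ "P ` D"] exI[of _ "\<lambda>\<alpha> y. ep (inv_into D P y) \<alpha>"] conjI ballI y subset_refl)
    fix \<alpha> assume \<alpha>: "\<alpha> \<in> J"
    then have \<alpha>r: "\<alpha> \<in> {1..r}" using JK(3) by blast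
    show "holo_pullback_section n r m \<rho> A E (P ` D) (\<lambda>y. ep (inv_into D P y) \<alpha>)"
      by (rule pullback_section[OF \<alpha>r])
    fix y' assume "y' \<in> P ` D"
    then obtain w where w: "w \<in> D" "y' = P w" by blast
    interpret hermitian_module "fibre w" "hmet w" by (rule fibre_hermitian[OF w(1)])
    have "ep w \<alpha> \<in> sub w l"
      unfolding sub_def JK(1)[symmetric] using \<alpha> finite_JK by (intro lspan_base ep_closed[OF w(1) JK(3)]) auto
    moreover have "snd y' l = sub w l" using lm by (simp add: w(2) P_eq)
    ultimately show "ep (inv_into D P y') \<alpha> \<in> snd y' l" using w inv_P by simp
    show "quot_frame \<alpha> y' = snd y' k +>\<^bsub>fib E (fst y')\<^esub> ep (inv_into D P y') \<alpha>"
      by (simp add: quot_frame_def)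
  qed
  show ?thesis
    unfolding taut_quotient_def using P_mem quot_frame_basis sec by (simp add: J_def)
qed

section \<open>Gram matrices of the frame of \<open>E\<close> and of the adapted frame\<close>

definition "base_gram \<gamma> \<delta> w = hmet w (frame w \<gamma>) (frame w \<delta>)"
definition "gram \<alpha> \<beta> w = hmet w (ep w \<alpha>) (ep w \<beta>)"

text \<open>These entries depend on the base point only; their smoothness in the chart
  \<open>z\<close> is pulled back along the projection of coordinates.\<close>

lemma base_gram_smooth:
  assumes "\<gamma> \<in> {1..r}" "\<delta> \<in> {1..r}"
  shows "smooth I D (base_gram \<gamma> \<delta>)"
proof -
  have "\<forall>(U, s)\<in>frames E. \<forall>\<alpha>\<in>idx E. \<forall>\<beta>\<in>idx E. smooth_fun {1..n} A U (\<lambda>x. herm E x (s \<alpha> x) (s \<beta> x))"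
    using vb unfolding hermitian_holomorphic_bundle_def by blast
  then have "smooth_fun {1..n} A U (\<lambda>x. herm E x (e \<gamma> x) (e \<delta> x))"
    using frame_mem assms idx by fastforce
  then have "smooth {1..n} (z ` U) (\<lambda>w. herm E (inv_into U z w) (e \<gamma> (inv_into U z w)) (e \<delta> (inv_into U z w)))"
    using chart unfolding smooth_fun_def by fastforce
  from smooth_base_coords[OF Inl_subset chart_props(3) this]
  show ?thesis unfolding base_gram_def hmet_def frame_def pt_def D_eq[symmetric] .
qed

lemma gram_eq:
  assumes "w \<in> D" "\<alpha> \<in> {1..r}" "\<beta> \<in> {1..r}"
  shows "gram \<alpha> \<beta> w = (\<Sum>\<gamma>\<in>{1..r}. \<Sum>\<delta>\<in>{1..r}. eps_coeff r m \<rho> (\<lambda>p. w (Inr p)) \<alpha> \<gamma> *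
      (cnj (eps_coeff r m \<rho> (\<lambda>p. w (Inr p)) \<beta> \<delta>) * base_gram \<gamma> \<delta> w))"
proof -
  interpret hermitian_module "fibre w" "hmet w" by (rule fibre_hermitian[OF assms(1)])
  have f: "frame w \<in> {1..r} \<rightarrow> carrier (fibre w)" by (rule frame_closed[OF assms(1)])
  show ?thesis
    unfolding gram_def ep_lincomb[OF assms(1,2)] ep_lincomb[OF assms(1,3)] base_gram_def sum_distrib_left[symmetric]
    using f by (subst herm_lincomb_left) (auto intro!: sum.cong simp: herm_lincomb_right Pi_iff)
qed

lemma coeff_smooth: "smooth I D (\<lambda>w. eps_coeff r m \<rho> (\<lambda>p. w (Inr p)) \<alpha> \<gamma>)"
  using coeff_holo by (simp add: holo_def)

lemma gram_smooth:
  assumes "\<alpha> \<in> {1..r}" "\<beta> \<in> {1..r}"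
  shows "smooth I D (gram \<alpha> \<beta>)"
proof (rule smooth_cong)
  show "smooth I D (\<lambda>w. \<Sum>\<gamma>\<in>{1..r}. \<Sum>\<delta>\<in>{1..r}. eps_coeff r m \<rho> (\<lambda>p. w (Inr p)) \<alpha> \<gamma> *
      (cnj (eps_coeff r m \<rho> (\<lambda>p. w (Inr p)) \<beta> \<delta>) * base_gram \<gamma> \<delta> w))"
    by (intro smooth_sum smooth_mult smooth_cnj coeff_smooth base_gram_smooth)
qed (rule gram_eq[symmetric, OF _ assms])

lemma gram_anisotropic_D:
  assumes "w \<in> D" "S \<subseteq> {1..r}"
  shows "anisotropic S (\<lambda>\<alpha> \<beta>. gram \<alpha> \<beta> w)"
proof -
  interpret hermitian_module "fibre w" "hmet w" by (rule fibre_hermitian[OF assms(1)])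
  show ?thesis unfolding gram_def by (rule gram_anisotropic[OF ep_indep[OF assms]])
qed

end


section \<open>The 2-jet of the Gram matrix\<close>

context flag_frame
begin

text \<open>Normal equations of the projection to the lower bundle: their matrix is the Gram matrix
  over \<open>K\<close>, nondegenerate at every point, so Gaussian elimination applies on the whole
  chart.\<close>

lemma quot_coeff_exists:
  "\<exists>q. \<forall>\<alpha>\<in>J. (\<forall>\<mu>\<in>K. smooth I D (q \<alpha> \<mu>)) \<and>
     (\<forall>w\<in>D. \<forall>\<nu>\<in>K. (\<Sum>\<mu>\<in>K. q \<alpha> \<mu> w * gram \<mu> \<nu> w) = gram \<alpha> \<nu> w)"
proof -
  have JK': "J \<subseteq> {1..r}" "K \<subseteq> {1..r}" using JK(3) by blast+
  have "\<exists>x. (\<forall>\<mu>\<in>K. smooth I D (x \<mu>)) \<and> (\<forall>w\<in>D. \<forall>\<nu>\<in>K. (\<Sum>\<mu>\<in>K. x \<mu> w * gram \<mu> \<nu> w) = gram \<alpha> \<nu> w)"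
    if "\<alpha> \<in> J" for \<alpha>
    by (rule smooth_solve[OF finite_JK(2)])
      (use that JK' in \<open>blast intro: gram_smooth gram_anisotropic_D\<close>)+
  then show ?thesis by (intro bchoice ballI)
qed

definition "quot_coeff = (SOME q. \<forall>\<alpha>\<in>J. (\<forall>\<mu>\<in>K. smooth I D (q \<alpha> \<mu>)) \<and>
     (\<forall>w\<in>D. \<forall>\<nu>\<in>K. (\<Sum>\<mu>\<in>K. q \<alpha> \<mu> w * gram \<mu> \<nu> w) = gram \<alpha> \<nu> w))"

lemma quot_coeff:
  "\<alpha> \<in> J \<Longrightarrow> \<mu> \<in> K \<Longrightarrow> smooth I D (quot_coeff \<alpha> \<mu>)"
  "\<alpha> \<in> J \<Longrightarrow> w \<in> D \<Longrightarrow> \<nu> \<in> K \<Longrightarrow> (\<Sum>\<mu>\<in>K. quot_coeff \<alpha> \<mu> w * gram \<mu> \<nu> w) = gram \<alpha> \<nu> w"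
  using someI_ex[OF quot_coeff_exists] unfolding quot_coeff_def[symmetric] by blast+

definition "quot_gram \<alpha> \<beta> w = gram \<alpha> \<beta> w - (\<Sum>\<mu>\<in>K. quot_coeff \<alpha> \<mu> w * gram \<mu> \<beta> w)"

definition "rep w \<alpha> = ep w \<alpha> \<oplus>\<^bsub>fibre w\<^esub> lincomb (fibre w) K (\<lambda>\<mu>. - quot_coeff \<alpha> \<mu> w) (ep w)"

lemma JK_subset: "J \<subseteq> {1..r}" "K \<subseteq> {1..r}"
  using JK(3) by blast+

lemma ep_mem: "w \<in> D \<Longrightarrow> \<alpha> \<in> {1..r} \<Longrightarrow> ep w \<alpha> \<in> carrier (fibre w)"
  using ep_closed[of w "{1..r}"] by (auto simp del: One_nat_def)

lemma rep_closed: "w \<in> D \<Longrightarrow> \<alpha> \<in> J \<Longrightarrow> rep w \<alpha> \<in> carrier (fibre w)"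
proof -
  assume w: "w \<in> D" and \<alpha>: "\<alpha> \<in> J"
  interpret hermitian_module "fibre w" "hmet w" by (rule fibre_hermitian[OF w])
  show ?thesis unfolding rep_def using \<alpha> JK_subset
    by (intro M.add.m_closed lincomb_closed ep_closed[OF w] ep_mem[OF w]) auto
qed

lemma orth_rep_quot_frame:
  assumes w: "w \<in> D" and \<alpha>: "\<alpha> \<in> J"
  shows "orth_rep (hmet w) (sub w k) (sub w k +>\<^bsub>fibre w\<^esub> ep w \<alpha>) = rep w \<alpha>"
    and "v \<in> sub w k \<Longrightarrow> hmet w (rep w \<alpha>) v = 0"
proof -
  interpret hermitian_module "fibre w" "hmet w" by (rule fibre_hermitian[OF w])
  have \<alpha>r: "\<alpha> \<in> {1..r}" using \<alpha> JK_subset by blast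
  have "(\<Sum>\<mu>\<in>K. quot_coeff \<alpha> \<mu> w * hmet w (ep w \<mu>) (ep w \<nu>)) = hmet w (ep w \<alpha>) (ep w \<nu>)" if "\<nu> \<in> K" for \<nu>
    using quot_coeff(2)[OF \<alpha> w that] by (simp add: gram_def)
  note r = orth_rep_eq[OF finite_JK(2) ep_closed[OF w JK_subset(2)] sub_k ep_mem[OF w \<alpha>r] this]
  show "orth_rep (hmet w) (sub w k) (sub w k +>\<^bsub>fibre w\<^esub> ep w \<alpha>) = rep w \<alpha>"
    unfolding rep_def by (rule r(1))
  show "hmet w (rep w \<alpha>) v = 0" if "v \<in> sub w k"
    unfolding rep_def by (rule r(2)[OF _ that])
qed

text \<open>Only the left factor has to be expanded: the \<open>K\<close>-part of
  \<open>rep w \<beta>\<close> lies in \<open>sub w k\<close> and is orthogonal to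
  \<open>rep w \<alpha>\<close>. This explains why \<open>quot_gram\<close> contains no term
  quadratic in \<open>quot_coeff\<close>.\<close>

lemma quot_gram_rep:
  assumes w: "w \<in> D" and \<alpha>: "\<alpha> \<in> J" and \<beta>: "\<beta> \<in> J"
  shows "hmet w (rep w \<alpha>) (rep w \<beta>) = quot_gram \<alpha> \<beta> w"
proof -
  interpret hermitian_module "fibre w" "hmet w" by (rule fibre_hermitian[OF w])
  have r: "\<alpha> \<in> {1..r}" "\<beta> \<in> {1..r}" using \<alpha> \<beta> JK_subset by auto
  note rc = rep_closed[OF w \<alpha>] and ec = ep_mem[OF w r(1)] ep_mem[OF w r(2)]
  let ?v = "lincomb (fibre w) K (\<lambda>\<mu>. - quot_coeff \<beta> \<mu> w) (ep w)"
  have eK: "ep w \<in> K \<rightarrow> carrier (fibre w)" by (rule ep_closed[OF w JK_subset(2)])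
  have vc: "?v \<in> carrier (fibre w)" using eK by (rule lincomb_closed)
  have "?v \<in> sub w k" unfolding sub_k lspan_def by blast
  then have z: "hmet w (rep w \<alpha>) ?v = 0" by (rule orth_rep_quot_frame(2)[OF w \<alpha>])
  have "hmet w (rep w \<alpha>) (rep w \<beta>) = cnj (hmet w (rep w \<beta>) (rep w \<alpha>))"
    using rep_closed[OF w \<beta>] rc by (rule herm_cnj)
  also have "hmet w (rep w \<beta>) (rep w \<alpha>) = hmet w (ep w \<beta>) (rep w \<alpha>) + hmet w ?v (rep w \<alpha>)"
    unfolding rep_def[of w \<beta>] by (rule herm_add_left[OF ec(2) vc rc])
  also have "cnj \<dots> = hmet w (rep w \<alpha>) (ep w \<beta>) + hmet w (rep w \<alpha>) ?v"
    using herm_cnj[OF ec(2) rc] herm_cnj[OF vc rc] by simp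
  also have "\<dots> = hmet w (ep w \<alpha>) (ep w \<beta>) + (\<Sum>\<mu>\<in>K. - quot_coeff \<alpha> \<mu> w * hmet w (ep w \<mu>) (ep w \<beta>))"
    unfolding z unfolding rep_def using eK ec
    by (subst herm_add_left) (auto simp: herm_lincomb_left[OF finite_JK(2) eK ec(2)])
  finally show ?thesis by (simp add: quot_gram_def gram_def sum_negf)
qed

lemma quot_gram_herm: "w \<in> D \<Longrightarrow> \<alpha> \<in> J \<Longrightarrow> \<beta> \<in> J \<Longrightarrow> quot_gram \<beta> \<alpha> w = cnj (quot_gram \<alpha> \<beta> w)"
proof -
  assume a: "w \<in> D" "\<alpha> \<in> J" "\<beta> \<in> J"
  interpret hermitian_module "fibre w" "hmet w" by (rule fibre_hermitian[OF a(1)])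
  show ?thesis
    unfolding quot_gram_rep[OF a, symmetric] quot_gram_rep[OF a(1,3,2), symmetric]
    using a by (intro herm_cnj rep_closed)
qed

text \<open>\<open>rep w \<alpha>\<close> differs from \<open>ep w \<alpha>\<close> by a combination
  over \<open>K\<close>, so a relation among the \<open>rep\<close> becomes one among the
  \<open>ep\<close> with the same coefficients over \<open>J\<close>.\<close>

lemma rep_indep:
  assumes w: "w \<in> D"
  shows "complex_module.indep (fibre w) J (rep w)"
proof -
  interpret hermitian_module "fibre w" "hmet w" by (rule fibre_hermitian[OF w])
  define N where "N = (\<lambda>\<alpha> \<gamma>. if \<gamma> \<in> K then - quot_coeff \<alpha> \<gamma> w else if \<gamma> = \<alpha> then 1 else 0)"
  have e: "ep w \<in> J \<union> K \<rightarrow> carrier (fibre w)" "ep w \<in> J \<rightarrow> carrier (fibre w)" "ep w \<in> K \<rightarrow> carrier (fibre w)"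
    using ep_closed[OF w JK(3)] by auto
  have rep: "rep w \<alpha> = lincomb (fibre w) (J \<union> K) (N \<alpha>) (ep w)" if \<alpha>: "\<alpha> \<in> J" for \<alpha>
  proof -
    have nK: "\<gamma> \<notin> K" if "\<gamma> \<in> J" for \<gamma> using that JK(2) by blast
    have "lincomb (fibre w) (J \<union> K) (N \<alpha>) (ep w) = lincomb (fibre w) J (N \<alpha>) (ep w) \<oplus>\<^bsub>fibre w\<^esub> lincomb (fibre w) K (N \<alpha>) (ep w)"
      by (rule lincomb_union[OF finite_JK JK(2) e(1)])
    also have "lincomb (fibre w) K (N \<alpha>) (ep w) = lincomb (fibre w) K (\<lambda>\<mu>. - quot_coeff \<alpha> \<mu> w) (ep w)"
      using e by (intro lincomb_cong) (auto simp: N_def)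
    also have "lincomb (fibre w) J (N \<alpha>) (ep w) = lincomb (fibre w) J (\<lambda>\<gamma>. if \<gamma> = \<alpha> then 1 else 0) (ep w)"
      using e nK by (intro lincomb_cong) (auto simp: N_def)
    also have "\<dots> = ep w \<alpha>"
      using lincomb_single[OF finite_JK(1) \<alpha> e(2), of 1] funcset_mem[OF e(2) \<alpha>] by simp
    finally show ?thesis by (simp add: rep_def)
  qed
  show ?thesis
    unfolding indep_def
  proof (intro conjI allI impI ballI finite_JK)
    show "rep w \<in> J \<rightarrow> carrier (fibre w)" using rep_closed[OF w] by auto
    fix x \<alpha> assume z: "lincomb (fibre w) J x (rep w) = \<zero>\<^bsub>fibre w\<^esub>" and \<alpha>: "\<alpha> \<in> J"
    have "lincomb (fibre w) J x (rep w) = lincomb (fibre w) J x (\<lambda>\<alpha>. lincomb (fibre w) (J \<union> K) (N \<alpha>) (ep w))"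
      using e rep by (intro lincomb_cong) auto
    also have "\<dots> = lincomb (fibre w) (J \<union> K) (\<lambda>\<gamma>. \<Sum>\<alpha>\<in>J. x \<alpha> * N \<alpha> \<gamma>) (ep w)"
      using finite_JK e by (intro lincomb_lincomb) auto
    finally have "(\<Sum>\<alpha>'\<in>J. x \<alpha>' * N \<alpha>' \<alpha>) = 0"
      using z \<alpha> ep_indep[OF w JK(3)] unfolding indep_def by auto
    moreover have "(\<Sum>\<alpha>'\<in>J. x \<alpha>' * N \<alpha>' \<alpha>) = (\<Sum>\<alpha>'\<in>J. if \<alpha> = \<alpha>' then x \<alpha>' else 0)"
      using \<alpha> JK(2) by (intro sum.cong) (auto simp: N_def)
    ultimately show "x \<alpha> = 0" using \<alpha> finite_JK by simp
  qed
qed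

lemma quot_gram_anisotropic:
  assumes w: "w \<in> D"
  shows "anisotropic J (\<lambda>\<alpha> \<beta>. quot_gram \<alpha> \<beta> w)"
proof -
  interpret hermitian_module "fibre w" "hmet w" by (rule fibre_hermitian[OF w])
  have "anisotropic J (\<lambda>\<alpha> \<beta>. hmet w (rep w \<alpha>) (rep w \<beta>))" by (rule gram_anisotropic[OF rep_indep[OF w]])
  then show ?thesis unfolding anisotropic_def by (simp add: quot_gram_rep[OF w])
qed

lemma quot_gram_smooth: "\<alpha> \<in> J \<Longrightarrow> \<beta> \<in> J \<Longrightarrow> smooth I D (quot_gram \<alpha> \<beta>)"
  unfolding quot_gram_def using JK_subset
  by (intro smooth_diff smooth_sum smooth_mult quot_coeff gram_smooth) auto

lemma quot_herm_eq:
  assumes "w \<in> D" "\<alpha> \<in> J" "\<beta> \<in> J"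
  shows "quot_herm (hmet w) (sub w k) (quot_frame \<alpha> (P w)) (quot_frame \<beta> (P w)) = quot_gram \<alpha> \<beta> w"
  unfolding quot_herm_def quot_frame_P[OF assms(1)]
  using assms by (simp add: orth_rep_quot_frame(1) quot_gram_rep)

lemma origin_D: "origin I \<in> D" and base_origin: "base_coords {1..n} (origin I) = z x\<^sub>0"
proof -
  show b: "base_coords {1..n} (origin I) = z x\<^sub>0"
  proof
    have "Inl j \<in> I" if "j \<in> {1..n}" for j using that Inl_subset by blast
    then show "base_coords {1..n} (origin I) j = z x\<^sub>0 j" for j
      unfolding z_x0 by (auto simp: base_coords_def origin_def simp del: One_nat_def)
  qed
  then show "origin I \<in> D" unfolding D_eq using x0_mem origin_mem[of I] by simp
qed

lemma pt_origin: "pt (origin I) = x\<^sub>0"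
  unfolding pt_def base_origin using chart_props(2) x0_mem by (rule inv_into_f_f)

definition off :: "(nat + nat \<times> nat \<Rightarrow> complex) \<Rightarrow> nat \<Rightarrow> nat \<Rightarrow> complex" where
  "off w \<gamma> \<alpha> = eps_off r m \<rho> (\<lambda>p. w (Inr p)) \<gamma> \<alpha>"

lemma off_eq: "off w \<gamma> \<alpha> = (if (\<gamma>, \<alpha>) \<in> admissible r m \<rho> then w (Inr (\<gamma>, \<alpha>)) else 0)"
  by (simp add: off_def eps_off_def)

lemma off_bigO: "(\<lambda>w. off w \<gamma> \<alpha>) \<in> bigO_pow I 1"
proof (cases "(\<gamma>, \<alpha>) \<in> admissible r m \<rho>")
  case True
  then show ?thesis using bigO_pow_coord[OF finite_I Inr_mem[OF True]] by (simp add: off_eq)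
qed (simp add: off_eq)

lemma off_lin: "lin_form I (\<lambda>w. off w \<gamma> \<alpha>)"
  using lin_form_coord[OF finite_I Inr_mem] lin_form_zero by (cases "(\<gamma>, \<alpha>) \<in> admissible r m \<rho>") (simp_all add: off_eq)

lemma off_antilin: "antilin_form I (\<lambda>w. cnj (off w \<gamma> \<alpha>))"
  using antilin_form_coord[OF finite_I Inr_mem] antilin_form_zero
  by (cases "(\<gamma>, \<alpha>) \<in> admissible r m \<rho>") (simp_all add: off_eq)

lemma off_sesq: "sesq_form I (\<lambda>u v. off u \<gamma> \<alpha> * cnj (off v \<delta> \<beta>))"
  using sesq_form_coord[OF finite_I Inr_mem Inr_mem] sesq_form_zero
  by (cases "(\<gamma>, \<alpha>) \<in> admissible r m \<rho>"; cases "(\<delta>, \<beta>) \<in> admissible r m \<rho>") (simp_all add: off_eq)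

definition base_sesq :: "nat \<Rightarrow> nat \<Rightarrow> (nat + nat \<times> nat \<Rightarrow> complex) \<Rightarrow> (nat + nat \<times> nat \<Rightarrow> complex) \<Rightarrow> complex" where
  "base_sesq \<alpha> \<beta> u v = (\<Sum>i\<in>{1..n}. \<Sum>j\<in>{1..n}. c i j \<alpha> \<beta> * (u (Inl i) * cnj (v (Inl j))))"

lemma base_sesq_form: "sesq_form I (base_sesq \<alpha> \<beta>)"
proof -
  have eq: "base_sesq \<alpha> \<beta> = (\<lambda>u v. \<Sum>i\<in>{1..n}. \<Sum>j\<in>{1..n}. c i j \<alpha> \<beta> * (u (Inl i) * cnj (v (Inl j))))"
    by (simp add: base_sesq_def fun_eq_iff)
  show ?thesis
    unfolding eq by (intro sesq_form_sum sesq_form_cmult sesq_form_coord finite_I) (use Inl_subset in blast)+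
qed

definition "\<delta> \<alpha> \<beta> = (if \<alpha> = (\<beta>::nat) then 1 else (0::complex))"

text \<open>The Euclidean length of the base coordinates is at most \<open>nrm I w\<close>, which
  also counts the fibre coordinates; thus the normal frame estimate becomes a Landau bound in all
  coordinates.\<close>

lemma base_gram_jet:
  assumes "\<alpha> \<in> {1..r}" "\<beta> \<in> {1..r}"
  shows "(\<lambda>w. base_gram \<alpha> \<beta> w - (\<delta> \<alpha> \<beta> - base_sesq \<alpha> \<beta> w w)) \<in> bigO_pow I 3"
proof -
  let ?L = "\<lambda>x. L2_set (\<lambda>j. norm (z x j)) {1..n}"
  obtain C \<epsilon> where \<epsilon>: "\<epsilon> > 0" and C: "\<And>x. x \<in> U \<Longrightarrow> ?L x < \<epsilon> \<Longrightarrow>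
      norm (herm E x (e \<alpha> x) (e \<beta> x) - (\<delta> \<alpha> \<beta> - (\<Sum>j\<in>{1..n}. \<Sum>k\<in>{1..n}. c j k \<alpha> \<beta> * z x j * cnj (z x k)))) \<le> C * ?L x ^ 3"
    using normal assms unfolding normal_frame_def idx \<delta>_def fst_conv snd_conv by blast
  have le: "?L (pt w) \<le> nrm I w" if "w \<in> D" for w
  proof -
    have "?L (pt w) \<le> (\<Sum>j\<in>{1..n}. norm (z (pt w) j))" by (rule L2_set_le_sum) simp
    also have "\<dots> = (\<Sum>j\<in>{1..n}. norm (w (Inl j)))"
      unfolding pt_mem(2)[OF that] by (intro sum.cong) (auto simp: base_coords_def)
    also have "\<dots> = (\<Sum>i\<in>Inl ` {1..n}. norm (w i))" by (subst sum.reindex) (auto simp: inj_on_def)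
    also have "\<dots> \<le> nrm I w" unfolding nrm_def using Inl_subset finite_I by (intro sum_mono2) auto
    finally show ?thesis .
  qed
  have "eventually (\<lambda>w. norm (complex_of_real (nrm I w)) < \<epsilon>) (at_origin I)"
    using tendsto_nrm[OF finite_I origin_D] \<epsilon> by (auto simp: tendsto_iff dist_norm)
  with eventually_domain[OF origin_D]
  have "eventually (\<lambda>w. norm (base_gram \<alpha> \<beta> w - (\<delta> \<alpha> \<beta> - base_sesq \<alpha> \<beta> w w)) \<le> \<bar>C\<bar> * norm (complex_of_real (nrm I w) ^ 3)) (at_origin I)"
  proof eventually_elim
    case (elim w)
    have x: "pt w \<in> U" using elim by (intro pt_mem)
    have L: "?L (pt w) < \<epsilon>" using le[of w] elim by (simp add: nrm_nonneg)
    have s: "(\<Sum>j\<in>{1..n}. \<Sum>k\<in>{1..n}. c j k \<alpha> \<beta> * z (pt w) j * cnj (z (pt w) k)) = base_sesq \<alpha> \<beta> w w"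
      unfolding base_sesq_def pt_mem(2)[OF elim(1)] by (intro sum.cong) (auto simp: base_coords_def mult.assoc)
    have "norm (base_gram \<alpha> \<beta> w - (\<delta> \<alpha> \<beta> - base_sesq \<alpha> \<beta> w w)) \<le> C * ?L (pt w) ^ 3"
      using C[OF x L] unfolding s base_gram_def hmet_def frame_def .
    \<comment> \<open>\<open>C\<close> may be negative, and monotonicity in the norm requires a
      nonnegative factor.\<close>
    also have "\<dots> \<le> \<bar>C\<bar> * nrm I w ^ 3"
      using le[OF elim(1)] by (intro mult_mono power_mono) (auto simp: L2_set_nonneg)
    finally show ?case by (simp add: norm_power nrm_nonneg)
  qed
  then show ?thesis by (rule bigoI)
qed

lemma base_sesq_bigO: "(\<lambda>w. base_sesq \<alpha> \<beta> w w) \<in> bigO_pow I 2"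
proof -
  have "(\<lambda>w. w (Inl i) * cnj (w (Inl j))) \<in> bigO_pow I (1 + 1)" if "i \<in> {1..n}" "j \<in> {1..n}" for i j
    using that Inl_subset by (intro bigO_pow_mult bigO_pow_cnj bigO_pow_coord finite_I) auto
  then show ?thesis
    unfolding base_sesq_def
    by (intro big_sum_in_bigo landau_o.big.cmult_in_iff'[THEN iffD2])
      (auto simp: numeral_2_eq_2 intro: landau_o.big.cmult_in_iff[THEN iffD2])
qed

lemma base_gram_bigO:
  assumes "\<alpha> \<in> {1..r}" "\<beta> \<in> {1..r}"
  shows "(\<lambda>w. base_gram \<alpha> \<beta> w - \<delta> \<alpha> \<beta>) \<in> bigO_pow I 2"
proof -
  have "(\<lambda>w. base_gram \<alpha> \<beta> w - (\<delta> \<alpha> \<beta> - base_sesq \<alpha> \<beta> w w)) \<in> bigO_pow I 2"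
    using base_gram_jet[OF assms] bigO_pow_mono[OF finite_I origin_D, of 2 3] by auto
  from sum_in_bigo(2)[OF this base_sesq_bigO[of \<alpha> \<beta>]] show ?thesis by (simp add: algebra_simps)
qed

text \<open>The quadratic part with its two arguments kept apart: the jet uses the diagonal
  \<open>u = v = w\<close>, the curvature the values at different tangent vectors.\<close>

definition "gram_sesq \<alpha> \<beta> u v = (\<Sum>\<gamma>\<in>{1..r}. off u \<gamma> \<alpha> * cnj (off v \<gamma> \<beta>)) - base_sesq \<alpha> \<beta> u v"

text \<open>In the expansion by the number of \<open>off\<close> factors, replacing
  \<open>base_gram\<close> by \<open>\<delta>\<close> costs order 2. Together with at least one
  \<open>off\<close> factor the error has order 3; only the term without \<open>off\<close> uses the
  full jet of the normal frame.\<close>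

lemma gram_jet:
  assumes \<alpha>: "\<alpha> \<in> {1..r}" and \<beta>: "\<beta> \<in> {1..r}"
  shows "(\<lambda>w. gram \<alpha> \<beta> w - (\<delta> \<alpha> \<beta> + off w \<beta> \<alpha> + cnj (off w \<alpha> \<beta>) + gram_sesq \<alpha> \<beta> w w)) \<in> bigO_pow I 3"
proof -
  let ?R = "{1..r}"
  let ?d = "\<lambda>\<gamma> \<delta>' w. base_gram \<gamma> \<delta>' w - \<delta> \<gamma> \<delta>'"
  have delta: "(\<Sum>\<gamma>\<in>?R. \<delta> \<gamma> \<alpha>' * f \<gamma>) = f \<alpha>'" "(\<Sum>\<gamma>\<in>?R. \<delta> \<alpha>' \<gamma> * f \<gamma>) = f \<alpha>'"
    "(\<Sum>\<gamma>\<in>?R. f \<gamma> * \<delta> \<gamma> \<alpha>') = f \<alpha>'" "(\<Sum>\<gamma>\<in>?R. f \<gamma> * \<delta> \<alpha>' \<gamma>) = f \<alpha>'"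
    if "\<alpha>' \<in> ?R" for f \<alpha>'
    using that by (simp_all add: \<delta>_def if_distrib[of "\<lambda>x. x * _"] if_distrib[of "\<lambda>x. _ * x"] cong: if_cong)
  have eq: "gram \<alpha> \<beta> w = base_gram \<alpha> \<beta> w + (\<Sum>\<gamma>\<in>?R. off w \<gamma> \<alpha> * base_gram \<gamma> \<beta> w)
      + (\<Sum>\<epsilon>\<in>?R. cnj (off w \<epsilon> \<beta>) * base_gram \<alpha> \<epsilon> w)
      + (\<Sum>\<gamma>\<in>?R. \<Sum>\<epsilon>\<in>?R. off w \<gamma> \<alpha> * (cnj (off w \<epsilon> \<beta>) * base_gram \<gamma> \<epsilon> w))" if w: "w \<in> D" for w
  proof -
    have co: "eps_coeff r m \<rho> (\<lambda>p. w (Inr p)) \<alpha>' \<gamma> = \<delta> \<gamma> \<alpha>' + off w \<gamma> \<alpha>'" for \<alpha>' \<gamma>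
      by (simp add: eps_coeff_def off_def \<delta>_def)
    have cd: "cnj (\<delta> \<gamma> \<alpha>' + x) = \<delta> \<gamma> \<alpha>' + cnj x" for \<gamma> \<alpha>' x by (simp add: \<delta>_def)
    have "gram \<alpha> \<beta> w = (\<Sum>\<gamma>\<in>?R. (\<delta> \<gamma> \<alpha> + off w \<gamma> \<alpha>) * (\<Sum>\<epsilon>\<in>?R. (\<delta> \<epsilon> \<beta> + cnj (off w \<epsilon> \<beta>)) * base_gram \<gamma> \<epsilon> w))"
      unfolding gram_eq[OF w \<alpha> \<beta>] co cd sum_distrib_left ..
    also have "\<dots> = (\<Sum>\<gamma>\<in>?R. (\<delta> \<gamma> \<alpha> + off w \<gamma> \<alpha>) * (base_gram \<gamma> \<beta> w + (\<Sum>\<epsilon>\<in>?R. cnj (off w \<epsilon> \<beta>) * base_gram \<gamma> \<epsilon> w)))"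
      unfolding distrib_right sum.distrib delta(1)[OF \<beta>] ..
    also have "\<dots> = base_gram \<alpha> \<beta> w + (\<Sum>\<epsilon>\<in>?R. cnj (off w \<epsilon> \<beta>) * base_gram \<alpha> \<epsilon> w)
       + (\<Sum>\<gamma>\<in>?R. off w \<gamma> \<alpha> * (base_gram \<gamma> \<beta> w + (\<Sum>\<epsilon>\<in>?R. cnj (off w \<epsilon> \<beta>) * base_gram \<gamma> \<epsilon> w)))"
      unfolding distrib_right sum.distrib delta(1)[OF \<alpha>] ..
    finally show ?thesis
      unfolding distrib_left sum.distrib sum_distrib_left by (simp add: add_ac)
  qed
  have exp: "gram \<alpha> \<beta> w - (\<delta> \<alpha> \<beta> + off w \<beta> \<alpha> + cnj (off w \<alpha> \<beta>) + gram_sesq \<alpha> \<beta> w w)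
     = (base_gram \<alpha> \<beta> w - (\<delta> \<alpha> \<beta> - base_sesq \<alpha> \<beta> w w))
      + (\<Sum>\<gamma>\<in>?R. off w \<gamma> \<alpha> * ?d \<gamma> \<beta> w) + (\<Sum>\<epsilon>\<in>?R. cnj (off w \<epsilon> \<beta>) * ?d \<alpha> \<epsilon> w)
      + (\<Sum>\<gamma>\<in>?R. \<Sum>\<epsilon>\<in>?R. off w \<gamma> \<alpha> * (cnj (off w \<epsilon> \<beta>) * ?d \<gamma> \<epsilon> w))" if w: "w \<in> D" for w
  proof -
    have 1: "(\<Sum>\<gamma>\<in>?R. off w \<gamma> \<alpha> * ?d \<gamma> \<beta> w) = (\<Sum>\<gamma>\<in>?R. off w \<gamma> \<alpha> * base_gram \<gamma> \<beta> w) - off w \<beta> \<alpha>"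
      unfolding right_diff_distrib sum_subtractf delta(3)[OF \<beta>] ..
    have 2: "(\<Sum>\<epsilon>\<in>?R. cnj (off w \<epsilon> \<beta>) * ?d \<alpha> \<epsilon> w) = (\<Sum>\<epsilon>\<in>?R. cnj (off w \<epsilon> \<beta>) * base_gram \<alpha> \<epsilon> w) - cnj (off w \<alpha> \<beta>)"
      unfolding right_diff_distrib sum_subtractf delta(4)[OF \<alpha>] ..
    have "(\<Sum>\<epsilon>\<in>?R. off w \<gamma> \<alpha> * (cnj (off w \<epsilon> \<beta>) * ?d \<gamma> \<epsilon> w))
       = (\<Sum>\<epsilon>\<in>?R. off w \<gamma> \<alpha> * (cnj (off w \<epsilon> \<beta>) * base_gram \<gamma> \<epsilon> w)) - off w \<gamma> \<alpha> * cnj (off w \<gamma> \<beta>)" if "\<gamma> \<in> ?R" for \<gamma>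
      unfolding sum_distrib_left[symmetric] right_diff_distrib sum_subtractf delta(4)[OF that] ..
    then have 3: "(\<Sum>\<gamma>\<in>?R. \<Sum>\<epsilon>\<in>?R. off w \<gamma> \<alpha> * (cnj (off w \<epsilon> \<beta>) * ?d \<gamma> \<epsilon> w))
       = (\<Sum>\<gamma>\<in>?R. \<Sum>\<epsilon>\<in>?R. off w \<gamma> \<alpha> * (cnj (off w \<epsilon> \<beta>) * base_gram \<gamma> \<epsilon> w)) - (\<Sum>\<gamma>\<in>?R. off w \<gamma> \<alpha> * cnj (off w \<gamma> \<beta>))"
      unfolding sum_subtractf[symmetric] by (rule sum.cong[OF refl])
    show ?thesis unfolding 1 2 3 eq[OF w] gram_sesq_def by simp
  qed
  have O1: "(\<lambda>w. off w \<gamma> \<alpha> * ?d \<gamma> \<beta> w) \<in> bigO_pow I (1 + 2)" if "\<gamma> \<in> ?R" for \<gamma>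
    using that \<beta> by (intro bigO_pow_mult off_bigO base_gram_bigO)
  have O2: "(\<lambda>w. cnj (off w \<epsilon> \<beta>) * ?d \<alpha> \<epsilon> w) \<in> bigO_pow I (1 + 2)" if "\<epsilon> \<in> ?R" for \<epsilon>
    using that \<alpha> by (intro bigO_pow_mult bigO_pow_cnj off_bigO base_gram_bigO)
  have O3: "(\<lambda>w. off w \<gamma> \<alpha> * (cnj (off w \<epsilon> \<beta>) * ?d \<gamma> \<epsilon> w)) \<in> bigO_pow I 3" if "\<gamma> \<in> ?R" "\<epsilon> \<in> ?R" for \<gamma> \<epsilon>
  proof -
    have "(\<lambda>w. off w \<gamma> \<alpha> * (cnj (off w \<epsilon> \<beta>) * ?d \<gamma> \<epsilon> w)) \<in> bigO_pow I (1 + (1 + 2))"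
      using that by (intro bigO_pow_mult bigO_pow_cnj off_bigO base_gram_bigO)
    then show ?thesis using bigO_pow_mono[OF finite_I origin_D, of 3 "1 + (1 + 2)"] by auto
  qed
  have "(\<lambda>w. (base_gram \<alpha> \<beta> w - (\<delta> \<alpha> \<beta> - base_sesq \<alpha> \<beta> w w))
      + (\<Sum>\<gamma>\<in>?R. off w \<gamma> \<alpha> * ?d \<gamma> \<beta> w) + (\<Sum>\<epsilon>\<in>?R. cnj (off w \<epsilon> \<beta>) * ?d \<alpha> \<epsilon> w)
      + (\<Sum>\<gamma>\<in>?R. \<Sum>\<epsilon>\<in>?R. off w \<gamma> \<alpha> * (cnj (off w \<epsilon> \<beta>) * ?d \<gamma> \<epsilon> w))) \<in> bigO_pow I 3"
    by (intro sum_in_bigo(1) big_sum_in_bigo base_gram_jet[OF \<alpha> \<beta>] O3)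
      (use O1 O2 in \<open>simp_all add: numeral_3_eq_3\<close>)
  then show ?thesis
    by (subst landau_o.big.in_cong[OF eventually_mono[OF eventually_domain[OF origin_D] exp]])
qed

end

text \<open>Linear combinations and dual bases over \<open>J\<close> see only the values on
  \<open>J\<close>, while frames and curvature matrices are identified for these indices
  alone.\<close>

lemma (in complex_module) end_form_cong:
  assumes b: "b \<in> J \<rightarrow> carrier V" and eq: "\<And>\<alpha>. \<alpha> \<in> J \<Longrightarrow> b \<alpha> = b' \<alpha>"
    and \<omega>: "\<And>\<alpha> \<beta> u v. \<alpha> \<in> J \<Longrightarrow> \<beta> \<in> J \<Longrightarrow> \<omega> \<beta> \<alpha> u v = \<omega>' \<beta> \<alpha> u v"
  shows "end_form V J b \<omega> = end_form V J b' \<omega>'"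
proof -
  have lc: "lincomb V J c b' = lincomb V J d b" if "\<And>\<alpha>. \<alpha> \<in> J \<Longrightarrow> c \<alpha> = d \<alpha>" for c d
    using b eq that by (intro lincomb_cong) auto
  have "dual_basis V J b = dual_basis V J b'"
    unfolding dual_basis_def[abs_def] using lc by simp
  then show ?thesis
    unfolding end_form_def using \<omega> by (intro ext restrict_ext lc[symmetric] sum.cong) simp_all
qed

context flag_frame
begin

lemma gram_sesq_bigO: "(\<lambda>w. gram_sesq \<alpha> \<beta> w w) \<in> bigO_pow I 2"
proof -
  have "(\<lambda>w. off w \<gamma> \<alpha> * cnj (off w \<gamma> \<beta>)) \<in> bigO_pow I 2" for \<gamma>
    using bigO_pow_mult[OF off_bigO bigO_pow_cnj[OF off_bigO]] by (simp add: numeral_2_eq_2)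
  then show ?thesis
    unfolding gram_sesq_def by (intro sum_in_bigo(2) big_sum_in_bigo base_sesq_bigO)
qed

lemma gram_bigO_2:
  assumes "\<alpha> \<in> {1..r}" "\<beta> \<in> {1..r}"
  shows "(\<lambda>w. gram \<alpha> \<beta> w - (\<delta> \<alpha> \<beta> + off w \<beta> \<alpha> + cnj (off w \<alpha> \<beta>))) \<in> bigO_pow I 2"
proof -
  have "(\<lambda>w. gram \<alpha> \<beta> w - (\<delta> \<alpha> \<beta> + off w \<beta> \<alpha> + cnj (off w \<alpha> \<beta>) + gram_sesq \<alpha> \<beta> w w)) \<in> bigO_pow I 2"
    using gram_jet[OF assms] bigO_pow_mono[OF finite_I origin_D, of 2 3] by auto
  from sum_in_bigo(1)[OF this gram_sesq_bigO[of \<alpha> \<beta>]] show ?thesis by (simp add: algebra_simps)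
qed

lemma gram_bigO_1:
  assumes "\<alpha> \<in> {1..r}" "\<beta> \<in> {1..r}"
  shows "(\<lambda>w. gram \<alpha> \<beta> w - \<delta> \<alpha> \<beta>) \<in> bigO_pow I 1"
proof -
  have "(\<lambda>w. gram \<alpha> \<beta> w - (\<delta> \<alpha> \<beta> + off w \<beta> \<alpha> + cnj (off w \<alpha> \<beta>))) \<in> bigO_pow I 1"
    using gram_bigO_2[OF assms] bigO_pow_mono[OF finite_I origin_D, of 1 2] by auto
  from sum_in_bigo(1)[OF this sum_in_bigo(1)[OF off_bigO[of \<beta> \<alpha>] bigO_pow_cnj[OF off_bigO[of \<alpha> \<beta>]]]]
  show ?thesis by (simp add: algebra_simps)
qed

text \<open>Here \<open>\<mu> > \<alpha>\<close>, whereas the first index of an admissible pair is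
  the smaller one. Hence the mixed Gram entries carry a single linear term.\<close>

lemma off_KJ: "\<mu> \<in> K \<Longrightarrow> \<alpha> \<in> J \<Longrightarrow> off w \<mu> \<alpha> = 0"
  by (auto simp: off_eq K_def J_def dest: admissible_bounds)

lemma gram_JK:
  assumes "\<alpha> \<in> J" "\<mu> \<in> K"
  shows "(\<lambda>w. gram \<alpha> \<mu> w - cnj (off w \<alpha> \<mu>)) \<in> bigO_pow I 2" "(\<lambda>w. gram \<mu> \<alpha> w - off w \<alpha> \<mu>) \<in> bigO_pow I 2"
    "gram \<alpha> \<mu> \<in> bigO_pow I 1" "gram \<mu> \<alpha> \<in> bigO_pow I 1"
proof -
  have r: "\<alpha> \<in> {1..r}" "\<mu> \<in> {1..r}" using assms JK_subset by auto
  have d: "\<delta> \<alpha> \<mu> = 0" "\<delta> \<mu> \<alpha> = 0" using assms JK(2) by (auto simp: \<delta>_def)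
  show "(\<lambda>w. gram \<alpha> \<mu> w - cnj (off w \<alpha> \<mu>)) \<in> bigO_pow I 2"
    using gram_bigO_2[OF r] off_KJ[OF assms(2,1)] by (simp add: d)
  show "(\<lambda>w. gram \<mu> \<alpha> w - off w \<alpha> \<mu>) \<in> bigO_pow I 2"
    using gram_bigO_2[OF r(2,1)] off_KJ[OF assms(2,1)] by (simp add: d)
  show "gram \<alpha> \<mu> \<in> bigO_pow I 1" using gram_bigO_1[OF r] by (simp add: d)
  show "gram \<mu> \<alpha> \<in> bigO_pow I 1" using gram_bigO_1[OF r(2,1)] by (simp add: d)
qed

text \<open>Bootstrapping: the normal equations express \<open>quot_coeff\<close> as
  \<open>gram\<close> minus \<open>quot_coeff\<close> times a factor of order 1. Boundedness, from
  continuity, improves to order 1, and a second pass gives the linear term up to order 2.\<close>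

lemma quot_coeff_bigO:
  assumes \<alpha>: "\<alpha> \<in> J" and \<nu>: "\<nu> \<in> K"
  shows "(\<lambda>w. quot_coeff \<alpha> \<nu> w - cnj (off w \<alpha> \<nu>)) \<in> bigO_pow I 2"
proof -
  let ?err = "\<lambda>\<nu> w. \<Sum>\<mu>\<in>K. quot_coeff \<alpha> \<mu> w * (gram \<mu> \<nu> w - \<delta> \<mu> \<nu>)"
  have eq: "quot_coeff \<alpha> \<nu> w = gram \<alpha> \<nu> w - ?err \<nu> w" if "w \<in> D" "\<nu> \<in> K" for w \<nu>
  proof -
    have "(\<Sum>\<mu>\<in>K. quot_coeff \<alpha> \<mu> w * \<delta> \<mu> \<nu>) = quot_coeff \<alpha> \<nu> w"
      using that finite_JK by (simp add: \<delta>_def if_distrib[of "\<lambda>x. _ * x"] cong: if_cong)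
    then show ?thesis
      using quot_coeff(2)[OF \<alpha> that] by (simp add: right_diff_distrib sum_subtractf)
  qed
  have g: "(\<lambda>w. gram \<mu> \<nu> w - \<delta> \<mu> \<nu>) \<in> bigO_pow I 1" if "\<mu> \<in> K" "\<nu> \<in> K" for \<mu> \<nu>
    using that JK_subset by (intro gram_bigO_1) auto
  have q0: "quot_coeff \<alpha> \<mu> \<in> bigO_pow I 0" if "\<mu> \<in> K" for \<mu>
    using quot_coeff(1)[OF \<alpha> that] by (rule smooth_bigO_0[OF origin_D])
  have q1: "quot_coeff \<alpha> \<mu> \<in> bigO_pow I 1" if \<mu>: "\<mu> \<in> K" for \<mu>
  proof -
    have "(\<lambda>w. gram \<alpha> \<mu> w - ?err \<mu> w) \<in> bigO_pow I 1"
      using bigO_pow_mult[OF q0 g] \<mu> by (intro sum_in_bigo(2) big_sum_in_bigo gram_JK(3)[OF \<alpha> \<mu>]) simp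
    then show ?thesis
      by (subst landau_o.big.in_cong[OF eventually_mono[OF eventually_domain[OF origin_D] eq[OF _ \<mu>]]])
  qed
  have "(\<lambda>w. (gram \<alpha> \<nu> w - cnj (off w \<alpha> \<nu>)) - ?err \<nu> w) \<in> bigO_pow I 2"
    using bigO_pow_mult[OF q1 g] \<nu> by (intro sum_in_bigo(2) big_sum_in_bigo gram_JK(1)[OF \<alpha> \<nu>]) (simp add: numeral_2_eq_2)
  moreover have "quot_coeff \<alpha> \<nu> w - cnj (off w \<alpha> \<nu>) = (gram \<alpha> \<nu> w - cnj (off w \<alpha> \<nu>)) - ?err \<nu> w" if "w \<in> D" for w
    using eq[OF that \<nu>] by simp
  ultimately show ?thesis
    by (subst landau_o.big.in_cong[OF eventually_mono[OF eventually_domain[OF origin_D]]])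
qed

definition "quot_sesq \<alpha> \<beta> u v = gram_sesq \<alpha> \<beta> u v - (\<Sum>\<mu>\<in>K. off u \<beta> \<mu> * cnj (off v \<alpha> \<mu>))"

lemma quot_sesq_form: "sesq_form I (quot_sesq \<alpha> \<beta>)"
proof -
  have "quot_sesq \<alpha> \<beta> = (\<lambda>u v. ((\<Sum>\<gamma>\<in>{1..r}. off u \<gamma> \<alpha> * cnj (off v \<gamma> \<beta>)) - base_sesq \<alpha> \<beta> u v)
      - (\<Sum>\<mu>\<in>K. off u \<beta> \<mu> * cnj (off v \<alpha> \<mu>)))"
    by (simp add: quot_sesq_def gram_sesq_def fun_eq_iff)
  then show ?thesis
    by (simp only:) (intro sesq_form_diff sesq_form_sum off_sesq base_sesq_form)
qed

text \<open>
  The frame is not normal: the linear terms of its Gram matrix account for the part of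
  \<open>quot_sesq\<close> that is indexed by \<open>J\<close>, and these two contributions cancel in the curvature.
\<close>

lemma quot_gram_jet:
  assumes \<alpha>: "\<alpha> \<in> J" and \<beta>: "\<beta> \<in> J"
  shows "(\<lambda>w. quot_gram \<alpha> \<beta> w - (\<delta> \<alpha> \<beta> + off w \<beta> \<alpha> + cnj (off w \<alpha> \<beta>) + quot_sesq \<alpha> \<beta> w w)) \<in> bigO_pow I 3"
proof -
  have r: "\<alpha> \<in> {1..r}" "\<beta> \<in> {1..r}" using \<alpha> \<beta> JK_subset by auto
  \<comment> \<open>The difference of two products, split so that each summand has one factor of
    order 2 and one of order 1.\<close>
  have O: "(\<lambda>w. (quot_coeff \<alpha> \<mu> w - cnj (off w \<alpha> \<mu>)) * gram \<mu> \<beta> w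
      + cnj (off w \<alpha> \<mu>) * (gram \<mu> \<beta> w - off w \<beta> \<mu>)) \<in> bigO_pow I 3" if \<mu>: "\<mu> \<in> K" for \<mu>
    using bigO_pow_mult[OF quot_coeff_bigO[OF \<alpha> \<mu>] gram_JK(4)[OF \<beta> \<mu>]]
      bigO_pow_mult[OF bigO_pow_cnj[OF off_bigO] gram_JK(2)[OF \<beta> \<mu>]]
    by (intro sum_in_bigo(1)) (simp_all add: numeral_3_eq_3 numeral_2_eq_2)
  have "(\<lambda>w. (gram \<alpha> \<beta> w - (\<delta> \<alpha> \<beta> + off w \<beta> \<alpha> + cnj (off w \<alpha> \<beta>) + gram_sesq \<alpha> \<beta> w w))
     - (\<Sum>\<mu>\<in>K. (quot_coeff \<alpha> \<mu> w - cnj (off w \<alpha> \<mu>)) * gram \<mu> \<beta> w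
      + cnj (off w \<alpha> \<mu>) * (gram \<mu> \<beta> w - off w \<beta> \<mu>))) \<in> bigO_pow I 3"
    by (intro sum_in_bigo(2) big_sum_in_bigo gram_jet[OF r] O)
  moreover have "(\<Sum>\<mu>\<in>K. (quot_coeff \<alpha> \<mu> w - cnj (off w \<alpha> \<mu>)) * gram \<mu> \<beta> w
      + cnj (off w \<alpha> \<mu>) * (gram \<mu> \<beta> w - off w \<beta> \<mu>))
     = (\<Sum>\<mu>\<in>K. quot_coeff \<alpha> \<mu> w * gram \<mu> \<beta> w) - (\<Sum>\<mu>\<in>K. off w \<beta> \<mu> * cnj (off w \<alpha> \<mu>))" for w
    unfolding sum_subtractf[symmetric] by (intro sum.cong refl) (simp add: algebra_simps)
  moreover have "quot_gram \<alpha> \<beta> w - (\<delta> \<alpha> \<beta> + off w \<beta> \<alpha> + cnj (off w \<alpha> \<beta>) + quot_sesq \<alpha> \<beta> w w)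
     = (gram \<alpha> \<beta> w - (\<delta> \<alpha> \<beta> + off w \<beta> \<alpha> + cnj (off w \<alpha> \<beta>) + gram_sesq \<alpha> \<beta> w w))
      - ((\<Sum>\<mu>\<in>K. quot_coeff \<alpha> \<mu> w * gram \<mu> \<beta> w) - (\<Sum>\<mu>\<in>K. off w \<beta> \<mu> * cnj (off w \<alpha> \<mu>)))" for w
    by (simp add: quot_gram_def quot_sesq_def)
  ultimately show ?thesis by (simp only:)
qed

section \<open>The curvature at the origin of the chart\<close>

definition "curv_form \<beta> \<alpha> u v = base_curv n Inl c \<beta> \<alpha> u v
      - (\<Sum>\<nu>\<in>{1..r - \<rho> l}. wedge (d_coord (Inr (\<nu>, \<alpha>))) (d_coord_bar (Inr (\<nu>, \<beta>))) u v)
      + (\<Sum>\<mu>\<in>{r - \<rho> k<..r}. wedge (d_coord (Inr (\<beta>, \<mu>))) (d_coord_bar (Inr (\<alpha>, \<mu>))) u v)"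

text \<open>Antisymmetrising yields wedges with \<open>u\<close> and \<open>v\<close> exchanged,
  which fixes the signs. In the sum over \<open>{1..r}\<close> the \<open>K\<close>-part vanishes by
  \<open>off_KJ\<close>, the \<open>J\<close>-part is cancelled by the products of linear terms, and
  the indices up to \<open>r - \<rho> l\<close> remain.\<close>

lemma curvature_terms:
  assumes \<alpha>: "\<alpha> \<in> J" and \<beta>: "\<beta> \<in> J"
  shows "quot_sesq \<alpha> \<beta> v u - quot_sesq \<alpha> \<beta> u v
      - (\<Sum>\<gamma>\<in>J. off v \<gamma> \<alpha> * cnj (off u \<gamma> \<beta>) - off u \<gamma> \<alpha> * cnj (off v \<gamma> \<beta>))
    = curv_form \<beta> \<alpha> u v"
proof -
  define T where "T = (\<lambda>\<gamma> u v. off u \<gamma> \<alpha> * cnj (off v \<gamma> \<beta>))"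
  have dec: "{1..r} = {1..r - \<rho> l} \<union> (J \<union> K)" "{1..r - \<rho> l} \<inter> (J \<union> K) = {}"
    unfolding JK(1) by auto
  have TK: "T \<gamma> u v = 0" if "\<gamma> \<in> K" for \<gamma> u v using off_KJ[OF that \<alpha>] by (simp add: T_def)
  have split: "(\<Sum>\<gamma>\<in>{1..r}. T \<gamma> u v) = (\<Sum>\<gamma>\<in>{1..r - \<rho> l}. T \<gamma> u v) + (\<Sum>\<gamma>\<in>J. T \<gamma> u v)" for u v
  proof -
    have "(\<Sum>\<gamma>\<in>{1..r}. T \<gamma> u v) = (\<Sum>\<gamma>\<in>{1..r - \<rho> l}. T \<gamma> u v) + (\<Sum>\<gamma>\<in>J \<union> K. T \<gamma> u v)"
      unfolding dec(1) using dec(2) finite_JK by (intro sum.union_disjoint) auto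
    also have "(\<Sum>\<gamma>\<in>J \<union> K. T \<gamma> u v) = (\<Sum>\<gamma>\<in>J. T \<gamma> u v) + (\<Sum>\<gamma>\<in>K. T \<gamma> u v)"
      using JK(2) finite_JK by (intro sum.union_disjoint) auto
    finally show ?thesis using TK by simp
  qed
  \<comment> \<open>For \<open>l = m\<close> the range of \<open>\<nu>\<close> is empty; otherwise
    the step \<open>l\<close> witnesses admissibility.\<close>
  have adm1: "(\<nu>, \<alpha>') \<in> admissible r m \<rho>" if "\<nu> \<in> {1..r - \<rho> l}" "\<alpha>' \<in> J" for \<nu> \<alpha>'
  proof (rule admissibleI)
    show "l < m"
    proof (rule ccontr)
      assume "\<not> l < m"
      then have "\<rho> l = r" using lm dimension_sequenceD(2)[OF dims] by simp
      then show False using that by simp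
    qed
    show "0 < l" using kl by simp
    show "1 \<le> \<nu>" "\<nu> \<le> r - \<rho> l" using that by auto
    show "r - \<rho> l < \<alpha>'" "\<alpha>' \<le> r" using that JK_subset by (auto simp: J_def)
  qed
  \<comment> \<open>For \<open>k = 0\<close> the set \<open>K\<close> is empty; otherwise the step
    \<open>k\<close> witnesses admissibility.\<close>
  have adm2: "(\<alpha>', \<mu>) \<in> admissible r m \<rho>" if "\<mu> \<in> K" "\<alpha>' \<in> J" for \<mu> \<alpha>'
  proof (rule admissibleI)
    show "0 < k"
    proof (rule ccontr)
      assume "\<not> 0 < k"
      then have "\<rho> k = 0" using dimension_sequenceD(1)[OF dims] by simp
      then show False using that by (simp add: K_def)
    qed
    show "k < m" using kl lm by simp
    show "1 \<le> \<alpha>'" "\<alpha>' \<le> r - \<rho> k" "r - \<rho> k < \<mu>" "\<mu> \<le> r" using that by (auto simp: J_def K_def)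
  qed
  have base: "base_sesq \<alpha> \<beta> u v - base_sesq \<alpha> \<beta> v u = base_curv n Inl c \<beta> \<alpha> u v"
    unfolding base_sesq_def base_curv_def wedge_def d_coord_def d_coord_bar_def sum_subtractf[symmetric]
    by (intro sum.cong refl) (simp add: right_diff_distrib)
  have top: "(\<Sum>\<gamma>\<in>{1..r - \<rho> l}. T \<gamma> u v) - (\<Sum>\<gamma>\<in>{1..r - \<rho> l}. T \<gamma> v u)
     = (\<Sum>\<nu>\<in>{1..r - \<rho> l}. wedge (d_coord (Inr (\<nu>, \<alpha>))) (d_coord_bar (Inr (\<nu>, \<beta>))) u v)"
    unfolding wedge_def d_coord_def d_coord_bar_def sum_subtractf[symmetric]
    by (intro sum.cong refl) (simp add: T_def off_eq adm1 \<alpha> \<beta> del: One_nat_def)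
  have bot: "(\<Sum>\<mu>\<in>K. off u \<beta> \<mu> * cnj (off v \<alpha> \<mu>)) - (\<Sum>\<mu>\<in>K. off v \<beta> \<mu> * cnj (off u \<alpha> \<mu>))
     = (\<Sum>\<mu>\<in>{r - \<rho> k<..r}. wedge (d_coord (Inr (\<beta>, \<mu>))) (d_coord_bar (Inr (\<alpha>, \<mu>))) u v)"
    unfolding wedge_def d_coord_def d_coord_bar_def sum_subtractf[symmetric] K_def[symmetric]
    by (intro sum.cong refl) (simp add: off_eq adm2 \<alpha> \<beta>)
  have J: "(\<Sum>\<gamma>\<in>J. off v \<gamma> \<alpha> * cnj (off u \<gamma> \<beta>) - off u \<gamma> \<alpha> * cnj (off v \<gamma> \<beta>))
     = (\<Sum>\<gamma>\<in>J. T \<gamma> v u) - (\<Sum>\<gamma>\<in>J. T \<gamma> u v)"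
    by (simp add: T_def sum_subtractf)
  have S: "quot_sesq \<alpha> \<beta> u v = (\<Sum>\<gamma>\<in>{1..r - \<rho> l}. T \<gamma> u v) + (\<Sum>\<gamma>\<in>J. T \<gamma> u v) - base_sesq \<alpha> \<beta> u v
      - (\<Sum>\<mu>\<in>K. off u \<beta> \<mu> * cnj (off v \<alpha> \<mu>))" for u v
    unfolding split[symmetric] by (simp add: quot_sesq_def gram_sesq_def T_def)
  show ?thesis unfolding curv_form_def S J base[symmetric] top[symmetric] bot[symmetric] by (simp add: algebra_simps)
qed

lemma quot_fibre_module:
  assumes w: "w \<in> D"
  shows "complex_module (quot_module (taut_fib E l (P w)) (snd (P w) k))"
proof -
  interpret hermitian_module "fibre w" "hmet w" by (rule fibre_hermitian[OF w])
  let ?M = "(fibre w)\<lparr>carrier := sub w l\<rparr>"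
  have sl: "submodule (sub w l) complex_ring (fibre w)" by (rule sub_submodule[OF w])
  interpret M: complex_module ?M by (rule complex_module_submodule[OF sl])
  have eK: "ep w \<in> K \<rightarrow> sub w l"
    using lspan_base[of "J \<union> K" "ep w"] finite_JK ep_closed[OF w JK(3)] unfolding sub_def JK(1)[symmetric] by blast
  have "lspan ?M K (ep w) = sub w k"
    using lincomb_submodule[OF sl finite_JK(2) eK] unfolding sub_k lspan_def by simp
  moreover have "submodule (lspan ?M K (ep w)) complex_ring ?M"
    using finite_JK eK by (intro M.submodule_lspan) simp_all
  ultimately show ?thesis
    using M.complex_module_quot by (simp add: taut_fib_P snd_P_k)
qed

lemma P_origin: "P (origin I) = (x\<^sub>0, f\<^sub>0)" and ep_origin: "\<alpha> \<in> {1..r} \<Longrightarrow> ep (origin I) \<alpha> = e \<alpha> x\<^sub>0"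
proof -
  interpret hermitian_module "fibre (origin I)" "hmet (origin I)" by (rule fibre_hermitian[OF origin_D])
  have fr: "frame (origin I) \<alpha> = e \<alpha> x\<^sub>0" for \<alpha> by (simp add: frame_def pt_origin)
  have fc: "frame (origin I) \<in> {1..r} \<rightarrow> carrier (fibre (origin I))" by (rule frame_closed[OF origin_D])
  have ep: "ep (origin I) \<alpha> = frame (origin I) \<alpha>" if \<alpha>: "\<alpha> \<in> {1..r}" for \<alpha>
  proof -
    have "eps_coeff r m \<rho> (\<lambda>p. origin I (Inr p)) \<alpha> = (\<lambda>\<gamma>. if \<gamma> = \<alpha> then 1 else 0)"
      using Inr_mem by (auto simp: eps_coeff_def eps_off_def origin_def fun_eq_iff)
    then have "ep (origin I) \<alpha> = lincomb (fibre (origin I)) {1..r} (\<lambda>\<gamma>. if \<gamma> = \<alpha> then 1 else 0) (frame (origin I))"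
      using ep_lincomb[OF origin_D \<alpha>] by (simp only:)
    then show ?thesis
      using lincomb_single[OF _ \<alpha> fc, of 1] funcset_mem[OF fc \<alpha>] by simp
  qed
  then show "\<alpha> \<in> {1..r} \<Longrightarrow> ep (origin I) \<alpha> = e \<alpha> x\<^sub>0" by (simp add: fr)
  have "sub (origin I) i = f\<^sub>0 i" if "i \<le> m" for i
  proof -
    have "lincomb (fibre (origin I)) {r - \<rho> i<..r} c (ep (origin I)) = lincomb (fibre (origin I)) {r - \<rho> i<..r} c (\<lambda>\<alpha>. e \<alpha> x\<^sub>0)" for c
    proof (rule lincomb_cong)
      have sub: "\<alpha> \<in> {1..r}" if "\<alpha> \<in> {r - \<rho> i<..r}" for \<alpha> using that by auto
      show "ep (origin I) \<alpha> = e \<alpha> x\<^sub>0" if "\<alpha> \<in> {r - \<rho> i<..r}" for \<alpha> using ep[OF sub[OF that]] fr by simp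
      show "(\<lambda>\<alpha>. e \<alpha> x\<^sub>0) \<in> {r - \<rho> i<..r} \<rightarrow> carrier (fibre (origin I))"
        using funcset_mem[OF fc] sub unfolding fr by blast
    qed simp
    then have "sub (origin I) i = lspan (fib E x\<^sub>0) {r - \<rho> i<..r} (\<lambda>\<alpha>. e \<alpha> x\<^sub>0)"
      by (simp add: sub_def lspan_def fibre_def pt_origin)
    then show ?thesis using flag_eq that by simp
  qed
  moreover have "f\<^sub>0 \<in> extensional {..m}" using flag by (simp add: flag_bundle_def)
  ultimately have "(\<lambda>i\<in>{..m}. sub (origin I) i) = f\<^sub>0" by (auto simp: fun_eq_iff extensional_def)
  then show "P (origin I) = (x\<^sub>0, f\<^sub>0)" by (simp add: P_eq pt_origin)
qed

lemma curvature:
  "has_chern_curvature I (flag_chart n r m \<rho> E (U, z) e) (taut_quotient n r m \<rho> X A E l k) (x\<^sub>0, f\<^sub>0)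
     (end_form (fib (taut_quotient n r m \<rho> X A E l k) (x\<^sub>0, f\<^sub>0)) J
       (\<lambda>\<alpha>. f\<^sub>0 k +>\<^bsub>fib E x\<^sub>0\<^esub> e \<alpha> x\<^sub>0)
       curv_form)"
proof -
  let ?B = "taut_quotient n r m \<rho> X A E l k"
  \<comment> \<open>Written exactly as \<open>has_chern_curvature\<close> prescribes. It agrees with
    \<open>quot_gram\<close> on \<open>D\<close> only, so smoothness, symmetry and the jet are
    transferred locally.\<close>
  define H where "H = (\<lambda>\<alpha> \<beta> w. let y = inv_into (P ` D) (inv_into D P) w in
      herm ?B y (quot_frame \<alpha> y) (quot_frame \<beta> y))"
  have Heq: "H \<alpha> \<beta> w = quot_gram \<alpha> \<beta> w" if "w \<in> D" "\<alpha> \<in> J" "\<beta> \<in> J" for w \<alpha> \<beta>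
  proof -
    have "fst (P w) = pt w" by (simp add: P_eq)
    then show ?thesis
      using quot_herm_eq[OF that] unfolding H_def Let_def inv_inv_P[OF that(1)]
      by (simp add: taut_quotient_def snd_P_k hmet_def)
  qed
  have idxB: "idx ?B = J" by (simp add: taut_quotient_def J_def)
  have fibB: "fib ?B y = quot_module (taut_fib E l y) (snd y k)" for y by (simp add: taut_quotient_def)
  have sm: "smooth I D (H \<alpha> \<beta>)" if "\<alpha> \<in> J" "\<beta> \<in> J" for \<alpha> \<beta>
    by (rule smooth_cong[OF _ quot_gram_smooth[OF that]]) (simp add: Heq that)
  obtain a where a: "chern_connection I D J H a"
    and curv: "\<And>\<alpha> \<beta> u v. \<alpha> \<in> J \<Longrightarrow> \<beta> \<in> J \<Longrightarrow> curvature_matrix I J a (origin I) \<beta> \<alpha> u v =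
       quot_sesq \<alpha> \<beta> v u - quot_sesq \<alpha> \<beta> u v
       - (\<Sum>\<gamma>\<in>J. off v \<gamma> \<alpha> * cnj (off u \<gamma> \<beta>) - off u \<gamma> \<alpha> * cnj (off v \<gamma> \<beta>))"
  proof (rule chern_curvature_of_jet[OF finite_I finite_JK(1) origin_D,
        where H = H and L = "\<lambda>\<alpha> \<beta> w. off w \<beta> \<alpha>" and B = "\<lambda>\<alpha> \<beta> w. cnj (off w \<alpha> \<beta>)" and S = quot_sesq])
    show "smooth I D (H \<alpha> \<beta>)" if "\<alpha> \<in> J" "\<beta> \<in> J" for \<alpha> \<beta> by (rule sm[OF that])
    show "anisotropic J (\<lambda>\<alpha> \<beta>. H \<alpha> \<beta> p)" if "p \<in> D" for p
      using quot_gram_anisotropic[OF that] unfolding anisotropic_def by (simp add: Heq[OF that])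
    show "H \<beta> \<alpha> p = cnj (H \<alpha> \<beta> p)" if "p \<in> D" "\<alpha> \<in> J" "\<beta> \<in> J" for p \<alpha> \<beta>
      unfolding Heq[OF that] Heq[OF that(1,3,2)] by (rule quot_gram_herm[OF that])
    show "(\<lambda>w. H \<alpha> \<beta> w - ((if \<alpha> = \<beta> then 1 else 0) + off w \<beta> \<alpha> + cnj (off w \<alpha> \<beta>) + quot_sesq \<alpha> \<beta> w w)) \<in> bigO_pow I 3"
      if "\<alpha> \<in> J" "\<beta> \<in> J" for \<alpha> \<beta>
    proof -
      have "H \<alpha> \<beta> w - ((if \<alpha> = \<beta> then 1 else 0) + off w \<beta> \<alpha> + cnj (off w \<alpha> \<beta>) + quot_sesq \<alpha> \<beta> w w)
          = quot_gram \<alpha> \<beta> w - (\<delta> \<alpha> \<beta> + off w \<beta> \<alpha> + cnj (off w \<alpha> \<beta>) + quot_sesq \<alpha> \<beta> w w)" if "w \<in> D" for w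
        unfolding Heq[OF that \<open>\<alpha> \<in> J\<close> \<open>\<beta> \<in> J\<close>] \<delta>_def ..
      then show ?thesis
        by (subst landau_o.big.in_cong[OF eventually_mono[OF eventually_domain[OF origin_D]]])
          (assumption, rule quot_gram_jet[OF that])
    qed
  next
    fix a assume 1: "chern_connection I D J H a"
      and 2: "\<And>\<alpha> \<beta> u v. \<alpha> \<in> J \<Longrightarrow> \<beta> \<in> J \<Longrightarrow> curvature_matrix I J a (origin I) \<beta> \<alpha> u v =
       quot_sesq \<alpha> \<beta> v u - quot_sesq \<alpha> \<beta> u v
       - (\<Sum>\<gamma>\<in>J. off v \<gamma> \<alpha> * cnj (off u \<gamma> \<beta>) - off u \<gamma> \<alpha> * cnj (off v \<gamma> \<beta>))"
    show thesis by (rule that[OF 1 2])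
  qed (rule off_lin off_antilin quot_sesq_form | assumption)+
  interpret Q: complex_module "fib ?B (x\<^sub>0, f\<^sub>0)"
    using quot_fibre_module[OF origin_D] unfolding P_origin fibB .
  have B: "is_basis (fib ?B (x\<^sub>0, f\<^sub>0)) J (\<lambda>\<alpha>. quot_frame \<alpha> (x\<^sub>0, f\<^sub>0))"
    using quot_frame_basis[OF origin_D] unfolding P_origin fibB .
  have qf: "quot_frame \<alpha> (x\<^sub>0, f\<^sub>0) = f\<^sub>0 k +>\<^bsub>fib E x\<^sub>0\<^esub> e \<alpha> x\<^sub>0" if "\<alpha> \<in> J" for \<alpha>
  proof -
    have "\<alpha> \<in> {1..r}" using that JK_subset by blast
    then show ?thesis
      using quot_frame_P[OF origin_D, of \<alpha>] snd_P_k[of "origin I"] ep_origin[of \<alpha>]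
      by (simp add: P_origin fibre_def pt_origin del: One_nat_def)
  qed
  have z0: "inv_into D P (x\<^sub>0, f\<^sub>0) = origin I" using inv_P[OF origin_D] P_origin by simp
  have \<Theta>: "end_form (fib ?B (x\<^sub>0, f\<^sub>0)) J (\<lambda>\<alpha>. quot_frame \<alpha> (x\<^sub>0, f\<^sub>0)) (curvature_matrix I J a (origin I))
     = end_form (fib ?B (x\<^sub>0, f\<^sub>0)) J (\<lambda>\<alpha>. f\<^sub>0 k +>\<^bsub>fib E x\<^sub>0\<^esub> e \<alpha> x\<^sub>0)
       curv_form"
  proof (rule Q.end_form_cong)
    show "(\<lambda>\<alpha>. quot_frame \<alpha> (x\<^sub>0, f\<^sub>0)) \<in> J \<rightarrow> carrier (fib ?B (x\<^sub>0, f\<^sub>0))"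
      using B by (simp add: is_basis_def)
  qed (simp_all only: qf curv curvature_terms)
  have x0P: "(x\<^sub>0, f\<^sub>0) \<in> P ` D" using origin_D P_origin by force
  show ?thesis
    unfolding has_chern_curvature_def chart_eq fst_conv snd_conv idxB
  proof (intro exI conjI)
    show "(P ` D, quot_frame) \<in> frames ?B" by (rule quot_frame_mem)
    show "(x\<^sub>0, f\<^sub>0) \<in> P ` D" by (rule x0P)
    show "P ` D \<subseteq> P ` D" by simp
    show "openin (cspace I) (inv_into D P ` P ` D)" unfolding inv_P_image by (rule openin_domain)
    show "H = (\<lambda>\<alpha> \<beta> w. let y = inv_into (P ` D) (inv_into D P) w in
        herm ?B y (quot_frame \<alpha> y) (quot_frame \<beta> y))" by (rule H_def)
    show "\<forall>\<alpha>\<in>J. \<forall>\<beta>\<in>J. smooth I (inv_into D P ` P ` D) (H \<alpha> \<beta>)"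
      unfolding inv_P_image using sm by blast
    show "chern_connection I (inv_into D P ` P ` D) J H a"
      unfolding inv_P_image by (rule a)
  qed (simp only: z0 \<Theta>)
qed

end

theorem theorem2p1:
  fixes n r m k l :: nat and \<rho> :: "nat \<Rightarrow> nat"
    and X :: "'x set" and A :: "('x, nat) chart set" and E :: "('x, 'v) hbundle"
    and U :: "'x set" and z :: "'x \<Rightarrow> nat \<Rightarrow> complex" and e :: "nat \<Rightarrow> 'x \<Rightarrow> 'v"
    and x\<^sub>0 :: 'x and f\<^sub>0 :: "nat \<Rightarrow> 'v set"
    and c :: "nat \<Rightarrow> nat \<Rightarrow> nat \<Rightarrow> nat \<Rightarrow> complex"
  assumes "complex_manifold {1..n} X A"
    and "hermitian_holomorphic_bundle {1..n} X A E" and "idx E = {1..r}"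
    and "dimension_sequence r m \<rho>"
    and "(x\<^sub>0, f\<^sub>0) \<in> flag_bundle X E m \<rho>"
    and "(U, z) \<in> A" and "normal_frame n (U, z) E e x\<^sub>0 c"
    and "\<forall>i\<le>m. f\<^sub>0 i = lspan (fib E x\<^sub>0) {r - \<rho> i<..r} (\<lambda>\<alpha>. e \<alpha> x\<^sub>0)"
    and "k < l" and "l \<le> m"
  shows "has_chern_curvature (flag_index n r m \<rho>) (flag_chart n r m \<rho> E (U, z) e)
           (taut_quotient n r m \<rho> X A E l k) (x\<^sub>0, f\<^sub>0)
           (end_form (fib (taut_quotient n r m \<rho> X A E l k) (x\<^sub>0, f\<^sub>0)) {r - \<rho> l<..r - \<rho> k}
             (\<lambda>\<alpha>. f\<^sub>0 k +>\<^bsub>fib E x\<^sub>0\<^esub> e \<alpha> x\<^sub>0)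
             (\<lambda>\<beta> \<alpha> u v. base_curv n Inl c \<beta> \<alpha> u v
                - (\<Sum>\<nu>\<in>{1..r - \<rho> l}. wedge (d_coord (Inr (\<nu>, \<alpha>))) (d_coord_bar (Inr (\<nu>, \<beta>))) u v)
                + (\<Sum>\<mu>\<in>{r - \<rho> k<..r}. wedge (d_coord (Inr (\<beta>, \<mu>))) (d_coord_bar (Inr (\<alpha>, \<mu>))) u v)))"
proof -
  interpret flag_frame n r m k l \<rho> X A E U z e x\<^sub>0 f\<^sub>0 c
    by unfold_locales (fact assms)+
  show ?thesis using curvature unfolding I_def J_def curv_form_def[abs_def] .
qed

end
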